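(* Let $n\ge 1$ be an integer, $\vec a=(a_1,a_2),\vec b=(b_1,b_2),\vec c=(c_1,c_2)\in\mathbb{R}^2$, and $\vec\alpha=(\alpha_1,\alpha_2),\vec\beta=(\beta_1,\beta_2)\in(-1,\infty)^2$. Let $\vec p=(1,1)$ and $\vec q=(q_1,q_2)\in[1,\infty)^2$. Then the following statements are equivalent. (i) The operator $S_{\vec a,\vec b,\vec c}$ is bounded from $L^{\vec p}_{\vec\alpha}$ to $L^{\vec q}_{\vec\beta}$. (ii) The operator $T_{\vec a,\vec b,\vec c}$ is bounded from $L^{\vec p}_{\vec\alpha}$ to $L^{\vec q}_{\vec\beta}$. (iii) One of the following four alternatives holds: (A) for every $i\in\{1,2\}$: $-q_ia_i<\beta_i+1$, $\alpha_i<b_i$, and $c_i\le a_i+b_i-\alpha_i+\frac{n+1+\beta_i}{q_i}$; or (B) for every $i\in\{1,2\}$: $-q_ia_i<\beta_i+1$, $\alpha_i=b_i$, and $c_i<a_i+\frac{n+1+\beta_i}{q_i}$; or (C) $-q_ia_i<\beta_i+1$ for every $i\in\{1,2\}$, $\ \alpha_1=b_1$, $\ c_1<a_1+\frac{n+1+\beta_1}{q_1}$, $\ \alpha_2<b_2$, and $c_2\le a_2+b_2-\alpha_2+\frac{n+1+\beta_2}{q_2}$; or (D) $-q_ia_i<\beta_i+1$ for every $i\in\{1,2\}$, $\ \alpha_1<b_1$, $\ c_1\le a_1+b_1-\alpha_1+\frac{n+1+\beta_1}{q_1}$, $\ \alpha_2=b_2$, and $c_2<a_2+\frac{n+1+\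beta_2}{q_2}$.
   Context: $\mathbb{B}_n$ is the open unit ball of $\mathbb{C}^n$, $\langle z,w\rangle=\sum_j z_j\overline{w_j}$, and $dv$ is Lebesgue volume measure on $\mathbb{B}_n$ normalized so that $v(\mathbb{B}_n)=1$. For $\theta>-1$, $dv_\theta(z)=c_\theta(1-|z|^2)^\theta dv(z)$ with $c_\theta=\frac{\Gamma(n+\theta+1)}{n!\,\Gamma(\theta+1)}$, so $v_\theta(\mathbb{B}_n)=1$. For $\vec p=(p_1,p_2)\in[1,\infty]^2$ and $\vec\alpha\in(-1,\infty)^2$, $L^{\vec p}_{\vec\alpha}$ is the space of measurable $f$ on $\mathbb{B}_n\times\mathbb{B}_n$ with $$\|f\|_{L^{\vec p}_{\vec\alpha}}=\Big\{\int_{\mathbb{B}_n}\Big[\int_{\mathbb{B}_n}|f(z,w)|^{p_1}dv_{\alpha_1}(z)\Big]^{p_2/p_1}dv_{\alpha_2}(w)\Big\}^{1/p_2}<\infty$$ (usual modifications when some $p_i=\infty$). The operators are $$T_{\vec a,\vec b,\vec c}f(z,w)=(1-|z|^2)^{a_1}(1-|w|^2)^{a_2}\int_{\mathbb{B}_n}\int_{\mathbb{B}_n}\frac{(1-|u|^2)^{b_1}(1-|\eta|^2)^{b_2}}{(1-\langle z,u\rangle)^{c_1}(1-\langle w,\eta\rangle)^{c_2}}f(u,\eta)\,dv(u)\,dv(\eta),$$ $$S_{\vec a,\vec b,\vec c}f(z,w)=(1-|z|^2)^{a_1}(1-|w|^2)^{a_2}\int_{\mathbb{B}_n}\int_{\mathbb{B}_n}\frac{(1-|u|^2)^{b_1}(1-|\eta|^2)^{b_2}}{|1-\langle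 z,u\rangle|^{c_1}|1-\langle w,\eta\rangle|^{c_2}}f(u,\eta)\,dv(u)\,dv(\eta),$$ with principal branches of complex powers. Bounded from $X$ to $Y$ means $\|Tf\|_Y\le C\|f\|_X$ for all $f\in X$ with a constant $C$ independent of $f$. *)

theory Defs
  imports "HOL-Analysis.Analysis"
begin

text \<open>
  \<open>\<complex>\<^sup>n\<close> is \<open>complex ^ 'n\<close> with \<open>n = CARD('n)\<close>. Functions on \<open>\<bbbB>\<^sub>n \<times> \<bbbB>\<^sub>n\<close> are total functions whose
  values off the product of balls are never used, because all measures below live on the ball.
\<close>

type_synonym 'n cpair = "(complex ^ 'n) \<times> (complex ^ 'n)"

definition unit_ball :: "(complex ^ 'n) set" where
  "unit_ball = ball 0 1"

definition herm :: "complex ^ 'n \<Rightarrow> complex ^ 'n \<Rightarrow> complex" where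
  "herm z w = (\<Sum>j\<in>UNIV. z $ j * cnj (w $ j))"

definition vol :: "(complex ^ 'n) measure" where
  "vol = uniform_measure (restrict_space lborel unit_ball) unit_ball"

definition c_const :: "nat \<Rightarrow> real \<Rightarrow> real" where
  "c_const n \<theta> = Gamma (real n + \<theta> + 1) / (fact n * Gamma (\<theta> + 1))"

definition vol_weighted :: "real \<Rightarrow> (complex ^ 'n) measure" where
  "vol_weighted \<theta> = density vol (\<lambda>z. ennreal (c_const CARD('n) \<theta> * (1 - (norm z)\<^sup>2) powr \<theta>))"

text \<open>Power of an extended nonnegative real, meant for exponents \<open>r > 0\<close>, so that \<open>\<infinity>\<^sup>r = \<infinity>\<close>.\<close>

definition epowr :: "ennreal \<Rightarrow> real \<Rightarrow> ennreal" where
  "epowr x r = (if x = \<infinity> then \<infinity> else ennreal (enn2real x powr r))"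

text \<open>
  The mixed norm for finite exponents: the inner integral, with \<open>p\<^sub>1\<close> and \<open>\<alpha>\<^sub>1\<close>, is over the first
  variable. Elements of the space are represented by Borel functions; every Lebesgue measurable
  function agrees almost everywhere with one of these.
\<close>

definition mixed_norm ::
  "real ^ 2 \<Rightarrow> real ^ 2 \<Rightarrow> (('n::finite) cpair \<Rightarrow> complex) \<Rightarrow> ennreal" where
  "mixed_norm p \<alpha> f =
     epowr (\<integral>\<^sup>+ w. epowr (\<integral>\<^sup>+ z. ennreal (norm (f (z, w)) powr (p $ 1)) \<partial>vol_weighted (\<alpha> $ 1))
                       (p $ 2 / p $ 1) \<partial>vol_weighted (\<alpha> $ 2))
           (1 / p $ 2)"

definition mixed_L ::
  "real ^ 2 \<Rightarrow> real ^ 2 \<Rightarrow> (('n::finite) cpair \<Rightarrow> complex) set" where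
  "mixed_L p \<alpha> = {f \<in> borel_measurable (vol \<Otimes>\<^sub>M vol). mixed_norm p \<alpha> f < \<infinity>}"

definition T_kernel ::
  "real ^ 2 \<Rightarrow> real ^ 2 \<Rightarrow> ('n::finite) cpair \<Rightarrow> 'n cpair \<Rightarrow> complex" where
  "T_kernel b c = (\<lambda>(z, w) (u, \<eta>).
     of_real ((1 - (norm u)\<^sup>2) powr (b $ 1) * (1 - (norm \<eta>)\<^sup>2) powr (b $ 2)) /
     ((1 - herm z u) powr of_real (c $ 1) * (1 - herm w \<eta>) powr of_real (c $ 2)))"

definition S_kernel ::
  "real ^ 2 \<Rightarrow> real ^ 2 \<Rightarrow> ('n::finite) cpair \<Rightarrow> 'n cpair \<Rightarrow> complex" where
  "S_kernel b c = (\<lambda>(z, w) (u, \<eta>).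
     of_real ((1 - (norm u)\<^sup>2) powr (b $ 1) * (1 - (norm \<eta>)\<^sup>2) powr (b $ 2) /
       (norm (1 - herm z u) powr (c $ 1) * norm (1 - herm w \<eta>) powr (c $ 2))))"

definition kernel_op ::
  "real ^ 2 \<Rightarrow> (('n::finite) cpair \<Rightarrow> 'n cpair \<Rightarrow> complex) \<Rightarrow>
   ('n cpair \<Rightarrow> complex) \<Rightarrow> 'n cpair \<Rightarrow> complex" where
  "kernel_op a K f = (\<lambda>(z, w).
     of_real ((1 - (norm z)\<^sup>2) powr (a $ 1) * (1 - (norm w)\<^sup>2) powr (a $ 2)) *
     (\<integral>x. K (z, w) x * f x \<partial>(vol \<Otimes>\<^sub>M vol)))"

text \<open>
  Since the Bochner integral of a non-integrable function is \<open>0\<close> by convention, boundedness has to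
  require that the defining integral converges absolutely. For both kernels this does not depend
  on the point \<open>(z, w)\<close>, as the denominator is bounded above and away from \<open>0\<close> for fixed \<open>(z, w)\<close>.
\<close>

definition kernel_op_bounded ::
  "real ^ 2 \<Rightarrow> (('n::finite) cpair \<Rightarrow> 'n cpair \<Rightarrow> complex) \<Rightarrow>
   ('n cpair \<Rightarrow> complex) set \<Rightarrow>
   (('n cpair \<Rightarrow> complex) \<Rightarrow> ennreal) \<Rightarrow>
   ('n cpair \<Rightarrow> complex) set \<Rightarrow>
   (('n cpair \<Rightarrow> complex) \<Rightarrow> ennreal) \<Rightarrow> bool" where
  "kernel_op_bounded a K X normX Y normY \<longleftrightarrow>
     (\<exists>C::real. \<forall>f\<in>X.
        (\<forall>z\<in>unit_ball. \<forall>w\<in>unit_ball. integrable (vol \<Otimes>\<^sub>M vol) (\<lambda>x. K (z, w) x * f x)) \<and>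
        kernel_op a K f \<in> Y \<and>
        normY (kernel_op a K f) \<le> ennreal C * normX f)"

definition T_bounded ::
  "'n::finite itself \<Rightarrow> real ^ 2 \<Rightarrow> real ^ 2 \<Rightarrow> real ^ 2 \<Rightarrow>
   real ^ 2 \<Rightarrow> real ^ 2 \<Rightarrow> real ^ 2 \<Rightarrow> real ^ 2 \<Rightarrow> bool" where
  "T_bounded _ a b c p \<alpha> q \<beta> \<longleftrightarrow>
     kernel_op_bounded a (T_kernel b c :: 'n cpair \<Rightarrow> _)
       (mixed_L p \<alpha>) (mixed_norm p \<alpha>) (mixed_L q \<beta>) (mixed_norm q \<beta>)"

definition S_bounded ::
  "'n::finite itself \<Rightarrow> real ^ 2 \<Rightarrow> real ^ 2 \<Rightarrow> real ^ 2 \<Rightarrow>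
   real ^ 2 \<Rightarrow> real ^ 2 \<Rightarrow> real ^ 2 \<Rightarrow> real ^ 2 \<Rightarrow> bool" where
  "S_bounded _ a b c p \<alpha> q \<beta> \<longleftrightarrow>
     kernel_op_bounded a (S_kernel b c :: 'n cpair \<Rightarrow> _)
       (mixed_L p \<alpha>) (mixed_norm p \<alpha>) (mixed_L q \<beta>) (mixed_norm q \<beta>)"

end

theory Submission
  imports Defs
begin

text \<open>
  On \<open>L\<^sup>1\<close> with weights \<open>\<alpha>\<close> an integral operator is bounded if and only if its kernel, divided by the
  weight, has uniformly bounded norm as a function of the first variable. This kernel is a product
  of two one-variable factors, so boundedness splits into the condition, for \<open>i = 1, 2\<close>, that
  \<open>(1 - |u|\<^sup>2)\<^bsup>q(b-\<alpha>)\<^esup> \<integral> (1 - |z|\<^sup>2)\<^bsup>qa+\<beta>\<^esup> |1 - \<langle>z,u\<rangle>|\<^bsup>-qc\<^esup> dv(z)\<close> is bounded in \<open>u\<close>. The Forelli--Rudin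
  estimate decides when this happens: with \<open>t = qa + \<beta>\<close>, the weighted volume of a cap
  \<open>{z. |1 - \<langle>z,u\<rangle>| < r}\<close> is of order \<open>r\<^bsup>n+1+t\<^esup>\<close>. For necessity, testing on indicators of small
  balls recovers the size of the kernel, and the integral is bounded below on boxes that shrink to
  a boundary point.
\<close>

subsection \<open>The Hermitian form and Lebesgue measure\<close>

text \<open>Two obstacles shape the proof. First, nothing is integrated over spheres: caps are put
  into boxes by linear coordinate changes, and a weight that blows up at the sphere is controlled by
  averaging. Second, the kernel of \<open>T\<close> is complex, so a lower bound for its output has
  to exclude cancellation. On a ball whose radius is a small multiple of the distance to the sphere,
  \<open>1 - herm z u\<close> changes only by a small proportion, uniformly in \<open>z\<close>; as
  principal powers are multiplicative in the right half-plane, the kernel does so too. Up to a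
  constant, \<open>T\<close> is therefore as large on such test functions as \<open>S\<close>, which
  is why both operators have the same condition. A test function occupies both variables at once and
  bounds only the product of two one-variable norms. Placing one center at the origin, where the
  norm is bounded below by a positive constant, isolates the other. The strict inequality in the
  case \<open>b = \<alpha>\<close> cannot be read off from interior points through powers alone: it
  comes from a boundary point, reached by Fatou's lemma, at which the integral diverges for the
  critical exponent.\<close>

lemma herm_diff_right: "herm z (u - v) = herm z u - herm z v"
  by (simp add: herm_def algebra_simps sum_subtractf)

lemma herm_add_left: "herm (x + y) u = herm x u + herm y u"
  by (simp add: herm_def algebra_simps sum.distrib)

lemma herm_scaleR_left: "herm (r *\<^sub>R x) u = r *\<^sub>R herm x u"
  by (simp add: herm_def scaleR_sum_right)

lemma Re_herm: "Re (herm z u) = inner z u"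
  by (simp add: herm_def inner_vec_def inner_complex_def)

lemma norm_herm_le: "norm (herm z u) \<le> norm z * norm u"
proof -
  have "norm (herm z u) \<le> (\<Sum>j\<in>UNIV. norm (z $ j * cnj (u $ j)))"
    unfolding herm_def by (rule norm_sum)
  also have "\<dots> = (\<Sum>j\<in>UNIV. \<bar>norm (z $ j)\<bar> * \<bar>norm (u $ j)\<bar>)"
    by (simp add: norm_mult)
  also have "\<dots> \<le> norm z * norm u"
    unfolding norm_vec_def by (rule L2_set_mult_ineq)
  finally show ?thesis .
qed

lemma continuous_on_herm [continuous_intros]:
  assumes "continuous_on S f" "continuous_on S g"
  shows "continuous_on S (\<lambda>x. herm (f x) (g x))"
  unfolding herm_def by (intro continuous_intros assms)

lemma borel_measurable_herm [measurable (raw)]: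
  fixes f g :: "'a \<Rightarrow> complex ^ 'n"
  assumes [measurable]: "f \<in> borel_measurable M" "g \<in> borel_measurable M"
  shows "(\<lambda>x. herm (f x) (g x)) \<in> borel_measurable M"
proof -
  have "(\<lambda>p. herm (fst p) (snd p)) \<in> borel_measurable (borel :: ((complex ^ 'n) \<times> (complex ^ 'n)) measure)"
    by (intro borel_measurable_continuous_onI continuous_intros)
  moreover have "(\<lambda>x. (f x, g x)) \<in> M \<rightarrow>\<^sub>M borel"
    by measurable
  ultimately show ?thesis
    using measurable_compose[of "\<lambda>x. (f x, g x)" M borel "\<lambda>p. herm (fst p) (snd p)" borel] by simp
qed

lemma norm_1_minus_herm_ge: "norm z \<le> 1 \<Longrightarrow> norm u \<le> 1 \<Longrightarrow> 1 - norm z \<le> norm (1 - herm z u)"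
  "norm z \<le> 1 \<Longrightarrow> norm u \<le> 1 \<Longrightarrow> 1 - norm u \<le> norm (1 - herm z u)"
proof -
  have *: "1 - norm z * norm u \<le> norm (1 - herm z u)"
    using norm_triangle_ineq2[of 1 "herm z u"] norm_herm_le[of z u] by simp
  show "norm z \<le> 1 \<Longrightarrow> norm u \<le> 1 \<Longrightarrow> 1 - norm z \<le> norm (1 - herm z u)"
    using * mult_left_le[of "norm u" "norm z"] by simp
  show "norm z \<le> 1 \<Longrightarrow> norm u \<le> 1 \<Longrightarrow> 1 - norm u \<le> norm (1 - herm z u)"
    using * mult_right_le_one_le[of "norm u" "norm z"] by (simp add: mult.commute)
qed

lemma norm_1_minus_herm_le: "norm z \<le> 1 \<Longrightarrow> norm u \<le> 1 \<Longrightarrow> norm (1 - herm z u) \<le> 2"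
  using norm_triangle_ineq4[of 1 "herm z u"] norm_herm_le[of z u]
    mult_mono[of "norm z" 1 "norm u" 1] by simp

text \<open>Keeps every argument of a principal power in the open right half-plane. Boundary points
  \<open>u\<close> are included because the kernel is later evaluated at
  \<open>axis j 1\<close>.\<close>

lemma Re_1_minus_herm_pos: "norm z < 1 \<Longrightarrow> norm u \<le> 1 \<Longrightarrow> 0 < Re (1 - herm z u)"
proof -
  assume "norm z < 1" "norm u \<le> 1"
  then have "norm z * norm u < 1"
    using mult_left_le[of "norm u" "norm z"] by simp
  then show ?thesis
    using norm_herm_le[of z u] complex_Re_le_cmod[of "herm z u"] by simp
qed

lemma unit_ball_iff: "z \<in> unit_ball \<longleftrightarrow> norm z < 1"
  by (simp add: unit_ball_def)

lemma unit_ball_borel [measurable]: "unit_ball \<in> sets borel"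
  by (simp add: unit_ball_def)

lemma emeasure_lborel_ball_pos:
  fixes x :: "'a::euclidean_space"
  assumes "0 < r" shows "0 < emeasure lborel (ball x r)"
proof -
  have "emeasure lborel (ball x r) \<noteq> 0"
  proof
    assume "emeasure lborel (ball x r) = 0"
    then have "ball x r \<in> null_sets lborel" by (intro null_setsI) auto
    then have "negligible (ball x r)"
      by (simp add: null_sets_completionI negligible_iff_null_sets)
    then show False using open_not_negligible[of "ball x r"] assms by auto
  qed
  then show ?thesis by (simp add: zero_less_iff_neq_zero)
qed

lemma nn_integral_lborel_affine:
  fixes f :: "'a::euclidean_space \<Rightarrow> ennreal"
  assumes [measurable]: "f \<in> borel_measurable borel" and "c \<noteq> 0"
  shows "(\<integral>\<^sup>+x. f x \<partial>lborel) = ennreal (\<bar>c\<bar> ^ DIM('a)) * (\<integral>\<^sup>+x. f (t + c *\<^sub>R x) \<partial>lborel)"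
proof -
  have "(\<integral>\<^sup>+x. f x \<partial>lborel) =
      (\<integral>\<^sup>+x. f x \<partial>density (distr lborel borel (\<lambda>x. t + c *\<^sub>R x)) (\<lambda>_. ennreal (\<bar>c\<bar> ^ DIM('a))))"
    using lborel_affine[OF \<open>c \<noteq> 0\<close>, of t] by simp
  also have "\<dots> = (\<integral>\<^sup>+x. ennreal (\<bar>c\<bar> ^ DIM('a)) * f x \<partial>distr lborel borel (\<lambda>x. t + c *\<^sub>R x))"
    by (rule nn_integral_density) auto
  also have "\<dots> = (\<integral>\<^sup>+x. ennreal (\<bar>c\<bar> ^ DIM('a)) * f (t + c *\<^sub>R x) \<partial>lborel)"
    by (rule nn_integral_distr) auto
  also have "\<dots> = ennreal (\<bar>c\<bar> ^ DIM('a)) * (\<integral>\<^sup>+x. f (t + c *\<^sub>R x) \<partial>lborel)"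
    by (rule nn_integral_cmult) auto
  finally show ?thesis .
qed

text \<open>This is the uniqueness of Haar measure: the image of Lebesgue measure under \<open>M\<close> is
  translation invariant, hence a multiple of Lebesgue measure, and the unit ball bounds the factor.\<close>

lemma emeasure_linear_vimage_le:
  fixes M :: "'a::euclidean_space \<Rightarrow> 'a"
  assumes M: "linear M" and K: "\<And>x. norm x \<le> K * norm (M x)" "0 < K"
    and A [measurable]: "A \<in> sets borel"
  shows "emeasure lborel (M -` A) * emeasure lborel (ball (0::'a) 1)
    \<le> emeasure lborel A * emeasure lborel (ball (0::'a) K)"
proof -
  define B where "B = ball (0::'a) 1"
  have [measurable]: "B \<in> sets borel"
    by (simp add: B_def)
  have [measurable]: "M \<in> borel_measurable borel"
    using M by (intro borel_measurable_continuous_onI linear_continuous_on)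
      (simp add: linear_conv_bounded_linear)
  have "inj M"
    using K by (subst linear_injective_0[OF M]) (metis mult_zero_right norm_le_zero_iff norm_zero)
  then have "surj M"
    using \<open>inj M\<close> M by (simp add: linear_injective_imp_surjective)
  then obtain N where N: "M (N y) = y" for y
    by (metis surj_f_inv_f)
  have vim: "emeasure lborel (M -` S) = (\<integral>\<^sup>+x. indicator S (M x) \<partial>lborel)" if [measurable]: "S \<in> sets borel" for S
  proof -
    have "M -` S \<in> sets borel"
      using measurable_sets[of M borel borel S] by simp
    then have "emeasure lborel (M -` S) = (\<integral>\<^sup>+x. indicator (M -` S) x \<partial>lborel)"
      by simp
    also have "\<dots> = (\<integral>\<^sup>+x. indicator S (M x) \<partial>lborel)"
      by (intro nn_integral_cong) (simp add: indicator_def)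
    finally show ?thesis .
  qed
  have B_shift: "(\<integral>\<^sup>+y. indicator B (c + y) \<partial>lborel) = emeasure lborel B" for c
    using nn_integral_lborel_affine[where c=1 and t=c, OF borel_measurable_indicator[of B]] by simp
  have A': "(\<integral>\<^sup>+y. indicator A (c - y) \<partial>lborel) = emeasure lborel A" for c
    using nn_integral_lborel_affine[where c="-1" and t=c, OF borel_measurable_indicator[of A]] by simp
  \<comment> \<open>The double integral of \<open>indicator A (M x) * indicator B (M x + y)\<close>
    is computed in two ways; here the \<open>y\<close>-integral gives the volume of \<open>B\<close>
    by translation invariance.\<close>
  have "emeasure lborel (M -` A) * emeasure lborel B
      = (\<integral>\<^sup>+x. indicator A (M x) * (\<integral>\<^sup>+y. indicator B (M x + y) \<partial>lborel) \<partial>lborel)"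
    by (simp add: vim B_shift nn_integral_multc)
  also have "\<dots> = (\<integral>\<^sup>+x. (\<integral>\<^sup>+y. indicator A (M x) * indicator B (M x + y) \<partial>lborel) \<partial>lborel)"
    by (intro nn_integral_cong nn_integral_cmult[symmetric]) measurable
  also have "\<dots> = (\<integral>\<^sup>+y. (\<integral>\<^sup>+x. indicator A (M x) * indicator B (M x + y) \<partial>lborel) \<partial>lborel)"
    by (rule lborel_pair.Fubini') measurable
  \<comment> \<open>Shifting \<open>x\<close> by \<open>- N y\<close>, with \<open>N\<close> a right
    inverse of \<open>M\<close>, moves the translation from \<open>B\<close> to \<open>A\<close>;
    now the \<open>y\<close>-integral gives the volume of \<open>A\<close>.\<close>
  also have "\<dots> = (\<integral>\<^sup>+y. (\<integral>\<^sup>+x. indicator A (M x - y) * indicator B (M x) \<partial>lborel) \<partial>lborel)"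
  proof (rule nn_integral_cong)
    fix y
    have [measurable]: "(\<lambda>x. indicator A (M x) * indicator B (M x + y) :: ennreal) \<in> borel_measurable borel"
      by measurable
    have "M (- N y + x) = M x - y" for x
      by (simp add: linear_diff[OF M] N)
    then show "(\<integral>\<^sup>+x. indicator A (M x) * indicator B (M x + y) \<partial>lborel) =
      (\<integral>\<^sup>+x. indicator A (M x - y) * indicator B (M x) \<partial>lborel)"
      using nn_integral_lborel_affine[where c=1 and t="- N y" and
          f="\<lambda>x. indicator A (M x) * indicator B (M x + y) :: ennreal"]
      by simp
  qed
  also have "\<dots> = (\<integral>\<^sup>+x. (\<integral>\<^sup>+y. indicator A (M x - y) * indicator B (M x) \<partial>lborel) \<partial>lborel)"
    by (rule lborel_pair.Fubini') measurable
  also have "\<dots> = (\<integral>\<^sup>+x. emeasure lborel A * indicator B (M x) \<partial>lborel)"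
    by (rule nn_integral_cong, subst nn_integral_multc) (auto simp: A')
  also have "\<dots> = emeasure lborel A * emeasure lborel (M -` B)"
    by (subst nn_integral_cmult) (simp_all add: vim)
  also have "\<dots> \<le> emeasure lborel A * emeasure lborel (ball (0::'a) K)"
  proof (intro mult_left_mono emeasure_mono subsetI)
    fix x assume "x \<in> M -` B"
    then have "K * norm (M x) < K * 1"
      using K(2) by (intro mult_strict_left_mono) (auto simp: B_def)
    then show "x \<in> ball 0 K"
      using K(1)[of x] by simp
  qed auto
  finally show ?thesis by (simp add: B_def)
qed

text \<open>The half-width \<open>h k\<close> may vary with the complex coordinate, since a
  nonisotropic box has one complex direction of size \<open>r\<close> and the others of size
  \<open>sqrt r\<close>.\<close>

lemma emeasure_lborel_polybox:
  fixes a :: "complex ^ 'n" and h :: "'n \<Rightarrow> real"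
  assumes h: "\<And>k. 0 \<le> h k"
  defines "S \<equiv> {y. \<forall>k. \<bar>Re (y $ k - a $ k)\<bar> \<le> h k \<and> \<bar>Im (y $ k - a $ k)\<bar> \<le> h k}"
  shows "S \<in> sets borel" "emeasure lborel S = ennreal (\<Prod>k\<in>UNIV. (2 * h k)\<^sup>2)"
proof -
  define d :: "complex ^ 'n" where "d = (\<chi> k. Complex (h k) (h k))"
  have basis: "Basis = (\<Union>k. {axis k 1, axis k \<i>}) " 
    by (auto simp: Basis_vec_def Basis_complex_def)
  have S: "S = cbox (a - d) (a + d)"
    unfolding S_def
    by (auto simp: mem_box basis inner_axis d_def inner_complex_def algebra_simps abs_le_iff)
  then show "S \<in> sets borel" by simp
  have "emeasure lborel S = (\<Prod>b\<in>Basis. ((a + d) - (a - d)) \<bullet> b)"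
    unfolding S using h
    by (intro emeasure_lborel_cbox) (auto simp: basis inner_axis d_def inner_complex_def)
  also have "(\<Prod>b\<in>Basis. ((a + d) - (a - d)) \<bullet> b) = (\<Prod>k\<in>UNIV. \<Prod>b\<in>{axis k 1, axis k \<i>}. ((a + d) - (a - d)) \<bullet> b)"
    unfolding basis by (intro prod.UNION_disjoint) (auto simp: axis_eq_axis)
  also have "\<dots> = (\<Prod>k\<in>UNIV. (2 * h k)\<^sup>2)"
    by (intro prod.cong refl)
      (auto simp: axis_eq_axis inner_axis d_def inner_complex_def power2_eq_square algebra_simps complex_eq_iff)
  finally show "emeasure lborel S = ennreal (\<Prod>k\<in>UNIV. (2 * h k)\<^sup>2)" .
qed

subsection \<open>Volumes of nonisotropic caps\<close>

lemma ennreal_le_divideI: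
  assumes "x * ennreal v \<le> ennreal y" "0 < v" "0 \<le> y"
  shows "x \<le> ennreal (y / v)"
proof (cases x)
  case (real a)
  then have "a * v \<le> y"
    using assms by (simp add: ennreal_mult[symmetric])
  then show ?thesis
    using real assms by (auto simp: pos_le_divide_eq intro!: ennreal_leI)
next
  case top
  then show ?thesis using assms by (simp add: ennreal_top_mult top_unique)
qed

text \<open>For \<open>norm u \<ge> 1/2\<close> some coordinate \<open>u\<^sub>j\<close> is bounded below, and replacing the coordinate
  \<open>z\<^sub>j\<close> by \<open>herm z u\<close> puts the cap into a box with sides of order \<open>r\<close> in the \<open>j\<close>-th complex
  direction and of order \<open>sqrt r\<close> in the others, because \<open>(norm (z - u))\<^sup>2 \<le> 2 * r\<close>.\<close>

lemma emeasure_cap_le_aux: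
  fixes u :: "complex ^ 'n"
  assumes u: "1/2 \<le> norm u" "norm u < 1" and r: "0 < r"
  defines "n \<equiv> real CARD('n)"
  shows "emeasure lborel {z. norm z < 1 \<and> norm (1 - herm z u) < r} * emeasure lborel (ball (0::complex^'n) 1)
    \<le> ennreal (8 ^ CARD('n) * r ^ (CARD('n) + 1)) * emeasure lborel (ball (0::complex^'n) (n + 2 * n * (1 + n)))"
proof -
  \<comment> \<open>\<open>K\<close> bounds the inverse of the coordinate change \<open>M\<close>:
    recovering the \<open>j\<close>-th coordinate costs \<open>2 * n * (1 + n)\<close>, and the
    remaining ones together cost at most \<open>n\<close>.\<close>
  define K where "K = n + 2 * n * (1 + n)"
  have n: "1 \<le> n"
    unfolding n_def by (simp add: Suc_leI)
  have "\<exists>j. 1 / (2 * n) \<le> norm (u $ j)"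
  proof (rule ccontr)
    assume "\<nexists>j. 1 / (2 * n) \<le> norm (u $ j)"
    then have "norm (u $ j) < 1 / (2 * n)" for j
      by (simp add: not_le)
    then have "(\<Sum>j\<in>UNIV. norm (u $ j)) < (\<Sum>j\<in>(UNIV::'n set). 1 / (2 * n))"
      by (intro sum_strict_mono) auto
    also have "\<dots> = 1/2" using n by (simp add: n_def)
    also have "\<dots> \<le> norm u" by fact
    also have "\<dots> \<le> (\<Sum>j\<in>UNIV. norm (u $ j))"
      unfolding norm_vec_def by (rule L2_set_le_sum) simp
    finally show False by simp
  qed
  then obtain j where j: "1 / (2 * n) \<le> norm (u $ j)" ..
  have uj: "norm (u $ k) \<le> 1" for k
    using u Finite_Cartesian_Product.norm_nth_le[of u k] by simp
  define M where "M = (\<lambda>z::complex^'n. \<chi> k. if k = j then herm z u else z $ k)"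
  have lin: "linear M"
    by (rule linearI) (auto simp: M_def vec_eq_iff herm_add_left herm_scaleR_left)
  have bound: "norm x \<le> K * norm (M x)" for x
  proof -
    have k: "norm (x $ k) \<le> norm (M x)" if "k \<noteq> j" for k
      using Finite_Cartesian_Product.norm_nth_le[of "M x" k] that by (simp add: M_def)
    have "herm x u = x $ j * cnj (u $ j) + (\<Sum>k\<in>UNIV - {j}. x $ k * cnj (u $ k))"
      unfolding herm_def by (simp add: sum.remove[of UNIV j])
    then have "norm (x $ j) * norm (u $ j) = norm (herm x u - (\<Sum>k\<in>UNIV - {j}. x $ k * cnj (u $ k)))"
      by (simp add: norm_mult)
    also have "\<dots> \<le> norm (herm x u) + norm (\<Sum>k\<in>UNIV - {j}. x $ k * cnj (u $ k))"
      by (rule norm_triangle_ineq4)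
    also have "norm (herm x u) \<le> norm (M x)"
      using Finite_Cartesian_Product.norm_nth_le[of "M x" j] by (simp add: M_def)
    also have "norm (\<Sum>k\<in>UNIV - {j}. x $ k * cnj (u $ k)) \<le> (\<Sum>k\<in>UNIV - {j}. norm (M x))"
      by (rule sum_norm_le) (auto simp: norm_mult intro: order_trans[OF mult_left_le k] uj)
    also have "\<dots> \<le> n * norm (M x)"
      unfolding n_def by (simp add: mult_right_mono)
    finally have "norm (x $ j) * norm (u $ j) \<le> (1 + n) * norm (M x)"
      by (simp add: algebra_simps)
    moreover have "norm (x $ j) * (1 / (2 * n)) \<le> norm (x $ j) * norm (u $ j)"
      using j by (intro mult_left_mono) auto
    ultimately have "norm (x $ j) / (2 * n) \<le> (1 + n) * norm (M x)"
      by simp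
    then have j': "norm (x $ j) \<le> 2 * n * (1 + n) * norm (M x)"
      using n by (simp add: pos_divide_le_eq algebra_simps)
    have "norm x \<le> (\<Sum>k\<in>UNIV. norm (x $ k))"
      unfolding norm_vec_def by (rule L2_set_le_sum) simp
    also have "\<dots> = norm (x $ j) + (\<Sum>k\<in>UNIV - {j}. norm (x $ k))"
      by (simp add: sum.remove[of UNIV j])
    also have "(\<Sum>k\<in>UNIV - {j}. norm (x $ k)) \<le> (\<Sum>k\<in>UNIV - {j}. norm (M x))"
      using k by (intro sum_mono) auto
    also have "\<dots> \<le> n * norm (M x)"
      unfolding n_def by (simp add: mult_right_mono)
    finally show ?thesis using j' by (simp add: K_def algebra_simps)
  qed
  define h where "h = (\<lambda>k. if k = j then r else sqrt (2 * r))"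
  define a where "a = (\<chi> k. if k = j then 1 else u $ k)"
  define A where "A = {y. \<forall>k. \<bar>Re (y $ k - a $ k)\<bar> \<le> h k \<and> \<bar>Im (y $ k - a $ k)\<bar> \<le> h k}"
  have h0: "0 \<le> h k" for k using r by (simp add: h_def)
  have A: "A \<in> sets borel" "emeasure lborel A = ennreal (\<Prod>k\<in>UNIV. (2 * h k)\<^sup>2)"
    unfolding A_def using emeasure_lborel_polybox[of h a] h0 by auto
  have "(\<Prod>k\<in>UNIV. (2 * h k)\<^sup>2) = (2 * r)\<^sup>2 * (\<Prod>k\<in>UNIV - {j}. (2 * h k)\<^sup>2)"
    by (simp add: prod.remove[of UNIV j] h_def)
  also have "(\<Prod>k\<in>UNIV - {j}. (2 * h k)\<^sup>2) = (\<Prod>k\<in>UNIV - {j}. 8 * r)"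
    using r by (intro prod.cong) (auto simp: h_def power_mult_distrib)
  also have "\<dots> = (8 * r) ^ (CARD('n) - 1)"
    by simp
  also have "(2 * r)\<^sup>2 * (8 * r) ^ (CARD('n) - 1) \<le> (8 * r\<^sup>2) * (8 * r) ^ (CARD('n) - 1)"
    using r by (intro mult_right_mono) (auto simp: power_mult_distrib)
  also have "\<dots> = (8 * 8 ^ (CARD('n) - 1)) * (r ^ 2 * r ^ (CARD('n) - 1))"
    by (simp add: power_mult_distrib)
  also have "\<dots> = 8 ^ CARD('n) * r ^ (CARD('n) + 1)"
    by (simp flip: power_Suc power_add)
  finally have A_le: "emeasure lborel A \<le> ennreal (8 ^ CARD('n) * r ^ (CARD('n) + 1))"
    unfolding A by (rule ennreal_leI)
  have "{z. norm z < 1 \<and> norm (1 - herm z u) < r} \<subseteq> M -` A"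
  proof clarify
    fix z assume z: "norm z < 1" "norm (1 - herm z u) < r"
    have "\<bar>Re (1 - herm z u)\<bar> < r" "\<bar>Im (1 - herm z u)\<bar> < r"
      using z abs_Re_le_cmod[of "1 - herm z u"] abs_Im_le_cmod[of "1 - herm z u"] by linarith+
    moreover have "norm (z $ k - u $ k) \<le> sqrt (2 * r)" for k
    proof -
      have "(norm (z - u))\<^sup>2 = (norm z)\<^sup>2 + (norm u)\<^sup>2 - 2 * Re (herm z u)"
        by (simp add: Re_herm power2_norm_eq_inner inner_diff_left inner_diff_right inner_commute)
      also have "\<dots> \<le> 1 + 1 - 2 * (1 - r)"
        using \<open>\<bar>Re (1 - herm z u)\<bar> < r\<close> z u power_le_one[of "norm z" 2] power_le_one[of "norm u" 2]
        by simp
      finally have "norm (z - u) \<le> sqrt (2 * r)"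
        by (intro real_le_rsqrt) simp
      then show ?thesis
        using Finite_Cartesian_Product.norm_nth_le[of "z - u" k] by simp
    qed
    moreover have "\<bar>Re (z $ k - u $ k)\<bar> \<le> norm (z $ k - u $ k)" "\<bar>Im (z $ k - u $ k)\<bar> \<le> norm (z $ k - u $ k)" for k
      by (rule abs_Re_le_cmod abs_Im_le_cmod)+
    ultimately have "M z \<in> A"
      unfolding A_def M_def a_def h_def by (auto simp: abs_minus_commute intro: order_trans less_imp_le)
    then show "z \<in> M -` A" by simp
  qed
  moreover have "M -` A \<in> sets borel"
  proof -
    have "M \<in> borel_measurable borel"
      using lin by (intro borel_measurable_continuous_onI linear_continuous_on)
        (simp add: linear_conv_bounded_linear)
    then show ?thesis using measurable_sets[of M borel borel A] A by simp
  qed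
  ultimately have "emeasure lborel {z. norm z < 1 \<and> norm (1 - herm z u) < r} \<le> emeasure lborel (M -` A)"
    by (intro emeasure_mono) auto
  then have "emeasure lborel {z. norm z < 1 \<and> norm (1 - herm z u) < r} * emeasure lborel (ball (0::complex^'n) 1)
    \<le> emeasure lborel (M -` A) * emeasure lborel (ball (0::complex^'n) 1)"
    by (intro mult_right_mono) auto
  also have "\<dots> \<le> emeasure lborel A * emeasure lborel (ball (0::complex^'n) K)"
    using n by (intro emeasure_linear_vimage_le[OF lin bound _ A(1)]) (auto simp: K_def intro!: add_pos_nonneg)
  also have "\<dots> \<le> ennreal (8 ^ CARD('n) * r ^ (CARD('n) + 1)) * emeasure lborel (ball (0::complex^'n) K)"
    by (intro mult_right_mono A_le) auto
  finally show ?thesis unfolding K_def .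
qed

lemma emeasure_lborel_ball_real:
  fixes x :: "'a::euclidean_space"
  shows "emeasure lborel (ball x r) = ennreal (measure lborel (ball x r))"
  using emeasure_lborel_ball_finite[of x r] by (intro emeasure_eq_ennreal_measure) auto

lemma measure_lborel_ball_pos:
  fixes x :: "'a::euclidean_space"
  assumes "0 < r" shows "0 < measure lborel (ball x r)"
  using emeasure_lborel_ball_pos[OF assms, of x] unfolding emeasure_lborel_ball_real by simp

text \<open>For \<open>r\<close> at least \<open>1/2\<close> the volume of the whole ball suffices.
  For smaller \<open>r\<close> the cap is empty unless \<open>norm u\<close> is at least
  \<open>1/2\<close>, because \<open>norm (1 - herm z u)\<close> is at least
  \<open>1 - norm u\<close>. The constant adds up those of the two nontrivial cases.\<close>

lemma emeasure_cap_le: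
  obtains C where "0 < C"
    "\<And>(u::complex^'n) r. norm u < 1 \<Longrightarrow> 0 < r \<Longrightarrow>
      emeasure lborel {z. norm z < 1 \<and> norm (1 - herm z u) < r} \<le> ennreal (C * r ^ (CARD('n) + 1))"
proof -
  let ?n = "real CARD('n)"
  define V where "V = measure lborel (ball (0::complex^'n) 1)"
  define W where "W = measure lborel (ball (0::complex^'n) (?n + 2 * ?n * (1 + ?n)))"
  have V: "0 < V" unfolding V_def by (rule measure_lborel_ball_pos) simp
  have W: "0 \<le> W" unfolding W_def by simp
  define C where "C = V * 2 ^ (CARD('n) + 1) + 8 ^ CARD('n) * W / V"
  show thesis
  proof (rule that)
    show "0 < C" using V W by (simp add: C_def add_pos_nonneg)
    fix u :: "complex^'n" and r :: real
    assume u: "norm u < 1" and r: "0 < r"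
    let ?D = "{z. norm z < 1 \<and> norm (1 - herm z u) < r}"
    show "emeasure lborel ?D \<le> ennreal (C * r ^ (CARD('n) + 1))"
    proof (cases "1/2 \<le> r")
      case True
      have "emeasure lborel ?D \<le> emeasure lborel (ball (0::complex^'n) 1)"
        by (intro emeasure_mono) auto
      also have "\<dots> = ennreal V"
        unfolding V_def by (rule emeasure_lborel_ball_real)
      also have "V \<le> C * r ^ (CARD('n) + 1)"
      proof -
        have "1 \<le> (2 * r) ^ (CARD('n) + 1)"
          using True by (intro one_le_power) auto
        then have "V \<le> V * (2 * r) ^ (CARD('n) + 1)"
          using V mult_left_mono[of 1 "(2 * r) ^ (CARD('n) + 1)" V] by simp
        also have "\<dots> = V * 2 ^ (CARD('n) + 1) * r ^ (CARD('n) + 1)"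
          by (simp only: power_mult_distrib mult.assoc)
        also have "\<dots> \<le> C * r ^ (CARD('n) + 1)"
          unfolding C_def using r V W by (intro mult_right_mono) auto
        finally show ?thesis .
      qed
      finally show ?thesis by (simp add: ennreal_leI)
    next
      case False
      show ?thesis
      proof (cases "1/2 \<le> norm u")
        case True
        have "emeasure lborel ?D * ennreal V \<le> ennreal (8 ^ CARD('n) * r ^ (CARD('n) + 1)) * ennreal W"
          using emeasure_cap_le_aux[OF True u r] unfolding V_def W_def emeasure_lborel_ball_real .
        also have "\<dots> = ennreal (8 ^ CARD('n) * r ^ (CARD('n) + 1) * W)"
          using r W by (simp add: ennreal_mult)
        finally have "emeasure lborel ?D \<le> ennreal (8 ^ CARD('n) * r ^ (CARD('n) + 1) * W / V)"
          using r V W by (intro ennreal_le_divideI) auto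
        also have "8 ^ CARD('n) * r ^ (CARD('n) + 1) * W / V = (8 ^ CARD('n) * W / V) * r ^ (CARD('n) + 1)"
          by simp
        also have "\<dots> \<le> C * r ^ (CARD('n) + 1)"
          unfolding C_def using r V W by (intro mult_right_mono) auto
        finally show ?thesis by (simp add: ennreal_leI)
      next
        case small: False
        have "\<not> norm (1 - herm z u) < r" if "norm z < 1" for z
          using norm_1_minus_herm_ge(2)[of z u] that u False small by simp
        then have "?D = {}" by auto
        then have "emeasure lborel ?D = 0" by (simp only: emeasure_empty)
        then show ?thesis by simp
      qed
    qed
  qed
qed

lemma nn_integral_powr_shift:
  fixes a :: real
  assumes "a > -1" "0 \<le> c"
  shows "(\<integral>\<^sup>+x. ennreal ((x - m) powr a) * indicator {m..m + c} x \<partial>lborel) = ennreal (c powr (a + 1) / (a + 1))"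
proof -
  have "(\<integral>\<^sup>+x. ennreal ((x - m) powr a) * indicator {m..m + c} x \<partial>lborel)
      = (\<integral>\<^sup>+x. ennreal (x powr a) * indicator {0..c} x \<partial>lborel)"
    by (subst nn_integral_real_affine[where c=1 and t=m])
      (auto intro!: nn_integral_cong simp: indicator_def)
  also have "\<dots> = ennreal (c powr (a + 1) / (a + 1))"
    using has_integral_powr_from_0[OF assms] by (intro nn_integral_has_integral_lebesgue') auto
  finally show ?thesis .
qed

text \<open>As \<open>t\<close> is not positive, moving the singularity from \<open>a\<close> to the
  left end of the range only increases the integrand. The bound is thus independent of
  \<open>a\<close>, which later is \<open>norm z\<close>.\<close>

lemma nn_integral_powr_truncated_le:
  fixes t :: real
  assumes t: "-1 < t" "t \<le> 0" and a: "a < 1" and L: "0 < L"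
  shows "(\<integral>\<^sup>+\<kappa>. ennreal ((\<kappa> - a) powr t) * indicator {\<kappa>. 1 - L < \<kappa> \<and> \<kappa> \<le> 1 \<and> a < \<kappa>} \<kappa> \<partial>lborel)
    \<le> ennreal (L powr (t + 1) / (t + 1))"
proof -
  define m where "m = max a (1 - L)"
  have m: "a \<le> m" "1 - L \<le> m" "m < 1" using a L by (auto simp: m_def)
  have "(\<integral>\<^sup>+\<kappa>. ennreal ((\<kappa> - a) powr t) * indicator {\<kappa>. 1 - L < \<kappa> \<and> \<kappa> \<le> 1 \<and> a < \<kappa>} \<kappa> \<partial>lborel)
     \<le> (\<integral>\<^sup>+\<kappa>. ennreal ((\<kappa> - m) powr t) * indicator {m..m + (1 - m)} \<kappa> \<partial>lborel)"
  proof (rule nn_integral_mono)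
    fix \<kappa> :: real
    show "ennreal ((\<kappa> - a) powr t) * indicator {\<kappa>. 1 - L < \<kappa> \<and> \<kappa> \<le> 1 \<and> a < \<kappa>} \<kappa>
      \<le> ennreal ((\<kappa> - m) powr t) * indicator {m..m + (1 - m)} \<kappa>"
    proof (cases "1 - L < \<kappa> \<and> \<kappa> \<le> 1 \<and> a < \<kappa>")
      case True
      then have "m < \<kappa>" by (auto simp: m_def)
      then have "(\<kappa> - a) powr t \<le> (\<kappa> - m) powr t"
        using m t by (intro powr_mono2') auto
      then show ?thesis using True \<open>m < \<kappa>\<close> by (auto intro: ennreal_leI)
    qed auto
  qed
  also have "\<dots> = ennreal ((1 - m) powr (t + 1) / (t + 1))"
    using m t by (intro nn_integral_powr_shift) auto
  also have "\<dots> \<le> ennreal (L powr (t + 1) / (t + 1))"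
    using m t by (intro ennreal_leI divide_right_mono powr_mono2) auto
  finally show ?thesis .
qed

text \<open>A ball for the nonisotropic quasi-distance, but with an interior center allowed: for
  \<open>norm u < 1\<close> it is empty when \<open>r \<le> 1 - norm u\<close>.\<close>

definition cap :: "complex ^ 'n \<Rightarrow> real \<Rightarrow> (complex ^ 'n) set" where
  "cap u r = {z. norm z < 1 \<and> norm (1 - herm z u) < r}"

lemma cap_borel [measurable]: "cap u r \<in> sets borel"
proof -
  have "open (cap u r)"
    unfolding cap_def Collect_conj_eq
    by (intro open_Int open_Collect_less continuous_intros)
  then show ?thesis by simp
qed

text \<open>For negative \<open>t\<close> the weight is integrated out by averaging the integral over the dilations
  \<open>z \<mapsto> z / \<kappa>\<close> with \<open>\<kappa>\<close> close to \<open>1\<close>.\<close>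

lemma nn_integral_cap_le_neg:
  fixes u :: "complex ^ 'n"
  assumes t: "-1 < t" "t < 0" and u: "norm u < 1" and r: "0 < r" "r \<le> 4"
    and C: "0 < C" "emeasure lborel (cap u (2 * r)) \<le> ennreal (C * (2 * r) ^ (CARD('n) + 1))"
  shows "(\<integral>\<^sup>+z. ennreal ((1 - norm z) powr t) * indicator (cap u r) z \<partial>lborel)
    \<le> ennreal (2 ^ DIM(complex^'n) / (1 + t) * 8 powr (-t) * C * 2 ^ (CARD('n) + 1) * r powr (real CARD('n) + 1 + t))"
proof -
  \<comment> \<open>For \<open>r \<le> 4\<close> this keeps the dilation factors above
    \<open>1/2\<close>, and moving the center by at most \<open>L\<close> enlarges the radius from
    \<open>r\<close> to less than \<open>2 * r\<close>.\<close>
  define L where "L = r / 8"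
  have L: "0 < L" "L \<le> 1/2" using r by (auto simp: L_def)
  define g where "g = (\<lambda>z. ennreal ((1 - norm z) powr t) * indicator (cap u r) z)"
  have [measurable]: "g \<in> borel_measurable borel" unfolding g_def by measurable
  let ?I = "\<integral>\<^sup>+z. g z \<partial>lborel"
  let ?N = "DIM(complex^'n)"
  have scale: "?I \<le> ennreal (2 ^ ?N) * (\<integral>\<^sup>+z. g ((1/\<kappa>) *\<^sub>R z) \<partial>lborel)" if "1/2 \<le> \<kappa>" "\<kappa> \<le> 1" for \<kappa>
  proof -
    have "?I = ennreal (\<bar>1/\<kappa>\<bar> ^ ?N) * (\<integral>\<^sup>+z. g ((1/\<kappa>) *\<^sub>R z) \<partial>lborel)"
      using nn_integral_lborel_affine[of g "1/\<kappa>" 0] that by simp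
    also have "\<dots> \<le> ennreal (2 ^ ?N) * (\<integral>\<^sup>+z. g ((1/\<kappa>) *\<^sub>R z) \<partial>lborel)"
      using that by (intro mult_right_mono ennreal_leI power_mono) (auto simp: field_simps)
    finally show ?thesis .
  qed
  \<comment> \<open>If the dilated point lies in the cap, then \<open>z\<close> lies in the cap of
    twice the radius, and the weight is at most \<open>(\<kappa> - norm z) powr t\<close>. This is
    integrable in \<open>\<kappa>\<close> for fixed \<open>z\<close> because \<open>-1 < t\<close>;
    only the unweighted volume of the larger cap is left.\<close>
  have ptw: "g ((1/\<kappa>) *\<^sub>R z) * indicator {1 - L<..1} \<kappa>
      \<le> indicator (cap u (2 * r)) z *
        (ennreal ((\<kappa> - norm z) powr t) * indicator {\<kappa>. 1 - L < \<kappa> \<and> \<kappa> \<le> 1 \<and> norm z < \<kappa>} \<kappa>)" for \<kappa> z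
  proof (cases "\<kappa> \<in> {1 - L<..1} \<and> (1/\<kappa>) *\<^sub>R z \<in> cap u r")
    case True
    then have l: "1 - L < \<kappa>" "\<kappa> \<le> 1" "0 < \<kappa>" using L by auto
    from True have z: "norm z < \<kappa>" and "norm (1 - (1/\<kappa>) *\<^sub>R herm z u) < r"
      using l by (auto simp: cap_def herm_scaleR_left field_simps)
    have \<kappa>r: "\<kappa> * r \<le> r"
      using l r by (intro mult_left_le_one_le) auto
    from \<open>norm (1 - (1/\<kappa>) *\<^sub>R herm z u) < r\<close> have "\<kappa> * norm (1 - (1/\<kappa>) *\<^sub>R herm z u) < \<kappa> * r"
      using l by simp
    also have "\<kappa> * norm (1 - (1/\<kappa>) *\<^sub>R herm z u) = norm (\<kappa> *\<^sub>R (1 - (1/\<kappa>) *\<^sub>R herm z u))"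
      using l by simp
    also have "\<kappa> *\<^sub>R (1 - (1/\<kappa>) *\<^sub>R herm z u) = of_real \<kappa> - herm z u"
      using l by (simp add: scaleR_diff_right scaleR_conv_of_real right_diff_distrib)
    finally have "norm (of_real \<kappa> - herm z u) < r"
      using \<kappa>r by linarith
    moreover have "norm (1 - complex_of_real \<kappa>) = 1 - \<kappa>"
      using l by (metis norm_of_real of_real_1 of_real_diff abs_of_nonneg diff_ge_0_iff_ge)
    ultimately have "norm (1 - herm z u) < 2 * r"
      using norm_triangle_ineq[of "1 - complex_of_real \<kappa>" "of_real \<kappa> - herm z u"] l L_def r by simp
    then have cap: "z \<in> cap u (2 * r)" using z l by (simp add: cap_def)
    have "1 - norm ((1/\<kappa>) *\<^sub>R z) = (\<kappa> - norm z) / \<kappa>"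
      using l by (simp add: field_simps)
    then have "(1 - norm ((1/\<kappa>) *\<^sub>R z)) powr t = (\<kappa> - norm z) powr t / \<kappa> powr t"
      using l z by (simp add: powr_divide)
    also have "\<dots> \<le> (\<kappa> - norm z) powr t"
    proof -
      have "1 \<le> \<kappa> powr t"
        using powr_mono2'[of t \<kappa> 1] l t by simp
      then show ?thesis by (simp add: divide_le_eq mult_le_cancel_left1)
    qed
    finally show ?thesis
      using cap l z True by (simp add: g_def ennreal_leI)
  next
    case False
    then have "g ((1/\<kappa>) *\<^sub>R z) * indicator {1 - L<..1} \<kappa> = 0" by (auto simp: g_def)
    then show ?thesis by (simp only: zero_le)
  qed
  have "?I * ennreal L = (\<integral>\<^sup>+\<kappa>. ?I * indicator {1 - L<..1} \<kappa> \<partial>lborel)"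
    using L by (subst nn_integral_cmult_indicator) auto
  also have "\<dots> \<le> (\<integral>\<^sup>+\<kappa>. ennreal (2 ^ ?N) * (\<integral>\<^sup>+z. g ((1/\<kappa>) *\<^sub>R z) * indicator {1 - L<..1} \<kappa> \<partial>lborel) \<partial>lborel)"
  proof (rule nn_integral_mono)
    fix \<kappa> :: real
    show "?I * indicator {1 - L<..1} \<kappa>
      \<le> ennreal (2 ^ ?N) * (\<integral>\<^sup>+z. g ((1/\<kappa>) *\<^sub>R z) * indicator {1 - L<..1} \<kappa> \<partial>lborel)"
      using scale[of \<kappa>] L by (cases "\<kappa> \<in> {1 - L<..1}") auto
  qed
  also have "\<dots> = ennreal (2 ^ ?N) * (\<integral>\<^sup>+\<kappa>. (\<integral>\<^sup>+z. g ((1/\<kappa>) *\<^sub>R z) * indicator {1 - L<..1} \<kappa> \<partial>lborel) \<partial>lborel)"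
    by (rule nn_integral_cmult) measurable
  also have "(\<integral>\<^sup>+\<kappa>. (\<integral>\<^sup>+z. g ((1/\<kappa>) *\<^sub>R z) * indicator {1 - L<..1} \<kappa> \<partial>lborel) \<partial>lborel)
     = (\<integral>\<^sup>+z. (\<integral>\<^sup>+\<kappa>. g ((1/\<kappa>) *\<^sub>R z) * indicator {1 - L<..1} \<kappa> \<partial>lborel) \<partial>lborel)"
    by (rule lborel_pair.Fubini') measurable
  also have "\<dots> \<le> (\<integral>\<^sup>+z. indicator (cap u (2 * r)) z * ennreal (L powr (t + 1) / (t + 1)) \<partial>lborel)"
  proof (rule nn_integral_mono)
    fix z :: "complex ^ 'n"
    show "(\<integral>\<^sup>+\<kappa>. g ((1/\<kappa>) *\<^sub>R z) * indicator {1 - L<..1} \<kappa> \<partial>lborel)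
      \<le> indicator (cap u (2 * r)) z * ennreal (L powr (t + 1) / (t + 1))"
    proof (cases "z \<in> cap u (2 * r)")
      case True
      then have "norm z < 1" by (simp add: cap_def)
      have "(\<integral>\<^sup>+\<kappa>. g ((1/\<kappa>) *\<^sub>R z) * indicator {1 - L<..1} \<kappa> \<partial>lborel)
        \<le> (\<integral>\<^sup>+\<kappa>. ennreal ((\<kappa> - norm z) powr t) * indicator {\<kappa>. 1 - L < \<kappa> \<and> \<kappa> \<le> 1 \<and> norm z < \<kappa>} \<kappa> \<partial>lborel)"
        using ptw[of _ z] True by (intro nn_integral_mono) simp
      also have "\<dots> \<le> ennreal (L powr (t + 1) / (t + 1))"
        using t L \<open>norm z < 1\<close> by (intro nn_integral_powr_truncated_le) auto
      finally show ?thesis using True by simp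
    next
      case False
      have "(\<integral>\<^sup>+\<kappa>. g ((1/\<kappa>) *\<^sub>R z) * indicator {1 - L<..1} \<kappa> \<partial>lborel) \<le> (\<integral>\<^sup>+\<kappa>. 0 \<partial>(lborel :: real measure))"
        using ptw[of _ z] False by (intro nn_integral_mono) simp
      then show ?thesis by simp
    qed
  qed
  also have "\<dots> = emeasure lborel (cap u (2 * r)) * ennreal (L powr (t + 1) / (t + 1))"
    by (subst nn_integral_multc) auto
  also have "\<dots> \<le> ennreal (C * (2 * r) ^ (CARD('n) + 1)) * ennreal (L powr (t + 1) / (t + 1))"
    using C by (intro mult_right_mono) auto
  finally have "?I * ennreal L \<le> ennreal (2 ^ ?N) * (ennreal (C * (2 * r) ^ (CARD('n) + 1)) * ennreal (L powr (t + 1) / (t + 1)))"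
    by (simp add: mult_left_mono)
  also have "\<dots> = ennreal (2 ^ ?N * (C * (2 * r) ^ (CARD('n) + 1) * (L powr (t + 1) / (t + 1))))"
    using C r t by (simp add: ennreal_mult'[symmetric] ennreal_mult''[symmetric])
  finally have "?I \<le> ennreal (2 ^ ?N * (C * (2 * r) ^ (CARD('n) + 1) * (L powr (t + 1) / (t + 1))) / L)"
    using L C r t by (intro ennreal_le_divideI) (auto intro!: mult_nonneg_nonneg divide_nonneg_nonneg)
  also have "2 ^ ?N * (C * (2 * r) ^ (CARD('n) + 1) * (L powr (t + 1) / (t + 1))) / L
     = 2 ^ ?N / (1 + t) * 8 powr (-t) * C * 2 ^ (CARD('n) + 1) * r powr (real CARD('n) + 1 + t)"
  proof -
    have "L powr (t + 1) / L = L powr t"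
      using L by (simp add: powr_add)
    also have "\<dots> = r powr t * 8 powr (-t)"
      using r by (simp add: L_def powr_divide powr_minus_divide)
    finally have *: "L powr (t + 1) = r powr t * 8 powr (-t) * L"
      using L by (simp add: field_simps)
    have **: "r powr (real CARD('n) + 1 + t) = r ^ (CARD('n) + 1) * r powr t"
      using r by (simp add: powr_add powr_realpow)
    show ?thesis
      unfolding * ** power_mult_distrib using L t by (simp add: add.commute)
  qed
  finally show ?thesis unfolding g_def .
qed

text \<open>For \<open>t\<close> nonnegative the weight is at most \<open>r powr t\<close> on the
  cap, since \<open>1 - norm z \<le> norm (1 - herm z u)\<close>; negative \<open>t\<close> is the
  averaged case. Radii up to \<open>4\<close> are twice the largest value of
  \<open>norm (1 - herm z u)\<close>, which is what the layer integral uses.\<close>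

lemma nn_integral_cap_le:
  fixes t :: real
  assumes t: "-1 < t"
  obtains C where "0 < C"
    "\<And>(u::complex^'n) r. norm u < 1 \<Longrightarrow> 0 < r \<Longrightarrow> r \<le> 4 \<Longrightarrow>
      (\<integral>\<^sup>+z. ennreal ((1 - norm z) powr t) * indicator (cap u r) z \<partial>lborel)
        \<le> ennreal (C * r powr (real CARD('n) + 1 + t))"
proof -
  obtain C where C: "0 < C"
    "\<And>(u::complex^'n) r. norm u < 1 \<Longrightarrow> 0 < r \<Longrightarrow>
      emeasure lborel (cap u r) \<le> ennreal (C * r ^ (CARD('n) + 1))"
    by (rule emeasure_cap_le[where 'n='n, folded cap_def]) blast
  show thesis
  proof (cases "t < 0")
    case True
    show thesis
    proof (rule that)
      show "0 < 2 ^ DIM(complex^'n) / (1 + t) * 8 powr (-t) * C * 2 ^ (CARD('n) + 1)"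
        using t C by simp
      fix u :: "complex^'n" and r :: real
      assume "norm u < 1" "0 < r" "r \<le> 4"
      moreover from this have "emeasure lborel (cap u (2 * r)) \<le> ennreal (C * (2 * r) ^ (CARD('n) + 1))"
        by (intro C) auto
      ultimately show "(\<integral>\<^sup>+z. ennreal ((1 - norm z) powr t) * indicator (cap u r) z \<partial>lborel)
        \<le> ennreal (2 ^ DIM(complex^'n) / (1 + t) * 8 powr (-t) * C * 2 ^ (CARD('n) + 1) * r powr (real CARD('n) + 1 + t))"
        using C(1) t True by (intro nn_integral_cap_le_neg)
    qed
  next
    case False
    show thesis
    proof (rule that[OF C(1)])
      fix u :: "complex^'n" and r :: real
      assume u: "norm u < 1" and r: "0 < r"
      have "(\<integral>\<^sup>+z. ennreal ((1 - norm z) powr t) * indicator (cap u r) z \<partial>lborel)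
        \<le> (\<integral>\<^sup>+z. ennreal (r powr t) * indicator (cap u r) z \<partial>lborel)"
      proof (rule nn_integral_mono)
        fix z :: "complex ^ 'n"
        show "ennreal ((1 - norm z) powr t) * indicator (cap u r) z \<le> ennreal (r powr t) * indicator (cap u r) z"
          using norm_1_minus_herm_ge(1)[of z u] u False
          by (cases "z \<in> cap u r") (auto simp: cap_def intro!: ennreal_leI powr_mono2)
      qed
      also have "\<dots> = ennreal (r powr t) * emeasure lborel (cap u r)"
        by (rule nn_integral_cmult_indicator) simp
      also have "\<dots> \<le> ennreal (r powr t) * ennreal (C * r ^ (CARD('n) + 1))"
        using C(2)[OF u r] by (intro mult_left_mono) auto
      also have "\<dots> = ennreal (C * r powr (real CARD('n) + 1 + t))"
        using r C(1) by (simp add: ennreal_mult[symmetric] powr_add powr_realpow algebra_simps)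
      finally show "(\<integral>\<^sup>+z. ennreal ((1 - norm z) powr t) * indicator (cap u r) z \<partial>lborel)
        \<le> ennreal (C * r powr (real CARD('n) + 1 + t))" .
    qed
  qed
qed

subsection \<open>The Forelli--Rudin estimate\<close>

text \<open>The interval from \<open>x\<close> to \<open>2 * x\<close> has length \<open>x\<close>,
  and on it \<open>r powr (- g - 1)\<close> is comparable with \<open>x powr (- g - 1)\<close>,
  whatever the sign of the exponent. It lies inside \<open>{d..4}\<close> because
  \<open>d \<le> x \<le> 2\<close>.\<close>

lemma powr_le_layer_integral:
  fixes x g :: real
  assumes x: "0 < d" "d \<le> x" "x \<le> 2"
  shows "ennreal (x powr (- g)) \<le> ennreal (2 powr \<bar>g + 1\<bar>) *
    (\<integral>\<^sup>+r. ennreal (r powr (- g - 1)) * indicator {d..4} r * indicator {x<..} r \<partial>lborel)"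
proof -
  define m where "m = 2 powr (- \<bar>g + 1\<bar>)"
  have low: "m * x powr (- g - 1) \<le> r powr (- g - 1)" if r: "x < r" "r \<le> 2 * x" for r
  proof -
    define y where "y = r / x"
    have y: "1 \<le> y" "y \<le> 2" using r x by (auto simp: y_def field_simps)
    have "m \<le> y powr (- g - 1)"
    proof (cases "g + 1 \<ge> 0")
      case True
      then show ?thesis using y powr_mono2'[of "- g - 1" y 2] by (simp add: m_def)
    next
      case False
      then have "1 \<le> y powr (- g - 1)"
        using y by (intro ge_one_powr_ge_zero) auto
      moreover have "m \<le> 2 powr 0"
        unfolding m_def by (rule powr_mono) auto
      ultimately show ?thesis by simp
    qed
    moreover have "r powr (- g - 1) = y powr (- g - 1) * x powr (- g - 1)"
      using x y by (simp add: y_def flip: powr_mult)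
    ultimately show ?thesis by (simp add: mult_right_mono)
  qed
  have "ennreal (m * x powr (- g)) = ennreal (m * x powr (- g - 1)) * emeasure lborel {x<..2 * x}"
    using x by (simp add: m_def ennreal_mult[symmetric] powr_diff)
  also have "\<dots> = (\<integral>\<^sup>+r. ennreal (m * x powr (- g - 1)) * indicator {x<..2 * x} r \<partial>lborel)"
    by (rule nn_integral_cmult_indicator[symmetric]) simp
  also have "\<dots> \<le> (\<integral>\<^sup>+r. ennreal (r powr (- g - 1)) * indicator {d..4} r * indicator {x<..} r \<partial>lborel)"
    using x by (intro nn_integral_mono) (auto simp: indicator_def intro!: ennreal_leI low)
  finally have *: "ennreal (m * x powr (- g))
    \<le> (\<integral>\<^sup>+r. ennreal (r powr (- g - 1)) * indicator {d..4} r * indicator {x<..} r \<partial>lborel)" .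
  have "ennreal (x powr (- g)) = ennreal (2 powr \<bar>g + 1\<bar>) * ennreal (m * x powr (- g))"
    by (simp add: m_def ennreal_mult[symmetric] powr_minus field_simps)
  also have "\<dots> \<le> ennreal (2 powr \<bar>g + 1\<bar>) *
    (\<integral>\<^sup>+r. ennreal (r powr (- g - 1)) * indicator {d..4} r * indicator {x<..} r \<partial>lborel)"
    by (intro mult_left_mono *) simp
  finally show ?thesis .
qed

text \<open>The lower endpoint dominates for positive \<open>s\<close>, the upper one for negative
  \<open>s\<close>; at \<open>s = 0\<close> the antiderivative would be a logarithm.\<close>

lemma nn_integral_powr_Icc:
  fixes s :: real
  assumes "s \<noteq> 0" "0 < d" "d \<le> 4"
  shows "(\<integral>\<^sup>+r. ennreal (r powr (- s - 1)) * indicator {d..4} r \<partial>lborel)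
    \<le> ennreal (if 0 < s then d powr (- s) / s else 4 powr (- s) / (- s))"
proof -
  have "(\<integral>\<^sup>+r. ennreal (r powr (- s - 1)) * indicator {d..4} r \<partial>lborel)
    = ennreal (4 powr (- s) / (- s) - d powr (- s) / (- s))"
  proof (rule nn_integral_FTC_Icc)
    fix x assume "x \<in> {d..4}"
    then have "0 < x" using assms by simp
    then show "DERIV (\<lambda>r. r powr (- s) / (- s)) x :> x powr (- s - 1)"
      using assms by (auto intro!: derivative_eq_intros)
  qed (use assms in auto)
  also have "\<dots> \<le> ennreal (if 0 < s then d powr (- s) / s else 4 powr (- s) / (- s))"
    using assms by (intro ennreal_leI) (auto simp: divide_nonneg_neg divide_le_0_iff)
  finally show ?thesis .
qed

text \<open>Writing the kernel power as a layer integral turns the estimate into cap volumes: after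
  Tonelli, \<open>r powr (- g - 1)\<close> times the cap bound is a multiple of
  \<open>r powr (- s - 1)\<close>. The integration starts at \<open>1 - norm u\<close>, below which
  caps are empty.\<close>

lemma forelli_rudin_le:
  fixes t g :: real
  assumes t: "-1 < t" and s: "s = g - (real CARD('n) + 1 + t)" "s \<noteq> 0"
  obtains C where "0 < C"
    "\<And>u::complex^'n. norm u < 1 \<Longrightarrow>
      (\<integral>\<^sup>+z. ennreal ((1 - norm z) powr t * norm (1 - herm z u) powr (- g)) * indicator unit_ball z \<partial>lborel)
        \<le> ennreal (C * (if 0 < s then (1 - norm u) powr (- s) else 1))"
proof -
  obtain B where B: "0 < B"
    "\<And>(u::complex^'n) r. norm u < 1 \<Longrightarrow> 0 < r \<Longrightarrow> r \<le> 4 \<Longrightarrow>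
      (\<integral>\<^sup>+z. ennreal ((1 - norm z) powr t) * indicator (cap u r) z \<partial>lborel)
        \<le> ennreal (B * r powr (real CARD('n) + 1 + t))"
    by (rule nn_integral_cap_le[OF t, where 'n='n]) blast
  define c where "c = 2 powr \<bar>g + 1\<bar>"
  have c: "0 < c" by (simp add: c_def)
  define C where "C = c * B * (if 0 < s then 1 / s else 4 powr (- s) / (- s))"
  show thesis
  proof (rule that)
    show "0 < C" unfolding C_def using c B(1) s(2) by (intro mult_pos_pos) (auto simp: divide_neg_pos divide_pos_neg)
    fix u :: "complex^'n"
    assume u: "norm u < 1"
    define d where "d = 1 - norm u"
    have d: "0 < d" "d \<le> 1" using u by (auto simp: d_def)
    let ?w = "\<lambda>z. ennreal ((1 - norm z) powr t)"
    let ?k = "\<lambda>r. ennreal (r powr (- g - 1)) * indicator {d..4} r"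
    have "(\<integral>\<^sup>+z. ennreal ((1 - norm z) powr t * norm (1 - herm z u) powr (- g)) * indicator unit_ball z \<partial>lborel)
      \<le> (\<integral>\<^sup>+z. ennreal c * (\<integral>\<^sup>+r. ?k r * (?w z * indicator (cap u r) z) \<partial>lborel) \<partial>lborel)"
    proof (rule nn_integral_mono)
      fix z :: "complex ^ 'n"
      show "ennreal ((1 - norm z) powr t * norm (1 - herm z u) powr (- g)) * indicator unit_ball z
        \<le> ennreal c * (\<integral>\<^sup>+r. ?k r * (?w z * indicator (cap u r) z) \<partial>lborel)"
      proof (cases "norm z < 1")
        case True
        let ?x = "norm (1 - herm z u)"
        have x: "d \<le> ?x" "?x \<le> 2"
          using norm_1_minus_herm_ge(2)[of z u] norm_1_minus_herm_le[of z u] u True by (auto simp: d_def)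
        have "ennreal ((1 - norm z) powr t * ?x powr (- g)) * indicator unit_ball z = ?w z * ennreal (?x powr (- g))"
          using True by (simp add: ennreal_mult unit_ball_iff)
        also have "\<dots> \<le> ?w z * (ennreal c * (\<integral>\<^sup>+r. ?k r * indicator {?x<..} r \<partial>lborel))"
          unfolding c_def using d x by (intro mult_left_mono powr_le_layer_integral) auto
        also have "\<dots> = ennreal c * (\<integral>\<^sup>+r. ?w z * (?k r * indicator {?x<..} r) \<partial>lborel)"
          by (simp add: nn_integral_cmult mult.left_commute)
        also have "(\<integral>\<^sup>+r. ?w z * (?k r * indicator {?x<..} r) \<partial>lborel)
            = (\<integral>\<^sup>+r. ?k r * (?w z * indicator (cap u r) z) \<partial>lborel)"
          using True by (intro nn_integral_cong) (simp add: indicator_def cap_def mult_ac)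
        finally show ?thesis .
      qed (simp add: unit_ball_iff)
    qed
    also have "\<dots> = ennreal c * (\<integral>\<^sup>+z. (\<integral>\<^sup>+r. ?k r * (?w z * indicator (cap u r) z) \<partial>lborel) \<partial>lborel)"
      unfolding cap_def by (rule nn_integral_cmult) measurable
    also have "(\<integral>\<^sup>+z. (\<integral>\<^sup>+r. ?k r * (?w z * indicator (cap u r) z) \<partial>lborel) \<partial>lborel)
        = (\<integral>\<^sup>+r. (\<integral>\<^sup>+z. ?k r * (?w z * indicator (cap u r) z) \<partial>lborel) \<partial>lborel)"
      unfolding cap_def by (rule lborel_pair.Fubini') measurable
    also have "\<dots> = (\<integral>\<^sup>+r. ?k r * (\<integral>\<^sup>+z. ?w z * indicator (cap u r) z \<partial>lborel) \<partial>lborel)"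
      by (intro nn_integral_cong nn_integral_cmult) measurable
    also have "\<dots> \<le> (\<integral>\<^sup>+r. ennreal B * (ennreal (r powr (- s - 1)) * indicator {d..4} r) \<partial>lborel)"
    proof (rule nn_integral_mono)
      fix r :: real
      show "?k r * (\<integral>\<^sup>+z. ?w z * indicator (cap u r) z \<partial>lborel)
        \<le> ennreal B * (ennreal (r powr (- s - 1)) * indicator {d..4} r)"
      proof (cases "r \<in> {d..4}")
        case True
        then have r: "0 < r" "r \<le> 4" using d by auto
        have "?k r * (\<integral>\<^sup>+z. ?w z * indicator (cap u r) z \<partial>lborel)
          \<le> ?k r * ennreal (B * r powr (real CARD('n) + 1 + t))"
          by (intro mult_left_mono B u r) simp
        also have "\<dots> = ennreal (B * (r powr (- g - 1) * r powr (real CARD('n) + 1 + t)))"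
          using True B(1) by (simp add: ennreal_mult[symmetric] mult_ac)
        also have "r powr (- g - 1) * r powr (real CARD('n) + 1 + t) = r powr (- s - 1)"
          unfolding s by (simp add: powr_add[symmetric] algebra_simps)
        finally show ?thesis using True B(1) by (simp add: ennreal_mult)
      qed simp
    qed
    also have "\<dots> = ennreal B * (\<integral>\<^sup>+r. ennreal (r powr (- s - 1)) * indicator {d..4} r \<partial>lborel)"
      by (rule nn_integral_cmult) measurable
    also have "\<dots> \<le> ennreal B * ennreal (if 0 < s then d powr (- s) / s else 4 powr (- s) / (- s))"
      using s(2) d by (intro mult_left_mono nn_integral_powr_Icc) auto
    finally have "(\<integral>\<^sup>+z. ennreal ((1 - norm z) powr t * norm (1 - herm z u) powr (- g)) * indicator unit_ball z \<partial>lborel)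
      \<le> ennreal c * (ennreal B * ennreal (if 0 < s then d powr (- s) / s else 4 powr (- s) / (- s)))"
      by (simp add: mult_left_mono)
    also have "\<dots> = ennreal (c * (B * (if 0 < s then d powr (- s) / s else 4 powr (- s) / (- s))))"
      using c B(1) by (simp add: ennreal_mult')
    also have "c * (B * (if 0 < s then d powr (- s) / s else 4 powr (- s) / (- s)))
        = C * (if 0 < s then (1 - norm u) powr (- s) else 1)"
      by (simp add: C_def d_def)
    finally show "(\<integral>\<^sup>+z. ennreal ((1 - norm z) powr t * norm (1 - herm z u) powr (- g)) * indicator unit_ball z \<partial>lborel)
        \<le> ennreal (C * (if 0 < s then (1 - norm u) powr (- s) else 1))" .
  qed
qed

subsection \<open>Mixed norms and a kernel bound\<close>

lemma epowr_ennreal: "0 \<le> x \<Longrightarrow> epowr (ennreal x) r = ennreal (x powr r)"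
  by (simp add: epowr_def)

lemma epowr_top [simp]: "epowr top r = top"
  by (simp add: epowr_def)

text \<open>This includes \<open>r = 0\<close>, because \<open>0 powr 0 = 0\<close>. Fixing both
  \<open>0\<close> and \<open>top\<close> makes \<open>epowr\<close> multiplicative also where
  \<open>0 * top = 0\<close>.\<close>

lemma epowr_0 [simp]: "epowr 0 r = 0"
  by (simp add: epowr_def)

lemma epowr_1 [simp]: "epowr x 1 = x"
  by (cases x) (auto simp: epowr_ennreal)

lemma epowr_mono: "x \<le> y \<Longrightarrow> 0 \<le> r \<Longrightarrow> epowr x r \<le> epowr y r"
  by (cases x; cases y) (auto simp: epowr_ennreal top_unique intro!: ennreal_leI powr_mono2)

lemma epowr_mult: "epowr (x * y) r = epowr x r * epowr y r"
proof (cases x; cases y)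
  fix a b :: real assume "0 \<le> a" "x = ennreal a" "0 \<le> b" "y = ennreal b"
  then show ?thesis by (simp add: ennreal_mult[symmetric] epowr_ennreal powr_mult)
next
  fix a :: real assume "0 \<le> a" "x = ennreal a" "y = top"
  then show ?thesis by (cases "a = 0") (auto simp: ennreal_mult_top epowr_ennreal)
next
  fix b :: real assume "x = top" "0 \<le> b" "y = ennreal b"
  then show ?thesis by (cases "b = 0") (auto simp: ennreal_top_mult epowr_ennreal)
next
  assume "x = top" "y = top"
  then show ?thesis by simp
qed

lemma epowr_epowr: "epowr (epowr x r) s = epowr x (r * s)"
  by (cases x) (auto simp: epowr_ennreal powr_powr)

lemma borel_measurable_epowr [measurable (raw)]:
  assumes [measurable]: "f \<in> borel_measurable M"
  shows "(\<lambda>x. epowr (f x) r) \<in> borel_measurable M"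
  unfolding epowr_def by measurable

text \<open>The tangent line at \<open>A\<close> to the convex function \<open>k powr q\<close>,
  solved for \<open>k\<close>.\<close>

lemma powr_tangent_le:
  fixes k A q :: real
  assumes "0 \<le> k" "0 < A" "1 \<le> q"
  shows "k \<le> (1 - 1 / q) * A + A powr (1 - q) / q * k powr q"
proof (cases "k = 0")
  case True
  then show ?thesis using assms by simp
next
  case False
  have "(k powr q * A powr (1 - q)) powr (1 / q) * A powr (1 - 1 / q)
    \<le> 1 / q * (k powr q * A powr (1 - q)) + (1 - 1 / q) * A"
    using assms False by (intro Youngs_inequality_0) auto
  also have "(k powr q * A powr (1 - q)) powr (1 / q) * A powr (1 - 1 / q)
      = k * (A powr ((1 - q) / q) * A powr (1 - 1 / q))"
    using assms by (simp add: powr_mult powr_powr)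
  also have "A powr ((1 - q) / q) * A powr (1 - 1 / q) = 1"
    using assms by (simp add: powr_add[symmetric] diff_divide_distrib)
  finally show ?thesis by (simp add: mult_ac)
qed

text \<open>Jensen's inequality for the measure with density \<open>F\<close>, not normalized,
  whence the power \<open>q - 1\<close> of its mass. It is the integrated tangent inequality, with
  tangent point \<open>A = g / m\<close>, the mean of \<open>k\<close>.\<close>

lemma epowr_nn_integral_le:
  fixes k :: "'x \<Rightarrow> real"
  assumes [measurable]: "k \<in> borel_measurable M" "F \<in> borel_measurable M"
    and k: "\<And>x. x \<in> space M \<Longrightarrow> 0 \<le> k x" and q: "1 \<le> q"
    and m: "(\<integral>\<^sup>+x. F x \<partial>M) < \<infinity>"
    and g: "(\<integral>\<^sup>+x. ennreal (k x) * F x \<partial>M) < \<infinity>"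
  shows "epowr (\<integral>\<^sup>+x. ennreal (k x) * F x \<partial>M) q
    \<le> epowr (\<integral>\<^sup>+x. F x \<partial>M) (q - 1) * (\<integral>\<^sup>+x. ennreal (k x powr q) * F x \<partial>M)"
proof -
  let ?G = "\<integral>\<^sup>+x. ennreal (k x powr q) * F x \<partial>M"
  obtain m where m: "(\<integral>\<^sup>+x. F x \<partial>M) = ennreal m" "0 \<le> m"
    using m by (cases "\<integral>\<^sup>+x. F x \<partial>M") auto
  obtain g where g: "(\<integral>\<^sup>+x. ennreal (k x) * F x \<partial>M) = ennreal g" "0 \<le> g"
    using g by (cases "\<integral>\<^sup>+x. ennreal (k x) * F x \<partial>M") auto
  show ?thesis
  proof (cases "g = 0")
    case True
    then show ?thesis using g by simp
  next
    case False
    have "m \<noteq> 0"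
    proof
      assume "m = 0"
      then have "AE x in M. F x = 0"
        using m by (simp add: nn_integral_0_iff_AE)
      then have "AE x in M. ennreal (k x) * F x = 0" by auto
      then have "(\<integral>\<^sup>+x. ennreal (k x) * F x \<partial>M) = 0"
        by (subst nn_integral_0_iff_AE) auto
      then show False using g False by simp
    qed
    then have pos: "0 < m" "0 < g" using m g False by auto
    define A where "A = g / m"
    have A: "0 < A" using pos by (simp add: A_def)
    show ?thesis
    proof (cases "?G")
      case (real G)
      define e where "e = A powr (1 - q) / q"
      have e: "0 \<le> e" using q by (simp add: e_def)
      have "ennreal g \<le> (\<integral>\<^sup>+x. ennreal ((1 - 1 / q) * A) * F x + ennreal e * (ennreal (k x powr q) * F x) \<partial>M)"
        unfolding g(1)[symmetric]
      proof (rule nn_integral_mono)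
        fix x assume "x \<in> space M"
        have "ennreal (k x) * F x \<le> ennreal ((1 - 1 / q) * A + e * k x powr q) * F x"
          unfolding e_def using powr_tangent_le[of "k x" A q] k[OF \<open>x \<in> space M\<close>] A q
          by (intro mult_right_mono ennreal_leI) auto
        also have "\<dots> = ennreal ((1 - 1 / q) * A) * F x + ennreal e * (ennreal (k x powr q) * F x)"
          using A q e by (simp add: ennreal_plus ennreal_mult' distrib_right mult.assoc)
        finally show "ennreal (k x) * F x \<le> ennreal ((1 - 1 / q) * A) * F x + ennreal e * (ennreal (k x powr q) * F x)" .
      qed
      also have "\<dots> = ennreal ((1 - 1 / q) * A) * ennreal m + ennreal e * ennreal G"
        by (simp add: nn_integral_add nn_integral_cmult m real)
      also have "\<dots> = ennreal ((1 - 1 / q) * A * m + e * G)"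
        using A q e m real by (simp add: ennreal_plus ennreal_mult)
      finally have "g \<le> (1 - 1 / q) * A * m + e * G"
        using A q e m real by (subst (asm) ennreal_le_iff) auto
      also have "(1 - 1 / q) * A * m = (1 - 1 / q) * g"
        using pos by (simp add: A_def)
      finally have "g / q \<le> A powr (1 - q) / q * G"
        by (simp add: e_def algebra_simps)
      then have "g \<le> A powr (1 - q) * G"
        using q by (simp add: divide_le_cancel)
      then have "A powr (q - 1) * g \<le> A powr (q - 1) * (A powr (1 - q) * G)"
        by (intro mult_left_mono) auto
      also have "\<dots> = G"
        using A by (simp add: mult.assoc[symmetric] powr_add[symmetric])
      finally have "m powr (q - 1) * (A powr (q - 1) * g) \<le> m powr (q - 1) * G"
        by (intro mult_left_mono) auto
      moreover have "m powr (q - 1) * (A powr (q - 1) * g) = g powr q"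
      proof -
        have "m powr (q - 1) * A powr (q - 1) = g powr (q - 1)"
          using pos by (simp add: A_def powr_mult[symmetric])
        then have "m powr (q - 1) * (A powr (q - 1) * g) = g powr (q - 1) * g"
          by (simp add: mult.assoc[symmetric])
        also have "\<dots> = g powr q"
          using pos by (simp add: powr_diff)
        finally show ?thesis .
      qed
      ultimately show ?thesis
        using pos real by (simp add: m g epowr_ennreal ennreal_mult[symmetric] ennreal_leI)
    next
      case top
      then show ?thesis using pos by (simp add: m epowr_ennreal ennreal_mult_top)
    qed
  qed
qed

text \<open>A substitute for Minkowski's integral inequality when the sections \<open>k _ x\<close> are bounded in
  \<open>L\<^sup>q\<close> uniformly in \<open>x\<close>.\<close>

lemma nn_integral_epowr_kernel_le:
  fixes k :: "'z \<Rightarrow> 'x \<Rightarrow> real"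
  assumes "sigma_finite_measure N" "sigma_finite_measure M"
    and [measurable]: "(\<lambda>(z, x). k z x) \<in> borel_measurable (N \<Otimes>\<^sub>M M)" "F \<in> borel_measurable M"
    and k: "\<And>z x. z \<in> space N \<Longrightarrow> x \<in> space M \<Longrightarrow> 0 \<le> k z x" and q: "1 \<le> q"
    and m: "(\<integral>\<^sup>+x. F x \<partial>M) < \<infinity>"
    and g: "\<And>z. z \<in> space N \<Longrightarrow> (\<integral>\<^sup>+x. ennreal (k z x) * F x \<partial>M) < \<infinity>"
    and B: "\<And>x. x \<in> space M \<Longrightarrow> (\<integral>\<^sup>+z. ennreal (k z x powr q) \<partial>N) \<le> B"
  shows "(\<integral>\<^sup>+z. epowr (\<integral>\<^sup>+x. ennreal (k z x) * F x \<partial>M) q \<partial>N) \<le> B * epowr (\<integral>\<^sup>+x. F x \<partial>M) q"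
proof -
  interpret N: sigma_finite_measure N by fact
  interpret M: sigma_finite_measure M by fact
  interpret pair_sigma_finite N M ..
  let ?m = "\<integral>\<^sup>+x. F x \<partial>M"
  \<comment> \<open>Jensen for each \<open>z\<close> moves the power inside the
    \<open>x\<close>-integral; after Tonelli the uniform bound \<open>B\<close> applies to each
    \<open>x\<close>.\<close>
  have "(\<integral>\<^sup>+z. epowr (\<integral>\<^sup>+x. ennreal (k z x) * F x \<partial>M) q \<partial>N)
    \<le> (\<integral>\<^sup>+z. epowr ?m (q - 1) * (\<integral>\<^sup>+x. ennreal (k z x powr q) * F x \<partial>M) \<partial>N)"
    using k q m g by (intro nn_integral_mono epowr_nn_integral_le) auto
  also have "\<dots> = epowr ?m (q - 1) * (\<integral>\<^sup>+z. (\<integral>\<^sup>+x. ennreal (k z x powr q) * F x \<partial>M) \<partial>N)"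
    by (rule nn_integral_cmult) measurable
  also have "(\<integral>\<^sup>+z. (\<integral>\<^sup>+x. ennreal (k z x powr q) * F x \<partial>M) \<partial>N)
      = (\<integral>\<^sup>+x. (\<integral>\<^sup>+z. ennreal (k z x powr q) * F x \<partial>N) \<partial>M)"
    by (rule Fubini'[symmetric]) measurable
  also have "\<dots> = (\<integral>\<^sup>+x. (\<integral>\<^sup>+z. ennreal (k z x powr q) \<partial>N) * F x \<partial>M)"
    by (intro nn_integral_cong nn_integral_multc) measurable
  also have "\<dots> \<le> (\<integral>\<^sup>+x. B * F x \<partial>M)"
    by (intro nn_integral_mono mult_right_mono B) auto
  also have "\<dots> = B * ?m"
    by (rule nn_integral_cmult) measurable
  finally have "(\<integral>\<^sup>+z. epowr (\<integral>\<^sup>+x. ennreal (k z x) * F x \<partial>M) q \<partial>N) \<le> epowr ?m (q - 1) * (B * ?m)"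
    by (simp add: mult_left_mono)
  also have "epowr ?m (q - 1) * (B * ?m) = B * epowr ?m q"
  proof -
    obtain r where r: "?m = ennreal r" "0 \<le> r" using m by (cases ?m) auto
    have "r powr (q - 1) * r = r powr q"
      using r by (cases "r = 0") (auto simp: powr_diff)
    then have "epowr ?m (q - 1) * ?m = epowr ?m q"
      using r by (simp add: epowr_ennreal ennreal_mult[symmetric])
    then show ?thesis by (simp add: mult.left_commute)
  qed
  finally show ?thesis .
qed

section \<open>Normalized volume and weighted measures on the ball\<close>

lemma space_vol [simp]: "space vol = unit_ball"
  by (simp add: vol_def uniform_measure_def space_restrict_space)

lemma sets_vol: "sets vol = sets (restrict_space borel unit_ball)"
  by (simp add: vol_def uniform_measure_def sets_restrict_space)

lemma measurable_ident_vol: "(\<lambda>z. z) \<in> vol \<rightarrow>\<^sub>M borel"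
proof -
  have "(\<lambda>z. z) \<in> restrict_space borel unit_ball \<rightarrow>\<^sub>M (borel :: (complex^'n) measure)"
    by (rule measurable_restrict_space1) simp
  then show ?thesis by (simp add: measurable_cong_sets[OF sets_vol refl])
qed

lemma borel_measurable_vol: "f \<in> borel \<rightarrow>\<^sub>M N \<Longrightarrow> f \<in> vol \<rightarrow>\<^sub>M N"
  using measurable_compose[OF measurable_ident_vol] by blast

lemma emeasure_vol_space: "emeasure lborel (unit_ball :: (complex^'n) set) \<noteq> 0"
  "emeasure lborel (unit_ball :: (complex^'n) set) \<noteq> \<infinity>"
  using emeasure_lborel_ball_pos[of 1 "0 :: complex^'n"] emeasure_lborel_ball_finite[of "0 :: complex^'n" 1]
  by (auto simp: unit_ball_def)

lemma nn_integral_vol: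
  fixes f :: "complex ^ 'n \<Rightarrow> ennreal"
  assumes "f \<in> borel_measurable vol"
  shows "(\<integral>\<^sup>+z. f z \<partial>vol) = (\<integral>\<^sup>+z. f z * indicator unit_ball z \<partial>lborel) / emeasure lborel (unit_ball :: (complex^'n) set)"
proof -
  have "f \<in> borel_measurable (restrict_space lborel unit_ball)"
    using assms by (simp add: vol_def uniform_measure_def cong: measurable_cong_sets)
  then have "(\<integral>\<^sup>+z. f z \<partial>vol) = (\<integral>\<^sup>+z. f z * indicator unit_ball z \<partial>restrict_space lborel unit_ball)
      / emeasure (restrict_space lborel unit_ball) (unit_ball :: (complex^'n) set)"
    unfolding vol_def by (rule nn_integral_uniform_measure) (auto simp: sets_restrict_space)
  also have "(\<integral>\<^sup>+z. f z * indicator unit_ball z \<partial>restrict_space lborel unit_ball)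
      = (\<integral>\<^sup>+z. f z * indicator unit_ball z * indicator unit_ball z \<partial>lborel)"
    by (rule nn_integral_restrict_space) simp
  also have "\<dots> = (\<integral>\<^sup>+z. f z * indicator unit_ball z \<partial>lborel)"
    by (intro nn_integral_cong) (simp add: indicator_def)
  also have "emeasure (restrict_space lborel unit_ball) (unit_ball :: (complex^'n) set) = emeasure lborel (unit_ball :: (complex^'n) set)"
    by (rule emeasure_restrict_space) auto
  finally show ?thesis .
qed

lemma finite_measure_vol: "finite_measure (vol :: (complex ^ 'n) measure)"
proof (rule finite_measureI)
  have "emeasure (restrict_space lborel unit_ball) (unit_ball :: (complex^'n) set) = emeasure lborel (unit_ball :: (complex^'n) set)"
    by (rule emeasure_restrict_space) auto
  then have "emeasure (vol :: (complex ^ 'n) measure) (space vol) = 1"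
    unfolding space_vol unfolding vol_def
    using emeasure_vol_space[where 'n='n] by (intro emeasure_uniform_measure_1) auto
  then show "emeasure (vol :: (complex ^ 'n) measure) (space vol) \<noteq> \<infinity>"
    by simp
qed

lemma c_const_pos: "-1 < \<theta> \<Longrightarrow> 0 < c_const n \<theta>"
  by (simp add: c_const_def)

lemma space_vol_weighted [simp]: "space (vol_weighted \<theta>) = unit_ball"
  by (simp add: vol_weighted_def)

lemma sets_vol_weighted [measurable_cong, simp]: "sets (vol_weighted \<theta>) = sets vol"
  by (simp add: vol_weighted_def)

lemma borel_measurable_weight [measurable]: "(\<lambda>z. ennreal (c * (1 - (norm z)\<^sup>2) powr \<theta>)) \<in> borel_measurable vol"
  by (rule borel_measurable_vol) measurable

lemma nn_integral_vol_weighted: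
  fixes f :: "complex ^ 'n \<Rightarrow> ennreal"
  assumes "f \<in> borel_measurable vol"
  shows "(\<integral>\<^sup>+z. f z \<partial>vol_weighted \<theta>)
    = (\<integral>\<^sup>+z. ennreal (c_const CARD('n) \<theta> * (1 - (norm z)\<^sup>2) powr \<theta>) * f z \<partial>vol)"
  unfolding vol_weighted_def using assms by (intro nn_integral_density) auto

lemma sigma_finite_vol: "sigma_finite_measure vol"
  by (rule finite_measure.axioms(1)[OF finite_measure_vol])

lemma sigma_finite_vol_weighted: "sigma_finite_measure (vol_weighted \<theta>)"
  unfolding vol_weighted_def
  by (subst sigma_finite_measure.sigma_finite_iff_density_finite[OF sigma_finite_vol]) auto

subsection \<open>Sufficiency\<close>

text \<open>The exponent \<open>e\<close> takes three values: \<open>b\<close> for the kernel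
  itself, \<open>b - \<alpha>\<close> after division by the weight of the domain space, and
  \<open>0\<close> in the necessity argument, where all powers of
  \<open>1 - (norm u)\<^sup>2\<close> stand on the other side.\<close>

definition factor :: "real \<Rightarrow> real \<Rightarrow> real \<Rightarrow> complex ^ 'n \<Rightarrow> complex ^ 'n \<Rightarrow> real" where
  "factor a e c z u = (1 - (norm z)\<^sup>2) powr a * (1 - (norm u)\<^sup>2) powr e / norm (1 - herm z u) powr c"

lemma factor_nonneg [simp]: "0 \<le> factor a e c z u"
  by (simp add: factor_def)

lemma borel_measurable_factor [measurable (raw)]:
  fixes f g :: "'a \<Rightarrow> complex ^ 'n"
  assumes [measurable]: "f \<in> borel_measurable M" "g \<in> borel_measurable M"
  shows "(\<lambda>x. factor a e c (f x) (g x)) \<in> borel_measurable M"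
  unfolding factor_def by measurable

text \<open>Yields absolute convergence of the operator at every point; this is where
  \<open>\<alpha> \<le> b\<close> enters independently of any norm estimate. The two terms of
  \<open>D\<close> serve the two signs of \<open>c\<close>.\<close>

lemma factor_bounded:
  fixes z :: "complex ^ 'n"
  assumes z: "norm z < 1" and e: "0 \<le> e"
  obtains B where "0 \<le> B" "\<And>u. norm u < 1 \<Longrightarrow> factor a e c z u \<le> B"
proof -
  define D where "D = (1 - norm z) powr (- c) + 2 powr (- c)"
  have "factor a e c z u \<le> (1 - (norm z)\<^sup>2) powr a * 1 * D" if u: "norm u < 1" for u
  proof -
    let ?x = "norm (1 - herm z u)"
    have x: "1 - norm z \<le> ?x" "?x \<le> 2"
      using norm_1_minus_herm_ge(1)[of z u] norm_1_minus_herm_le[of z u] z u by auto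
    have "?x powr (- c) \<le> D"
    proof (cases "0 \<le> c")
      case True
      then have "?x powr (- c) \<le> (1 - norm z) powr (- c)"
        using x z by (intro powr_mono2') auto
      then show ?thesis by (simp add: D_def add_increasing2)
    next
      case False
      then have "?x powr (- c) \<le> 2 powr (- c)"
        using x z by (intro powr_mono2) auto
      then show ?thesis by (simp add: D_def add_increasing)
    qed
    moreover have "(1 - (norm u)\<^sup>2) powr e \<le> 1"
      using e u powr_mono2[of e "1 - (norm u)\<^sup>2" 1] by (simp add: power_le_one)
    ultimately have "(1 - (norm z)\<^sup>2) powr a * (1 - (norm u)\<^sup>2) powr e * ?x powr (- c)
      \<le> (1 - (norm z)\<^sup>2) powr a * 1 * D"
      by (intro mult_mono) auto
    then show ?thesis by (simp add: factor_def powr_minus divide_inverse)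
  qed
  moreover have "0 \<le> (1 - (norm z)\<^sup>2) powr a * 1 * D" by (simp add: D_def)
  ultimately show thesis using that by blast
qed

text \<open>\<open>vol\<close> carries the restricted sigma-algebra of the ball, so the projections
  are composed with the inclusion into the whole space.\<close>

lemma measurable_vol_prod [measurable]:
  "fst \<in> borel_measurable (vol \<Otimes>\<^sub>M N)" "snd \<in> borel_measurable (N \<Otimes>\<^sub>M vol)"
  using measurable_compose[OF measurable_fst measurable_ident_vol]
    measurable_compose[OF measurable_snd measurable_ident_vol] by auto

lemma measurable_vol_prod2 [measurable]:
  "(\<lambda>x. fst (fst x)) \<in> borel_measurable ((vol \<Otimes>\<^sub>M N) \<Otimes>\<^sub>M N')"
  "(\<lambda>x. snd (fst x)) \<in> borel_measurable ((N \<Otimes>\<^sub>M vol) \<Otimes>\<^sub>M N')"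
  "(\<lambda>x. fst (snd x)) \<in> borel_measurable (N' \<Otimes>\<^sub>M (vol \<Otimes>\<^sub>M N))"
  "(\<lambda>x. snd (snd x)) \<in> borel_measurable (N' \<Otimes>\<^sub>M (N \<Otimes>\<^sub>M vol))"
  using measurable_compose[OF measurable_fst measurable_vol_prod(1)]
    measurable_compose[OF measurable_fst measurable_vol_prod(2)]
    measurable_compose[OF measurable_snd measurable_vol_prod(1)]
    measurable_compose[OF measurable_snd measurable_vol_prod(2)] by auto

lemma pair_sigma_finite_vol: "pair_sigma_finite vol vol"
  by (intro pair_sigma_finite.intro sigma_finite_vol)

text \<open>With both exponents equal to \<open>1\<close> the outer powers are trivial, and Tonelli
  merges the iterated integral into one over the product.\<close>

lemma mixed_norm_1_1:
  fixes f :: "'n::finite cpair \<Rightarrow> complex"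
  assumes [measurable]: "f \<in> borel_measurable (vol \<Otimes>\<^sub>M vol)"
    and \<alpha>: "\<forall>i. -1 < \<alpha> $ i"
  shows "mixed_norm (vector [1, 1]) \<alpha> f = ennreal (c_const CARD('n) (\<alpha> $ 1) * c_const CARD('n) (\<alpha> $ 2)) *
    (\<integral>\<^sup>+x. ennreal (norm (f x) * (1 - (norm (fst x))\<^sup>2) powr (\<alpha> $ 1) * (1 - (norm (snd x))\<^sup>2) powr (\<alpha> $ 2)) \<partial>(vol \<Otimes>\<^sub>M vol))"
proof -
  interpret pair_sigma_finite "vol :: (complex ^ 'n) measure" "vol :: (complex ^ 'n) measure"
    by (rule pair_sigma_finite_vol)
  let ?c1 = "c_const CARD('n) (\<alpha> $ 1)" and ?c2 = "c_const CARD('n) (\<alpha> $ 2)"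
  have c: "0 < ?c1" "0 < ?c2" using \<alpha> by (auto intro: c_const_pos)
  let ?F = "\<lambda>x. ennreal (norm (f x) * (1 - (norm (fst x))\<^sup>2) powr (\<alpha> $ 1) * (1 - (norm (snd x))\<^sup>2) powr (\<alpha> $ 2))"
  have [measurable]: "?F \<in> borel_measurable (vol \<Otimes>\<^sub>M vol)" by measurable
  have "mixed_norm (vector [1, 1]) \<alpha> f
    = (\<integral>\<^sup>+w. \<integral>\<^sup>+z. ennreal (norm (f (z, w))) \<partial>vol_weighted (\<alpha> $ 1) \<partial>vol_weighted (\<alpha> $ 2))"
    by (simp add: mixed_norm_def)
  also have "\<dots> = (\<integral>\<^sup>+w. \<integral>\<^sup>+z. ennreal (?c1 * (1 - (norm z)\<^sup>2) powr (\<alpha> $ 1)) * ennreal (norm (f (z, w))) \<partial>vol \<partial>vol_weighted (\<alpha> $ 2))"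
    by (intro nn_integral_cong nn_integral_vol_weighted) simp
  also have "\<dots> = (\<integral>\<^sup>+w. ennreal (?c2 * (1 - (norm w)\<^sup>2) powr (\<alpha> $ 2)) *
      (\<integral>\<^sup>+z. ennreal (?c1 * (1 - (norm z)\<^sup>2) powr (\<alpha> $ 1)) * ennreal (norm (f (z, w))) \<partial>vol) \<partial>vol)"
    by (intro nn_integral_vol_weighted) measurable
  also have "\<dots> = (\<integral>\<^sup>+w. ennreal (?c1 * ?c2) * (\<integral>\<^sup>+z. ?F (z, w) \<partial>vol) \<partial>vol)"
  proof (rule nn_integral_cong)
    fix w :: "complex ^ 'n" assume w: "w \<in> space vol"
    have "ennreal (?c2 * (1 - (norm w)\<^sup>2) powr (\<alpha> $ 2)) *
      (\<integral>\<^sup>+z. ennreal (?c1 * (1 - (norm z)\<^sup>2) powr (\<alpha> $ 1)) * ennreal (norm (f (z, w))) \<partial>vol)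
      = (\<integral>\<^sup>+z. ennreal (?c2 * (1 - (norm w)\<^sup>2) powr (\<alpha> $ 2)) *
        (ennreal (?c1 * (1 - (norm z)\<^sup>2) powr (\<alpha> $ 1)) * ennreal (norm (f (z, w)))) \<partial>vol)"
      using w by (intro nn_integral_cmult[symmetric]) measurable
    also have "\<dots> = (\<integral>\<^sup>+z. ennreal (?c1 * ?c2) * ?F (z, w) \<partial>vol)"
      using c by (intro nn_integral_cong) (simp add: ennreal_mult[symmetric] mult_ac)
    also have "\<dots> = ennreal (?c1 * ?c2) * (\<integral>\<^sup>+z. ?F (z, w) \<partial>vol)"
      using w by (intro nn_integral_cmult) measurable
    finally show "ennreal (?c2 * (1 - (norm w)\<^sup>2) powr (\<alpha> $ 2)) *
      (\<integral>\<^sup>+z. ennreal (?c1 * (1 - (norm z)\<^sup>2) powr (\<alpha> $ 1)) * ennreal (norm (f (z, w))) \<partial>vol)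
      = ennreal (?c1 * ?c2) * (\<integral>\<^sup>+z. ?F (z, w) \<partial>vol)" .
  qed
  also have "\<dots> = ennreal (?c1 * ?c2) * (\<integral>\<^sup>+w. (\<integral>\<^sup>+z. ?F (z, w) \<partial>vol) \<partial>vol)"
    by (rule nn_integral_cmult) measurable
  also have "(\<integral>\<^sup>+w. (\<integral>\<^sup>+z. ?F (z, w) \<partial>vol) \<partial>vol) = (\<integral>\<^sup>+x. ?F x \<partial>(vol \<Otimes>\<^sub>M vol))"
    by (rule nn_integral_snd) measurable
  finally show ?thesis .
qed

lemma integrable_cmult_complexD:
  fixes h :: "'a \<Rightarrow> complex"
  assumes "integrable M (\<lambda>x. s * h x)" "s \<noteq> 0"
  shows "integrable M h"
proof -
  have "integrable M (\<lambda>x. inverse s * (s * h x))"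
    using assms(1) by (rule integrable_mult_right)
  then show ?thesis using assms(2) by (simp flip: mult.assoc)
qed

text \<open>The kernel inequality is applied twice, in \<open>z\<close> with \<open>w\<close> fixed
  and then in \<open>w\<close>, each time with \<open>x\<close> running over the product space. The
  bounds \<open>M $ i\<close> contribute their \<open>q $ i\<close>-th roots, and the constants
  \<open>c_const\<close> come from expressing the mass of \<open>F\<close> by the norm of
  \<open>f\<close>.\<close>

lemma kernel_op_bounded_of_factors:
  fixes K :: "'n::finite cpair \<Rightarrow> 'n cpair \<Rightarrow> complex" and a b c \<alpha> \<beta> q M :: "real ^ 2"
  assumes K: "(\<lambda>(p, x). K p x) \<in> borel_measurable ((vol \<Otimes>\<^sub>M vol) \<Otimes>\<^sub>M (vol \<Otimes>\<^sub>M vol))"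
    and norm_K: "\<And>z w u \<eta>. norm z < 1 \<Longrightarrow> norm w < 1 \<Longrightarrow> norm u < 1 \<Longrightarrow> norm \<eta> < 1 \<Longrightarrow>
      norm (K (z, w) (u, \<eta>)) = factor 0 (b $ 1) (c $ 1) z u * factor 0 (b $ 2) (c $ 2) w \<eta>"
    and \<alpha>: "\<forall>i. -1 < \<alpha> $ i" and q: "\<forall>i. 1 \<le> q $ i" and b: "\<forall>i. \<alpha> $ i \<le> b $ i"
    and M0: "\<forall>i. 0 \<le> M $ i"
    and M: "\<And>i (u::complex^'n). norm u < 1 \<Longrightarrow>
      (\<integral>\<^sup>+z. ennreal (factor (a $ i) (b $ i - \<alpha> $ i) (c $ i) z u powr (q $ i)) \<partial>vol_weighted (\<beta> $ i)) \<le> ennreal (M $ i)"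
  shows "kernel_op_bounded a K (mixed_L (vector [1, 1]) \<alpha>) (mixed_norm (vector [1, 1]) \<alpha>) (mixed_L q \<beta>) (mixed_norm q \<beta>)"
proof -
  let ?P = "(vol :: (complex ^ 'n) measure) \<Otimes>\<^sub>M (vol :: (complex ^ 'n) measure)"
  interpret pair_sigma_finite "vol :: (complex ^ 'n) measure" "vol :: (complex ^ 'n) measure"
    by (rule pair_sigma_finite_vol)
  have P: "sigma_finite_measure ?P" ..
  interpret P: sigma_finite_measure ?P by (rule P)
  note [measurable] = K
  let ?c1 = "c_const CARD('n) (\<alpha> $ 1)" and ?c2 = "c_const CARD('n) (\<alpha> $ 2)"
  have c: "0 < ?c1" "0 < ?c2" using \<alpha> by (auto intro: c_const_pos)
  let ?k1 = "factor (a $ 1) (b $ 1 - \<alpha> $ 1) (c $ 1) :: complex ^ 'n \<Rightarrow> complex ^ 'n \<Rightarrow> real"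
  let ?k2 = "factor (a $ 2) (b $ 2 - \<alpha> $ 2) (c $ 2) :: complex ^ 'n \<Rightarrow> complex ^ 'n \<Rightarrow> real"
  have q0: "0 < q $ i" for i using q[rule_format, of i] by simp
  define C where "C = M $ 1 powr (1 / q $ 1) * M $ 2 powr (1 / q $ 2) / (?c1 * ?c2)"
  have main: "(\<forall>z\<in>unit_ball. \<forall>w\<in>unit_ball. integrable ?P (\<lambda>x. K (z, w) x * f x)) \<and>
      kernel_op a K f \<in> mixed_L q \<beta> \<and>
      mixed_norm q \<beta> (kernel_op a K f) \<le> ennreal C * mixed_norm (vector [1, 1]) \<alpha> f"
    if f: "f \<in> mixed_L (vector [1, 1]) \<alpha>" for f
  proof -
    have [measurable]: "f \<in> borel_measurable ?P" and fin: "mixed_norm (vector [1, 1]) \<alpha> f < \<infinity>"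
      using f by (auto simp: mixed_L_def)
    \<comment> \<open>The weights with exponents \<open>\<alpha>\<close> belong to \<open>F\<close>,
      so that its mass is the norm of \<open>f\<close> up to a constant; the kernel keeps the
      exponents \<open>b - \<alpha>\<close>.\<close>
    define F where "F = (\<lambda>x. ennreal (norm (f x) * (1 - (norm (fst x))\<^sup>2) powr (\<alpha> $ 1) * (1 - (norm (snd x))\<^sup>2) powr (\<alpha> $ 2)))"
    have [measurable]: "F \<in> borel_measurable ?P" unfolding F_def by measurable
    define m where "m = (\<integral>\<^sup>+x. F x \<partial>?P)"
    have norm_f: "mixed_norm (vector [1, 1]) \<alpha> f = ennreal (?c1 * ?c2) * m"
      unfolding m_def F_def using \<alpha> by (intro mixed_norm_1_1) auto
    have m: "m < \<infinity>"
    proof (rule ccontr)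
      assume "\<not> m < \<infinity>"
      then have "m = top" by (simp add: less_top[symmetric])
      then show False using fin c unfolding norm_f by (simp add: ennreal_mult_top)
    qed
    have K_eq: "ennreal (norm (of_real ((1 - (norm z)\<^sup>2) powr (a $ 1) * (1 - (norm w)\<^sup>2) powr (a $ 2)) * (K (z, w) x * f x)))
        = ennreal (?k1 z (fst x)) * (ennreal (?k2 w (snd x)) * F x)"
      if zw: "norm z < 1" "norm w < 1" and xP: "x \<in> space ?P" for z w x
    proof -
      obtain u \<eta> where x: "x = (u, \<eta>)" "norm u < 1" "norm \<eta> < 1"
        using xP by (cases x) (auto simp: space_pair_measure unit_ball_iff)
      have pos: "0 < 1 - (norm u)\<^sup>2" "0 < 1 - (norm \<eta>)\<^sup>2"
        using x by (simp_all add: power_less_one_iff)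
      show ?thesis
        unfolding F_def x norm_mult norm_K[OF zw x(2,3)]
        using pos by (simp add: ennreal_mult[symmetric] factor_def powr_diff field_simps norm_mult
            abs_of_nonneg)
    qed
    have fin2: "(\<integral>\<^sup>+x. ennreal (?k2 w (snd x)) * F x \<partial>?P) < \<infinity>" if w: "norm w < 1" for w
    proof -
      obtain B where B: "\<And>\<eta>. norm \<eta> < 1 \<Longrightarrow> ?k2 w \<eta> \<le> B"
        by (rule factor_bounded[OF w, of "b $ 2 - \<alpha> $ 2" "a $ 2" "c $ 2"]) (use b in auto)
      have "(\<integral>\<^sup>+x. ennreal (?k2 w (snd x)) * F x \<partial>?P) \<le> (\<integral>\<^sup>+x. ennreal B * F x \<partial>?P)"
        by (intro nn_integral_mono mult_right_mono ennreal_leI B) (auto simp: space_pair_measure unit_ball_iff)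
      also have "\<dots> = ennreal B * m"
        unfolding m_def by (rule nn_integral_cmult) simp
      also have "\<dots> < \<infinity>" using m by (simp add: ennreal_mult_less_top)
      finally show ?thesis .
    qed
    have fin1: "(\<integral>\<^sup>+x. ennreal (?k1 z (fst x)) * (ennreal (?k2 w (snd x)) * F x) \<partial>?P) < \<infinity>"
      if zw: "norm z < 1" "norm w < 1" for z w
    proof -
      obtain B where B: "\<And>u. norm u < 1 \<Longrightarrow> ?k1 z u \<le> B"
        by (rule factor_bounded[OF zw(1), of "b $ 1 - \<alpha> $ 1" "a $ 1" "c $ 1"]) (use b in auto)
      have "(\<integral>\<^sup>+x. ennreal (?k1 z (fst x)) * (ennreal (?k2 w (snd x)) * F x) \<partial>?P)
        \<le> (\<integral>\<^sup>+x. ennreal B * (ennreal (?k2 w (snd x)) * F x) \<partial>?P)"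
        by (intro nn_integral_mono mult_right_mono ennreal_leI B) (auto simp: space_pair_measure unit_ball_iff)
      also have "\<dots> = ennreal B * (\<integral>\<^sup>+x. ennreal (?k2 w (snd x)) * F x \<partial>?P)"
        by (rule nn_integral_cmult) measurable
      also have "\<dots> < \<infinity>" using fin2[OF zw(2)] by (simp add: ennreal_mult_less_top)
      finally show ?thesis .
    qed
    have meas_K: "(\<lambda>x. K p x * f x) \<in> borel_measurable ?P" if "p \<in> space ?P" for p
      using that by measurable
    have int: "integrable ?P (\<lambda>x. K (z, w) x * f x)" if zw: "norm z < 1" "norm w < 1" for z w
    proof -
      let ?r = "(1 - (norm z)\<^sup>2) powr (a $ 1) * (1 - (norm w)\<^sup>2) powr (a $ 2)"
      have r: "complex_of_real ?r \<noteq> 0"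
        using zw norm_ge_zero[of z] norm_ge_zero[of w]
        by (simp del: norm_ge_zero add: power2_eq_1_iff)
      \<comment> \<open>The identity \<open>K_eq\<close> contains the prefactor in \<open>z\<close>
        and \<open>w\<close>, so integrability is shown with it; being nonzero, it is divided out
        afterwards.\<close>
      have "integrable ?P (\<lambda>x. of_real ?r * (K (z, w) x * f x))"
      proof (rule integrableI_bounded)
        show "(\<lambda>x. of_real ?r * (K (z, w) x * f x)) \<in> borel_measurable ?P"
          using meas_K[of "(z, w)"] zw by (simp add: space_pair_measure unit_ball_iff)
        have "(\<integral>\<^sup>+x. ennreal (norm (of_real ?r * (K (z, w) x * f x))) \<partial>?P)
          = (\<integral>\<^sup>+x. ennreal (?k1 z (fst x)) * (ennreal (?k2 w (snd x)) * F x) \<partial>?P)"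
          by (intro nn_integral_cong K_eq zw)
        then show "(\<integral>\<^sup>+x. ennreal (norm (of_real ?r * (K (z, w) x * f x))) \<partial>?P) < \<infinity>"
          using fin1[OF zw] by simp
      qed
      from integrable_cmult_complexD[OF this r] show ?thesis .
    qed
    define T where "T = kernel_op a K f"
    have [measurable]: "T \<in> borel_measurable ?P"
    proof -
      have "(\<lambda>p. of_real ((1 - (norm (fst p))\<^sup>2) powr (a $ 1) * (1 - (norm (snd p))\<^sup>2) powr (a $ 2)) *
          (\<integral>x. K p x * f x \<partial>?P)) \<in> borel_measurable ?P"
        by measurable
      then show ?thesis by (simp add: T_def kernel_op_def case_prod_beta')
    qed
    have norm_T: "ennreal (norm (T (z, w))) \<le> (\<integral>\<^sup>+x. ennreal (?k1 z (fst x)) * (ennreal (?k2 w (snd x)) * F x) \<partial>?P)"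
      if zw: "norm z < 1" "norm w < 1" for z w
    proof -
      let ?r = "(1 - (norm z)\<^sup>2) powr (a $ 1) * (1 - (norm w)\<^sup>2) powr (a $ 2)"
      have "T (z, w) = (\<integral>x. of_real ?r * (K (z, w) x * f x) \<partial>?P)"
        by (simp add: T_def kernel_op_def)
      also have "ennreal (norm \<dots>) \<le> (\<integral>\<^sup>+x. ennreal (norm (of_real ?r * (K (z, w) x * f x))) \<partial>?P)"
        using int[OF zw] by (intro integral_norm_bound_ennreal integrable_mult_right)
      also have "\<dots> = (\<integral>\<^sup>+x. ennreal (?k1 z (fst x)) * (ennreal (?k2 w (snd x)) * F x) \<partial>?P)"
        by (intro nn_integral_cong K_eq zw)
      finally show ?thesis .
    qed
    have inner: "epowr (\<integral>\<^sup>+z. ennreal (norm (T (z, w)) powr (q $ 1)) \<partial>vol_weighted (\<beta> $ 1)) (q $ 2 / q $ 1)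
        \<le> epowr (ennreal (M $ 1)) (q $ 2 / q $ 1) * epowr (\<integral>\<^sup>+x. ennreal (?k2 w (snd x)) * F x \<partial>?P) (q $ 2)"
      if w: "norm w < 1" for w
    proof -
      have "(\<integral>\<^sup>+z. ennreal (norm (T (z, w)) powr (q $ 1)) \<partial>vol_weighted (\<beta> $ 1))
        \<le> (\<integral>\<^sup>+z. epowr (\<integral>\<^sup>+x. ennreal (?k1 z (fst x)) * (ennreal (?k2 w (snd x)) * F x) \<partial>?P) (q $ 1) \<partial>vol_weighted (\<beta> $ 1))"
      proof (rule nn_integral_mono)
        fix z :: "complex ^ 'n" assume "z \<in> space (vol_weighted (\<beta> $ 1))"
        then have z: "norm z < 1" by (simp add: unit_ball_iff)
        show "ennreal (norm (T (z, w)) powr (q $ 1))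
          \<le> epowr (\<integral>\<^sup>+x. ennreal (?k1 z (fst x)) * (ennreal (?k2 w (snd x)) * F x) \<partial>?P) (q $ 1)"
          using epowr_mono[OF norm_T[OF z w], of "q $ 1"] q0[of 1] by (simp add: epowr_ennreal)
      qed
      \<comment> \<open>Here the second factor, with \<open>w\<close> fixed, is part of the density.
        It survives only through the mass of that density, to which the same inequality is applied
        in \<open>w\<close>.\<close>
      also have "\<dots> \<le> ennreal (M $ 1) * epowr (\<integral>\<^sup>+x. ennreal (?k2 w (snd x)) * F x \<partial>?P) (q $ 1)"
      proof (rule nn_integral_epowr_kernel_le)
        show "(\<lambda>(z, x). ?k1 z (fst x)) \<in> borel_measurable (vol_weighted (\<beta> $ 1) \<Otimes>\<^sub>M ?P)"
          by measurable
        show "(\<integral>\<^sup>+z. ennreal (?k1 z (fst x) powr (q $ 1)) \<partial>vol_weighted (\<beta> $ 1)) \<le> ennreal (M $ 1)" if "x \<in> space ?P" for x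
          using M[of "fst x" 1] that by (auto simp: space_pair_measure unit_ball_iff)
      qed (use q fin1 fin2 w sigma_finite_vol_weighted P in \<open>auto simp: unit_ball_iff\<close>)
      finally have "epowr (\<integral>\<^sup>+z. ennreal (norm (T (z, w)) powr (q $ 1)) \<partial>vol_weighted (\<beta> $ 1)) (q $ 2 / q $ 1)
        \<le> epowr (ennreal (M $ 1) * epowr (\<integral>\<^sup>+x. ennreal (?k2 w (snd x)) * F x \<partial>?P) (q $ 1)) (q $ 2 / q $ 1)"
        using q0 by (intro epowr_mono) (auto intro: less_imp_le)
      also have "\<dots> = epowr (ennreal (M $ 1)) (q $ 2 / q $ 1) * epowr (\<integral>\<^sup>+x. ennreal (?k2 w (snd x)) * F x \<partial>?P) (q $ 2)"
        using q0[of 1] by (simp add: epowr_mult epowr_epowr)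
      finally show ?thesis .
    qed
    have "mixed_norm q \<beta> T \<le> epowr (\<integral>\<^sup>+w. epowr (ennreal (M $ 1)) (q $ 2 / q $ 1) *
        epowr (\<integral>\<^sup>+x. ennreal (?k2 w (snd x)) * F x \<partial>?P) (q $ 2) \<partial>vol_weighted (\<beta> $ 2)) (1 / q $ 2)"
      unfolding mixed_norm_def using q0[of 2]
      by (intro epowr_mono nn_integral_mono inner) (auto simp: unit_ball_iff)
    also have "(\<integral>\<^sup>+w. epowr (ennreal (M $ 1)) (q $ 2 / q $ 1) *
        epowr (\<integral>\<^sup>+x. ennreal (?k2 w (snd x)) * F x \<partial>?P) (q $ 2) \<partial>vol_weighted (\<beta> $ 2))
      = epowr (ennreal (M $ 1)) (q $ 2 / q $ 1) *
        (\<integral>\<^sup>+w. epowr (\<integral>\<^sup>+x. ennreal (?k2 w (snd x)) * F x \<partial>?P) (q $ 2) \<partial>vol_weighted (\<beta> $ 2))"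
      by (rule nn_integral_cmult) measurable
    also have "epowr \<dots> (1 / q $ 2) \<le> epowr (epowr (ennreal (M $ 1)) (q $ 2 / q $ 1) * (ennreal (M $ 2) * epowr m (q $ 2))) (1 / q $ 2)"
    proof (intro epowr_mono mult_left_mono)
      show "(\<integral>\<^sup>+w. epowr (\<integral>\<^sup>+x. ennreal (?k2 w (snd x)) * F x \<partial>?P) (q $ 2) \<partial>vol_weighted (\<beta> $ 2))
        \<le> ennreal (M $ 2) * epowr m (q $ 2)"
        unfolding m_def
      proof (rule nn_integral_epowr_kernel_le)
        show "(\<lambda>(w, x). ?k2 w (snd x)) \<in> borel_measurable (vol_weighted (\<beta> $ 2) \<Otimes>\<^sub>M ?P)"
          by measurable
        show "(\<integral>\<^sup>+w. ennreal (?k2 w (snd x) powr (q $ 2)) \<partial>vol_weighted (\<beta> $ 2)) \<le> ennreal (M $ 2)" if "x \<in> space ?P" for x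
          using M[of "snd x" 2] that by (auto simp: space_pair_measure unit_ball_iff)
      qed (use q fin2 m sigma_finite_vol_weighted P in \<open>auto simp: unit_ball_iff m_def\<close>)
    qed (use q0[of 2] in auto)
    also have "\<dots> = ennreal (M $ 1 powr (1 / q $ 1) * M $ 2 powr (1 / q $ 2)) * m"
      using q0[of 1] q0[of 2] M0 by (simp add: epowr_mult epowr_epowr epowr_ennreal powr_powr ennreal_mult mult.assoc)
    also have "\<dots> = ennreal C * mixed_norm (vector [1, 1]) \<alpha> f"
      using c M0 unfolding norm_f mult.assoc[symmetric]
      by (subst ennreal_mult[symmetric]) (auto simp: C_def)
    finally have bound: "mixed_norm q \<beta> T \<le> ennreal C * mixed_norm (vector [1, 1]) \<alpha> f" .
    also have "\<dots> < \<infinity>" using fin by (simp add: ennreal_mult_less_top)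
    finally have "T \<in> mixed_L q \<beta>" by (simp add: mixed_L_def)
    then show ?thesis using int bound by (auto simp: T_def unit_ball_iff)
  qed
  then show ?thesis unfolding kernel_op_bounded_def by blast
qed

section \<open>Comparison of weights and the one-variable condition\<close>

lemma one_minus_norm_sq:
  fixes z :: "'a::real_normed_vector"
  assumes "norm z < 1"
  shows "0 < 1 - norm z" "1 - norm z \<le> 1 - (norm z)\<^sup>2" "1 - (norm z)\<^sup>2 \<le> 2 * (1 - norm z)"
    "0 < 1 - (norm z)\<^sup>2"
proof -
  have eq: "1 - (norm z)\<^sup>2 = (1 - norm z) * (1 + norm z)"
    by (simp add: power2_eq_square algebra_simps)
  show "0 < 1 - norm z" using assms by simp
  then show "1 - norm z \<le> 1 - (norm z)\<^sup>2" "1 - (norm z)\<^sup>2 \<le> 2 * (1 - norm z)"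
    unfolding eq using assms mult_left_mono[of 1 "1 + norm z" "1 - norm z"]
      mult_left_mono[of "1 + norm z" 2 "1 - norm z"] by (simp_all add: mult.commute)
  then show "0 < 1 - (norm z)\<^sup>2" using \<open>0 < 1 - norm z\<close> by linarith
qed

text \<open>One of the two comparisons serves positive exponents and the other negative ones; hence
  the absolute value in the constant.\<close>

lemma powr_comparable:
  fixes x y t k :: real
  assumes "0 < x" "x \<le> k * y" "y \<le> k * x" "0 < k"
  shows "x powr t \<le> k powr \<bar>t\<bar> * y powr t"
proof -
  have y: "0 < y" using assms by (smt (verit) mult_pos_pos zero_less_mult_pos)
  show ?thesis
  proof (cases "0 \<le> t")
    case True
    then have "x powr t \<le> (k * y) powr t" using assms by (intro powr_mono2) auto
    then show ?thesis using True assms y by (simp add: powr_mult)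
  next
    case False
    then have "x powr t \<le> (y / k) powr t"
      using assms y by (intro powr_mono2') (auto simp: field_simps)
    then show ?thesis using False assms y by (simp add: powr_divide powr_minus_divide)
  qed
qed

lemma powr_comparable_lower:
  fixes x y t k :: real
  assumes "0 < x" "x \<le> k * y" "y \<le> k * x" "0 < k"
  shows "k powr (- \<bar>t\<bar>) * x powr t \<le> y powr t"
proof -
  have "k powr (- \<bar>t\<bar>) * x powr t \<le> k powr (- \<bar>t\<bar>) * (k powr \<bar>t\<bar> * y powr t)"
    using powr_comparable[OF assms] by (intro mult_left_mono) auto
  also have "\<dots> = y powr t"
    using assms by (simp add: mult.assoc[symmetric] powr_add[symmetric])
  finally show ?thesis .
qed

text \<open>The Forelli-Rudin form of the one-variable norm, with weight exponent
  \<open>q * a + \<beta>\<close> and kernel exponent \<open>q * c\<close>. It is an identity because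
  both directions of the equivalence read it.\<close>

lemma nn_integral_factor:
  fixes u :: "complex ^ 'n"
  assumes u: "norm u < 1" and \<beta>: "-1 < \<beta>"
  shows "(\<integral>\<^sup>+z. ennreal (factor a e c z u powr q) \<partial>vol_weighted \<beta>) =
    ennreal (c_const CARD('n) \<beta> * (1 - (norm u)\<^sup>2) powr (q * e)) *
    (\<integral>\<^sup>+z. ennreal ((1 - (norm z)\<^sup>2) powr (q * a + \<beta>) * norm (1 - herm z u) powr (- (q * c))) * indicator unit_ball z \<partial>lborel)
      / emeasure lborel (unit_ball :: (complex^'n) set)"
proof -
  have [measurable]: "(\<lambda>z. ennreal (factor a e c z u powr q)) \<in> borel_measurable vol"
    by (rule borel_measurable_vol) measurable
  have [measurable]: "(\<lambda>z::complex^'n. ennreal (c * (1 - (norm z)\<^sup>2) powr \<theta>)) \<in> borel_measurable vol" for c \<theta>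
    by (rule borel_measurable_weight)
  have "(\<integral>\<^sup>+z. ennreal (factor a e c z u powr q) \<partial>vol_weighted \<beta>) =
    (\<integral>\<^sup>+z. ennreal (c_const CARD('n) \<beta> * (1 - (norm z)\<^sup>2) powr \<beta>) * ennreal (factor a e c z u powr q) \<partial>vol)"
    by (rule nn_integral_vol_weighted) measurable
  also have "\<dots> = (\<integral>\<^sup>+z. ennreal (c_const CARD('n) \<beta> * (1 - (norm z)\<^sup>2) powr \<beta>) * ennreal (factor a e c z u powr q) * indicator unit_ball z \<partial>lborel)
    / emeasure lborel (unit_ball :: (complex^'n) set)"
    by (rule nn_integral_vol) measurable
  also have "(\<integral>\<^sup>+z. ennreal (c_const CARD('n) \<beta> * (1 - (norm z)\<^sup>2) powr \<beta>) * ennreal (factor a e c z u powr q) * indicator unit_ball z \<partial>lborel)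
    = (\<integral>\<^sup>+z. ennreal (c_const CARD('n) \<beta> * (1 - (norm u)\<^sup>2) powr (q * e)) *
      (ennreal ((1 - (norm z)\<^sup>2) powr (q * a + \<beta>) * norm (1 - herm z u) powr (- (q * c))) * indicator unit_ball z) \<partial>lborel)"
  proof (rule nn_integral_cong)
    fix z :: "complex ^ 'n"
    show "ennreal (c_const CARD('n) \<beta> * (1 - (norm z)\<^sup>2) powr \<beta>) * ennreal (factor a e c z u powr q) * indicator unit_ball z
      = ennreal (c_const CARD('n) \<beta> * (1 - (norm u)\<^sup>2) powr (q * e)) *
      (ennreal ((1 - (norm z)\<^sup>2) powr (q * a + \<beta>) * norm (1 - herm z u) powr (- (q * c))) * indicator unit_ball z)"
    proof (cases "norm z < 1")
      case True
      have "factor a e c z u powr q = (1 - (norm z)\<^sup>2) powr (q * a) * (1 - (norm u)\<^sup>2) powr (q * e) * norm (1 - herm z u) powr (- (q * c))"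
        by (simp add: factor_def divide_powr_uminus powr_mult powr_powr mult.commute)
      then show ?thesis using True c_const_pos[OF \<beta>, of "CARD('n)"]
        by (simp add: unit_ball_iff ennreal_mult[symmetric] powr_add mult_ac)
    qed (simp add: unit_ball_iff)
  qed
  also have "\<dots> = ennreal (c_const CARD('n) \<beta> * (1 - (norm u)\<^sup>2) powr (q * e)) *
    (\<integral>\<^sup>+z. ennreal ((1 - (norm z)\<^sup>2) powr (q * a + \<beta>) * norm (1 - herm z u) powr (- (q * c))) * indicator unit_ball z \<partial>lborel)"
    by (rule nn_integral_cmult) measurable
  finally show ?thesis .
qed

text \<open>The condition on a single coordinate. Alternatives (A) to (D) arise by distributing the
  conjunction over \<open>i = 1, 2\<close> across the disjunction inside.\<close>

definition admissible :: "nat \<Rightarrow> real \<Rightarrow> real \<Rightarrow> real \<Rightarrow> real \<Rightarrow> real \<Rightarrow> real \<Rightarrow> bool" where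
  "admissible n a b c \<alpha> \<beta> q \<longleftrightarrow> - (q * a) < \<beta> + 1 \<and>
    ((\<alpha> < b \<and> c \<le> a + b - \<alpha> + (real n + 1 + \<beta>) / q) \<or> (\<alpha> = b \<and> c < a + (real n + 1 + \<beta>) / q))"

text \<open>Both alternatives stay away from the critical exponent and its logarithm. If
  \<open>0 < e\<close>, the exponent is raised to the largest allowed value, where the integral is
  at most a multiple of the power that the prefactor cancels. If \<open>e = 0\<close>, the strict
  inequality makes the integral bounded.\<close>

lemma factor_integral_bounded_aux:
  fixes t g e :: real
  assumes t: "-1 < t" and e: "0 < e \<and> g \<le> real CARD('n) + 1 + t + e \<or> e = 0 \<and> g < real CARD('n) + 1 + t"
  obtains M where "0 \<le> M"
    "\<And>u::complex^'n. norm u < 1 \<Longrightarrow> ennreal ((1 - (norm u)\<^sup>2) powr e) *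
      (\<integral>\<^sup>+z. ennreal ((1 - (norm z)\<^sup>2) powr t * norm (1 - herm z u) powr (- g)) * indicator unit_ball z \<partial>lborel) \<le> ennreal M"
proof -
  \<comment> \<open>Since \<open>norm (1 - herm z u) \<le> 2\<close>, replacing \<open>g\<close> by
    the larger \<open>g'\<close> costs only the factor \<open>2 powr (g' - g)\<close>.\<close>
  define g' where "g' = (if 0 < e then real CARD('n) + 1 + t + e else g)"
  have g: "g \<le> g'" using e by (auto simp: g'_def)
  define s where "s = g' - (real CARD('n) + 1 + t)"
  have s: "s = (if 0 < e then e else g - (real CARD('n) + 1 + t))" "s \<noteq> 0"
    using e by (auto simp: s_def g'_def)
  obtain C where C: "0 < C"
    "\<And>u::complex^'n. norm u < 1 \<Longrightarrow>
      (\<integral>\<^sup>+z. ennreal ((1 - norm z) powr t * norm (1 - herm z u) powr (- g')) * indicator unit_ball z \<partial>lborel)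
        \<le> ennreal (C * (if 0 < s then (1 - norm u) powr (- s) else 1))"
    by (rule forelli_rudin_le[OF t s_def s(2)]) blast
  define D where "D = 2 powr \<bar>t\<bar> * 2 powr (g' - g)"
  show thesis
  proof (rule that)
    show "0 \<le> 2 powr e * (D * C)" using C by (simp add: D_def)
    fix u :: "complex ^ 'n" assume u: "norm u < 1"
    let ?I = "\<integral>\<^sup>+z. ennreal ((1 - (norm z)\<^sup>2) powr t * norm (1 - herm z u) powr (- g)) * indicator unit_ball z \<partial>lborel"
    have "?I \<le> (\<integral>\<^sup>+z. ennreal D * (ennreal ((1 - norm z) powr t * norm (1 - herm z u) powr (- g')) * indicator unit_ball z) \<partial>lborel)"
    proof (rule nn_integral_mono)
      fix z :: "complex ^ 'n"
      show "ennreal ((1 - (norm z)\<^sup>2) powr t * norm (1 - herm z u) powr (- g)) * indicator unit_ball z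
        \<le> ennreal D * (ennreal ((1 - norm z) powr t * norm (1 - herm z u) powr (- g')) * indicator unit_ball z)"
      proof (cases "norm z < 1")
        case True
        let ?x = "norm (1 - herm z u)"
        have x: "0 < ?x" "?x \<le> 2"
          using norm_1_minus_herm_ge(2)[of z u] norm_1_minus_herm_le[of z u] u True by auto
        have 1: "(1 - (norm z)\<^sup>2) powr t \<le> 2 powr \<bar>t\<bar> * (1 - norm z) powr t"
          using one_minus_norm_sq[OF True] by (intro powr_comparable) auto
        have "?x powr (- g) = ?x powr (g' - g) * ?x powr (- g')"
          by (simp flip: powr_add)
        also have "\<dots> \<le> 2 powr (g' - g) * ?x powr (- g')"
          using x g by (intro mult_right_mono powr_mono2) auto
        finally have "(1 - (norm z)\<^sup>2) powr t * ?x powr (- g) \<le> 2 powr \<bar>t\<bar> * (1 - norm z) powr t * (2 powr (g' - g) * ?x powr (- g'))"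
          using 1 by (intro mult_mono) auto
        then show ?thesis using True
          by (simp add: unit_ball_iff ennreal_mult[symmetric] D_def ennreal_leI mult_ac)
      qed (simp add: unit_ball_iff)
    qed
    also have "\<dots> = ennreal D * (\<integral>\<^sup>+z. ennreal ((1 - norm z) powr t * norm (1 - herm z u) powr (- g')) * indicator unit_ball z \<partial>lborel)"
      by (rule nn_integral_cmult) measurable
    also have "\<dots> \<le> ennreal D * ennreal (C * (if 0 < s then (1 - norm u) powr (- s) else 1))"
      by (intro mult_left_mono C u) simp
    finally have "ennreal ((1 - (norm u)\<^sup>2) powr e) * ?I
      \<le> ennreal ((1 - (norm u)\<^sup>2) powr e) * (ennreal D * ennreal (C * (if 0 < s then (1 - norm u) powr (- s) else 1)))"
      by (intro mult_left_mono) auto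
    also have "\<dots> = ennreal ((1 - (norm u)\<^sup>2) powr e * (D * (C * (if 0 < s then (1 - norm u) powr (- s) else 1))))"
      using C by (simp add: ennreal_mult D_def)
    also have "\<dots> \<le> ennreal (2 powr e * (D * C))"
    proof (rule ennreal_leI)
      have "(1 - (norm u)\<^sup>2) powr e * (if 0 < s then (1 - norm u) powr (- s) else 1) \<le> 2 powr e"
      proof (cases "0 < e")
        case True
        have "(1 - (norm u)\<^sup>2) powr e \<le> 2 powr e * (1 - norm u) powr e"
          using powr_comparable[of "1 - (norm u)\<^sup>2" 2 "1 - norm u" e] one_minus_norm_sq[OF u] True by auto
        then have "(1 - (norm u)\<^sup>2) powr e * (1 - norm u) powr (- e) \<le> 2 powr e * (1 - norm u) powr e * (1 - norm u) powr (- e)"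
          by (intro mult_right_mono) auto
        also have "\<dots> = 2 powr e"
          using u by (simp add: mult.assoc flip: powr_add)
        finally show ?thesis using True s by simp
      next
        case False
        then show ?thesis using s e one_minus_norm_sq[OF u] by auto
      qed
      then have "(D * C) * ((1 - (norm u)\<^sup>2) powr e * (if 0 < s then (1 - norm u) powr (- s) else 1)) \<le> (D * C) * 2 powr e"
        using C by (intro mult_left_mono) (auto simp: D_def)
      then show "(1 - (norm u)\<^sup>2) powr e * (D * (C * (if 0 < s then (1 - norm u) powr (- s) else 1))) \<le> 2 powr e * (D * C)"
        by (simp add: mult_ac)
    qed
    finally show "ennreal ((1 - (norm u)\<^sup>2) powr e) * ?I \<le> ennreal (2 powr e * (D * C))" .
  qed
qed

lemma admissible_imp_factor_bounded:
  fixes a b c \<alpha> \<beta> q :: real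
  assumes adm: "admissible CARD('n) a b c \<alpha> \<beta> q" and q: "1 \<le> q" and \<beta>: "-1 < \<beta>"
  obtains M where "0 \<le> M"
    "\<And>u::complex^'n. norm u < 1 \<Longrightarrow>
      (\<integral>\<^sup>+z. ennreal (factor a (b - \<alpha>) c z u powr q) \<partial>vol_weighted \<beta>) \<le> ennreal M"
proof -
  let ?n = "real CARD('n)"
  have q0: "q \<noteq> 0" using q by simp
  have t: "-1 < q * a + \<beta>" using adm by (auto simp: admissible_def)
  have "0 < q * (b - \<alpha>) \<and> q * c \<le> ?n + 1 + (q * a + \<beta>) + q * (b - \<alpha>) \<or>
      q * (b - \<alpha>) = 0 \<and> q * c < ?n + 1 + (q * a + \<beta>)"
  proof (cases "\<alpha> < b")
    case True
    then have "c \<le> a + b - \<alpha> + (?n + 1 + \<beta>) / q" using adm by (auto simp: admissible_def)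
    then have "q * c \<le> q * (a + b - \<alpha> + (?n + 1 + \<beta>) / q)" using q by (intro mult_left_mono) auto
    also have "\<dots> = ?n + 1 + (q * a + \<beta>) + q * (b - \<alpha>)" using q0 by (simp add: field_simps)
    finally show ?thesis using True q by auto
  next
    case False
    then have "\<alpha> = b" "c < a + (?n + 1 + \<beta>) / q" using adm by (auto simp: admissible_def)
    then have "q * c < q * (a + (?n + 1 + \<beta>) / q)" using q by (intro mult_strict_left_mono) auto
    also have "\<dots> = ?n + 1 + (q * a + \<beta>)" using q0 by (simp add: field_simps)
    finally show ?thesis using \<open>\<alpha> = b\<close> by auto
  qed
  then obtain M where M: "0 \<le> M" "\<And>u::complex^'n. norm u < 1 \<Longrightarrow> ennreal ((1 - (norm u)\<^sup>2) powr (q * (b - \<alpha>))) *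
      (\<integral>\<^sup>+z. ennreal ((1 - (norm z)\<^sup>2) powr (q * a + \<beta>) * norm (1 - herm z u) powr (- (q * c))) * indicator unit_ball z \<partial>lborel) \<le> ennreal M"
    by (rule factor_integral_bounded_aux[OF t]) blast
  define V where "V = measure lborel (unit_ball :: (complex^'n) set)"
  have V: "0 < V" "emeasure lborel (unit_ball :: (complex^'n) set) = ennreal V"
    unfolding V_def unit_ball_def by (auto intro: measure_lborel_ball_pos emeasure_lborel_ball_real)
  have c: "0 < c_const CARD('n) \<beta>" using \<beta> by (rule c_const_pos)
  show thesis
  proof (rule that)
    show "0 \<le> c_const CARD('n) \<beta> * M / V" using M V c by simp
    fix u :: "complex ^ 'n" assume u: "norm u < 1"
    let ?I = "\<integral>\<^sup>+z. ennreal ((1 - (norm z)\<^sup>2) powr (q * a + \<beta>) * norm (1 - herm z u) powr (- (q * c))) * indicator unit_ball z \<partial>lborel"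
    have "(\<integral>\<^sup>+z. ennreal (factor a (b - \<alpha>) c z u powr q) \<partial>vol_weighted \<beta>)
      = ennreal (c_const CARD('n) \<beta>) * (ennreal ((1 - (norm u)\<^sup>2) powr (q * (b - \<alpha>))) * ?I) / ennreal V"
      using c unfolding nn_integral_factor[OF u \<beta>] V by (simp add: ennreal_mult mult.assoc)
    also have "\<dots> \<le> ennreal (c_const CARD('n) \<beta>) * ennreal M / ennreal V"
      by (intro divide_right_mono_ennreal mult_left_mono M u) simp
    also have "\<dots> = ennreal (c_const CARD('n) \<beta> * M / V)"
      using M V c by (simp add: ennreal_mult[symmetric] divide_ennreal)
    finally show "(\<integral>\<^sup>+z. ennreal (factor a (b - \<alpha>) c z u powr q) \<partial>vol_weighted \<beta>) \<le> ennreal (c_const CARD('n) \<beta> * M / V)" .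
  qed
qed

section \<open>Size and measurability of the two kernels\<close>

lemma norm_S_kernel:
  "norm (S_kernel b c (z, w) (u, \<eta>)) = factor 0 (b $ 1) (c $ 1) z u * factor 0 (b $ 2) (c $ 2) w \<eta>"
  if "norm z < 1" "norm w < 1"
proof -
  \<comment> \<open>Because \<open>0 powr 0 = 0\<close>, this relies on \<open>z\<close> and
    \<open>w\<close> being interior points.\<close>
  have "(1 - (norm z)\<^sup>2) powr 0 = 1" "(1 - (norm w)\<^sup>2) powr 0 = 1"
    using one_minus_norm_sq(4)[OF that(1)] one_minus_norm_sq(4)[OF that(2)] by auto
  then show ?thesis
    by (simp add: S_kernel_def factor_def norm_mult norm_divide)
qed

text \<open>For real exponents the modulus of a principal power is the power of the modulus. The
  kernels of \<open>S\<close> and \<open>T\<close> thus have equal size, and sufficiency treats them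
  together.\<close>

lemma norm_T_kernel:
  "norm (T_kernel b c (z, w) (u, \<eta>)) = factor 0 (b $ 1) (c $ 1) z u * factor 0 (b $ 2) (c $ 2) w \<eta>"
  if "norm z < 1" "norm w < 1"
proof -
  have "(1 - (norm z)\<^sup>2) powr 0 = 1" "(1 - (norm w)\<^sup>2) powr 0 = 1"
    using one_minus_norm_sq(4)[OF that(1)] one_minus_norm_sq(4)[OF that(2)] by auto
  then show ?thesis
    by (simp add: T_kernel_def factor_def norm_mult norm_divide norm_powr_real_powr')
qed

lemma borel_measurable_S_kernel:
  "(\<lambda>(p, x). S_kernel b c p x) \<in> borel_measurable ((vol \<Otimes>\<^sub>M vol) \<Otimes>\<^sub>M (vol \<Otimes>\<^sub>M vol))"
  unfolding S_kernel_def case_prod_beta' by measurable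

text \<open>Principal powers are continuous in the right half-plane, which contains all arguments
  that occur; the value \<open>1\<close> elsewhere avoids the branch cut.\<close>

lemma borel_measurable_powr_halfplane:
  "(\<lambda>y. if 0 < Re y then y powr of_real c else 1) \<in> borel_measurable borel"
proof -
  have "(\<lambda>y. if y \<in> {y. 0 < Re y} then y powr of_real c else 1) \<in> borel_measurable borel"
  proof (rule borel_measurable_continuous_on_if)
    show "{y. 0 < Re y} \<in> sets borel"
      by (intro borel_open open_Collect_less continuous_intros)
    show "continuous_on {y. 0 < Re y} (\<lambda>y. y powr of_real c)"
      by (intro continuous_intros) (auto simp: complex_nonpos_Reals_iff)
  qed simp
  then show ?thesis by simp
qed

lemma borel_measurable_T_kernel:
  "(\<lambda>(p, x). T_kernel b c (p :: 'n::finite cpair) x) \<in> borel_measurable ((vol \<Otimes>\<^sub>M vol) \<Otimes>\<^sub>M (vol \<Otimes>\<^sub>M vol))"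
proof -
  let ?P = "(vol \<Otimes>\<^sub>M vol) :: 'n cpair measure"
  let ?h = "\<lambda>c y. if 0 < Re y then y powr of_real c else 1 :: complex"
  note [measurable] = measurable_compose[OF _ borel_measurable_powr_halfplane]
  have "(\<lambda>y. of_real ((1 - (norm (fst (snd y)))\<^sup>2) powr (b $ 1) * (1 - (norm (snd (snd y)))\<^sup>2) powr (b $ 2)) /
     (?h (c $ 1) (1 - herm (fst (fst y)) (fst (snd y))) * ?h (c $ 2) (1 - herm (snd (fst y)) (snd (snd y)))))
     \<in> borel_measurable (?P \<Otimes>\<^sub>M ?P)"
    by measurable
  also have "?this \<longleftrightarrow> ?thesis"
  proof (rule measurable_cong)
    fix y :: "'n cpair \<times> 'n cpair"
    assume "y \<in> space ((vol \<Otimes>\<^sub>M vol) \<Otimes>\<^sub>M (vol \<Otimes>\<^sub>M vol))"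
    then obtain z w u \<eta> where y: "y = ((z, w), (u, \<eta>))" "norm z < 1" "norm w < 1" "norm u < 1" "norm \<eta> < 1"
      by (cases y) (auto simp: space_pair_measure unit_ball_iff)
    show "of_real ((1 - (norm (fst (snd y)))\<^sup>2) powr (b $ 1) * (1 - (norm (snd (snd y)))\<^sup>2) powr (b $ 2)) /
     (?h (c $ 1) (1 - herm (fst (fst y)) (fst (snd y))) * ?h (c $ 2) (1 - herm (snd (fst y)) (snd (snd y))))
     = (case y of (p, x) \<Rightarrow> T_kernel b c p x)"
      using Re_1_minus_herm_pos[of z u] Re_1_minus_herm_pos[of w \<eta>] y
      by (simp add: T_kernel_def)
  qed
  finally show ?thesis .
qed

subsection \<open>Necessity of the exponent conditions\<close>

definition shell :: "real \<Rightarrow> (complex ^ 'n) set" where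
  "shell d = {z. 1 - d < norm z \<and> norm z < 1}"

lemma shell_borel [measurable]: "(shell d :: (complex ^ 'n) set) \<in> sets borel"
proof -
  have "open (shell d :: (complex ^ 'n) set)"
    unfolding shell_def Collect_conj_eq by (intro open_Int open_Collect_less continuous_intros)
  then show ?thesis by simp
qed

text \<open>The shells decrease to the empty set, so the measure with density \<open>f\<close>,
  finite on the ball, is continuous from above along them. A lower bound on thin shells that does
  not decay thereby contradicts integrability.\<close>

lemma shell_integral_small:
  fixes f :: "complex ^ 'n \<Rightarrow> ennreal"
  assumes [measurable]: "f \<in> borel_measurable borel"
    and fin: "(\<integral>\<^sup>+z. f z * indicator unit_ball z \<partial>lborel) < \<infinity>" and e: "0 < e"
  obtains d where "0 < d" "\<And>r. r \<le> d \<Longrightarrow> (\<integral>\<^sup>+z. f z * indicator (shell r) z \<partial>lborel) < e"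
proof -
  define A where "A = (\<lambda>m. shell (1 / real (Suc m)) :: (complex ^ 'n) set)"
  have em: "emeasure (density lborel f) S = (\<integral>\<^sup>+z. f z * indicator S z \<partial>lborel)" if "S \<in> sets borel" for S
    using that by (simp add: emeasure_density)
  have sub: "A m \<subseteq> unit_ball" for m by (auto simp: A_def shell_def unit_ball_iff)
  have "(\<lambda>m. emeasure (density lborel f) (A m)) \<longlonglongrightarrow> emeasure (density lborel f) (\<Inter>m. A m)"
  proof (rule Lim_emeasure_decseq)
    show "range A \<subseteq> sets (density lborel f)" by (auto simp: A_def)
    show "decseq A"
      unfolding decseq_def A_def shell_def
      by (auto intro: less_le_trans le_less_trans divide_left_mono)
        (smt (verit) frac_le of_nat_0_le_iff of_nat_mono)
    show "emeasure (density lborel f) (A m) \<noteq> \<infinity>" for m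
    proof -
      have "emeasure (density lborel f) (A m) \<le> emeasure (density lborel f) unit_ball"
        by (intro emeasure_mono sub) simp
      then show ?thesis using fin em[of unit_ball] by (auto simp: top_unique)
    qed
  qed
  also have "(\<Inter>m. A m) = {}"
  proof -
    have False if "\<And>m. z \<in> A m" for z
    proof -
      have z: "norm z < 1" using that[of 0] by (simp add: A_def shell_def)
      then obtain m where "1 / real (Suc m) < 1 - norm z"
        using reals_Archimedean[of "1 - norm z"] by (auto simp: inverse_eq_divide)
      then show False using that[of m] by (simp add: A_def shell_def)
    qed
    then show ?thesis by blast
  qed
  finally have "(\<lambda>m. emeasure (density lborel f) (A m)) \<longlonglongrightarrow> 0" by simp
  then have "eventually (\<lambda>m. emeasure (density lborel f) (A m) < e) sequentially"
    by (rule order_tendstoD(2)) (rule e)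
  then obtain m where m: "emeasure (density lborel f) (A m) < e"
    by (auto simp: eventually_sequentially)
  show thesis
  proof (rule that[of "1 / real (Suc m)"])
    fix r :: real assume "r \<le> 1 / real (Suc m)"
    then have "(\<integral>\<^sup>+z. f z * indicator (shell r) z \<partial>lborel) \<le> (\<integral>\<^sup>+z. f z * indicator (A m) z \<partial>lborel)"
      by (intro nn_integral_mono mult_left_mono) (auto simp: A_def shell_def indicator_def)
    then show "(\<integral>\<^sup>+z. f z * indicator (shell r) z \<partial>lborel) < e"
      using m em[of "A m"] by (simp add: A_def)
  qed simp
qed

text \<open>By scaling, the ball of radius \<open>1 - d\<close> takes at most the fraction
  \<open>1 - d\<close> of the volume, which leaves at least \<open>d\<close> for the shell.\<close>

lemma emeasure_shell_ge:
  assumes d: "0 < d" "d < 1"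
  shows "ennreal (d * measure lborel (ball (0::complex^'n) 1)) \<le> emeasure lborel (shell d :: (complex ^ 'n) set)"
proof -
  let ?V = "measure lborel (ball (0::complex^'n) 1)" and ?N = "DIM(complex^'n)"
  define r where "r = 1 - d"
  have r: "0 < r" "r < 1" using d by (auto simp: r_def)
  have "emeasure lborel (cball (0::complex^'n) r) = (\<integral>\<^sup>+z. indicator (cball 0 r) z \<partial>(lborel :: (complex^'n) measure))"
    by (simp add: nn_integral_indicator)
  also have "\<dots> = ennreal (\<bar>r\<bar> ^ ?N) * (\<integral>\<^sup>+z. indicator (cball 0 r) (0 + r *\<^sub>R z) \<partial>(lborel :: (complex^'n) measure))"
    by (rule nn_integral_lborel_affine) (use r in \<open>auto intro!: borel_measurable_indicator\<close>)
  also have "(\<integral>\<^sup>+z. indicator (cball 0 r) (0 + r *\<^sub>R z) \<partial>(lborel :: (complex^'n) measure))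
      = (\<integral>\<^sup>+z. indicator (cball 0 1) z \<partial>(lborel :: (complex^'n) measure))"
    using r by (intro nn_integral_cong) (simp add: indicator_def)
  also have "\<dots> = emeasure lborel (cball (0::complex^'n) 1)"
    by (simp add: nn_integral_indicator)
  also have "\<dots> = ennreal ?V"
    using emeasure_lborel_cball_finite[of "0::complex^'n" 1]
    by (simp add: emeasure_eq_ennreal_measure content_cball_conv_ball measure_completion)
  also have "ennreal (\<bar>r\<bar> ^ ?N) * ennreal ?V \<le> ennreal (r * ?V)"
  proof -
    have "r ^ ?N \<le> r ^ 1"
      using r by (intro power_decreasing) (auto simp: Suc_leI)
    then show ?thesis using r by (simp add: ennreal_mult[symmetric] ennreal_leI mult_right_mono)
  qed
  finally have cb: "emeasure lborel (cball (0::complex^'n) r) \<le> ennreal (r * ?V)" .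
  have "ennreal ?V = emeasure lborel (ball (0::complex^'n) 1)"
    by (simp add: emeasure_lborel_ball_real)
  also have "\<dots> \<le> emeasure lborel (shell d \<union> cball (0::complex^'n) r)"
    by (intro emeasure_mono) (auto simp: shell_def r_def)
  also have "\<dots> \<le> emeasure lborel (shell d :: (complex ^ 'n) set) + emeasure lborel (cball (0::complex^'n) r)"
    by (rule emeasure_subadditive) auto
  also have "\<dots> \<le> emeasure lborel (shell d :: (complex ^ 'n) set) + ennreal (r * ?V)"
    by (intro add_left_mono cb)
  finally have le: "ennreal ?V \<le> emeasure lborel (shell d :: (complex ^ 'n) set) + ennreal (r * ?V)" .
  show ?thesis
  proof (cases "emeasure lborel (shell d :: (complex ^ 'n) set)")
    case (real x)
    then have "?V \<le> x + r * ?V"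
      using le r by (simp add: ennreal_plus[symmetric] del: ennreal_plus)
    then show ?thesis using real by (auto simp: r_def algebra_simps intro!: ennreal_leI)
  qed simp
qed

text \<open>On a box with half-width \<open>r\<close> about \<open>1 - 3 * r\<close> in direction
  \<open>j\<close> and of order \<open>sqrt r\<close> in the others,
  \<open>1 - (norm z)\<^sup>2\<close> and \<open>norm (1 - herm z u)\<close> both lie between
  \<open>r\<close> and \<open>8 * r\<close>. The box has volume of order
  \<open>r powr (n + 1)\<close> and lies in the shell of width \<open>5 * r\<close>. The value
  \<open>x = 1\<close> is allowed for the boundary case.\<close>

lemma box_integral_ge:
  fixes j :: "'n::finite" and t g :: real
  obtains k where "0 < k"
    "\<And>r x. 0 < r \<Longrightarrow> r \<le> 1/4 \<Longrightarrow> 1 - r \<le> x \<Longrightarrow> x \<le> 1 \<Longrightarrow>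
      ennreal (k * r powr (real CARD('n) + 1 + t - g)) \<le>
      (\<integral>\<^sup>+z. ennreal ((1 - (norm z)\<^sup>2) powr t * norm (1 - herm z (axis j (of_real x))) powr (- g)) * indicator (shell (5 * r)) z \<partial>lborel)"
proof -
  let ?n = "real CARD('n)"
  have n: "0 < ?n" by simp
  define k0 where "k0 = 8 powr (- \<bar>t\<bar>) * 8 powr (- \<bar>g\<bar>)"
  define k where "k = k0 * (4 * (1 / ?n) ^ (CARD('n) - 1))"
  have k0: "0 < k0" by (simp add: k0_def)
  show thesis
  proof (rule that)
    show "0 < k" using k0 by (simp add: k_def)
    fix r x :: real assume r: "0 < r" "r \<le> 1/4" and x: "1 - r \<le> x" "x \<le> 1"
    \<comment> \<open>The constant under the root lets the coordinates other than \<open>j\<close>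
      add at most \<open>r / 2\<close> to \<open>(norm z)\<^sup>2\<close>, so the box stays at
      distance of order \<open>r\<close> from the sphere.\<close>
    define h where "h = (\<lambda>k. if k = j then r else sqrt (r / (4 * ?n)))"
    define a :: "complex ^ 'n" where "a = axis j (of_real (1 - 3 * r))"
    define Q where "Q = {y. \<forall>k. \<bar>Re (y $ k - a $ k)\<bar> \<le> h k \<and> \<bar>Im (y $ k - a $ k)\<bar> \<le> h k}"
    have h0: "0 \<le> h k" for k using r by (simp add: h_def)
    have Q: "Q \<in> sets borel" "emeasure lborel Q = ennreal (\<Prod>k\<in>UNIV. (2 * h k)\<^sup>2)"
      unfolding Q_def using emeasure_lborel_polybox[of h a] h0 by auto
    have vol: "(\<Prod>k\<in>UNIV. (2 * h k)\<^sup>2) = (4 * (1 / ?n) ^ (CARD('n) - 1)) * r powr (?n + 1)"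
    proof -
      have "(\<Prod>k\<in>UNIV. (2 * h k)\<^sup>2) = (2 * r)\<^sup>2 * (\<Prod>k\<in>UNIV - {j}. (2 * h k)\<^sup>2)"
        by (simp add: prod.remove[of UNIV j] h_def)
      also have "(\<Prod>k\<in>UNIV - {j}. (2 * h k)\<^sup>2) = (\<Prod>k\<in>UNIV - {j}. r / ?n)"
        using r by (intro prod.cong) (auto simp: h_def power_mult_distrib)
      also have "\<dots> = (r / ?n) ^ (CARD('n) - 1)" by simp
      also have "(2 * r)\<^sup>2 * (r / ?n) ^ (CARD('n) - 1) = (4 * (1 / ?n) ^ (CARD('n) - 1)) * (r ^ 2 * r ^ (CARD('n) - 1))"
        by (simp add: power_mult_distrib power_divide)
      also have "r ^ 2 * r ^ (CARD('n) - 1) = r ^ (CARD('n) + 1)"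
        using zero_less_card_finite[where 'a='n] by (simp flip: power_add)
      also have "\<dots> = r powr (?n + 1)"
        using r powr_realpow[of r "CARD('n) + 1"] by (simp add: add.commute)
      finally show ?thesis .
    qed
    have ptw: "z \<in> shell (5 * r) \<and>
        k0 * r powr (t - g) \<le> (1 - (norm z)\<^sup>2) powr t * norm (1 - herm z (axis j (of_real x))) powr (- g)"
      if zQ: "z \<in> Q" for z
    proof -
      have zj: "\<bar>Re (z $ j) - (1 - 3 * r)\<bar> \<le> r" "\<bar>Im (z $ j)\<bar> \<le> r"
        using zQ by (auto simp: Q_def a_def h_def split: if_splits dest!: spec[of _ j])
      have zk: "\<bar>Re (z $ k)\<bar> \<le> sqrt (r / (4 * ?n))" "\<bar>Im (z $ k)\<bar> \<le> sqrt (r / (4 * ?n))" if "k \<noteq> j" for k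
        using zQ that by (auto simp: Q_def a_def h_def axis_def dest!: spec[of _ k])
      have Rez: "1 - 4 * r \<le> Re (z $ j)" "Re (z $ j) \<le> 1 - 2 * r" "0 \<le> Re (z $ j)"
        using zj r by auto
      have "(norm z)\<^sup>2 = (\<Sum>k\<in>UNIV. (norm (z $ k))\<^sup>2)"
        by (simp add: norm_vec_def L2_set_def sum_nonneg)
      also have "\<dots> = (norm (z $ j))\<^sup>2 + (\<Sum>k\<in>UNIV - {j}. (norm (z $ k))\<^sup>2)"
        by (simp add: sum.remove[of UNIV j])
      also have "(norm (z $ j))\<^sup>2 \<le> (1 - 2 * r)\<^sup>2 + r\<^sup>2"
        unfolding cmod_power2
        using power_mono[OF Rez(2,3), of 2] power_mono[OF zj(2), of 2] by simp
      also have "(\<Sum>k\<in>UNIV - {j}. (norm (z $ k))\<^sup>2) \<le> (\<Sum>k\<in>UNIV - {j}. r / (2 * ?n))"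
      proof (rule sum_mono)
        fix k assume "k \<in> UNIV - {j}"
        then have k: "k \<noteq> j" by simp
        have "\<bar>Re (z $ k)\<bar>\<^sup>2 \<le> (sqrt (r / (4 * ?n)))\<^sup>2"
          by (rule power_mono[OF zk(1)[OF k]]) simp
        moreover have "\<bar>Im (z $ k)\<bar>\<^sup>2 \<le> (sqrt (r / (4 * ?n)))\<^sup>2"
          by (rule power_mono[OF zk(2)[OF k]]) simp
        ultimately show "(norm (z $ k))\<^sup>2 \<le> r / (2 * ?n)"
          using r by (simp add: cmod_power2)
      qed
      also have "(\<Sum>k\<in>UNIV - {j}. r / (2 * ?n)) \<le> (\<Sum>k\<in>(UNIV :: 'n set). r / (2 * ?n))"
        using r by (intro sum_mono2) auto
      also have "\<dots> = r / 2" by simp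
      finally have "(norm z)\<^sup>2 \<le> (1 - 2 * r)\<^sup>2 + r\<^sup>2 + r / 2" by simp
      also have "\<dots> = 1 - r - r * (5 / 2 - 5 * r)" by (simp add: power2_eq_square algebra_simps)
      also have "\<dots> \<le> 1 - r" using r by simp
      finally have up: "r \<le> 1 - (norm z)\<^sup>2" by simp
      then have "(norm z)\<^sup>2 < 1" using r by simp
      then have z1: "norm z < 1" by (simp add: power_less_one_iff)
      have "Re (z $ j) \<le> norm z"
        using complex_Re_le_cmod[of "z $ j"] Finite_Cartesian_Product.norm_nth_le[of z j] by simp
      then have z2: "1 - 4 * r \<le> norm z" using Rez by simp
      have low: "1 - (norm z)\<^sup>2 \<le> 8 * r"
        using one_minus_norm_sq(3)[OF z1] z2 by simp
      have herm: "herm z (axis j (of_real x)) = of_real x * z $ j"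
        unfolding herm_def axis_def by (simp add: if_distrib if_distribR sum.delta cong: if_cong)
      let ?y = "1 - herm z (axis j (of_real x))"
      have "x * Re (z $ j) \<le> 1 * Re (z $ j)" using x Rez by (intro mult_right_mono) auto
      then have y1: "r \<le> norm ?y"
        using complex_Re_le_cmod[of ?y] Rez r unfolding herm by simp
      have "Re ?y \<le> 5 * r"
      proof -
        have "(1 - r) * (1 - 4 * r) \<le> x * Re (z $ j)" using x Rez r by (intro mult_mono) auto
        moreover have "1 - 5 * r \<le> (1 - r) * (1 - 4 * r)" by (simp add: algebra_simps)
        ultimately show ?thesis unfolding herm by simp
      qed
      moreover have "0 \<le> Re ?y" using \<open>x * Re (z $ j) \<le> 1 * Re (z $ j)\<close> Rez r unfolding herm by simp
      moreover have "\<bar>Im ?y\<bar> \<le> r"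
      proof -
        have "\<bar>x\<bar> * \<bar>Im (z $ j)\<bar> \<le> 1 * r" using zj(2) x r by (intro mult_mono) auto
        then show ?thesis unfolding herm by (simp add: abs_mult)
      qed
      ultimately have y2: "norm ?y \<le> 8 * r"
        using cmod_le[of ?y] r by linarith
      have 1: "8 powr (- \<bar>t\<bar>) * r powr t \<le> (1 - (norm z)\<^sup>2) powr t"
        using up low r by (intro powr_comparable_lower) auto
      have "8 powr (- \<bar>- g\<bar>) * r powr (- g) \<le> norm ?y powr (- g)"
        using y1 y2 r by (intro powr_comparable_lower) auto
      then have 2: "8 powr (- \<bar>g\<bar>) * r powr (- g) \<le> norm ?y powr (- g)"
        by simp
      have "k0 * r powr (t - g) = (8 powr (- \<bar>t\<bar>) * r powr t) * (8 powr (- \<bar>g\<bar>) * r powr (- g))"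
        using powr_add[of r t "- g"] by (simp add: k0_def)
      also have "\<dots> \<le> (1 - (norm z)\<^sup>2) powr t * norm ?y powr (- g)"
        using 1 2 by (intro mult_mono) auto
      finally show ?thesis using z1 z2 r by (simp add: shell_def)
    qed
    have "ennreal (k * r powr (?n + 1 + t - g)) = ennreal (k0 * r powr (t - g)) * emeasure lborel Q"
    proof -
      have "r powr (?n + 1 + t - g) = r powr (t - g) * r powr (?n + 1)"
        by (simp add: powr_add[symmetric] algebra_simps)
      then show ?thesis
        unfolding Q vol k_def using k0 by (simp add: ennreal_mult[symmetric] mult_ac)
    qed
    also have "\<dots> = (\<integral>\<^sup>+z. ennreal (k0 * r powr (t - g)) * indicator Q z \<partial>lborel)"
      using Q(1) by (intro nn_integral_cmult_indicator[symmetric]) simp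
    also have "\<dots> \<le> (\<integral>\<^sup>+z. ennreal ((1 - (norm z)\<^sup>2) powr t * norm (1 - herm z (axis j (of_real x))) powr (- g)) * indicator (shell (5 * r)) z \<partial>lborel)"
      using ptw by (intro nn_integral_mono) (auto simp: indicator_def intro!: ennreal_leI)
    finally show "ennreal (k * r powr (?n + 1 + t - g)) \<le>
      (\<integral>\<^sup>+z. ennreal ((1 - (norm z)\<^sup>2) powr t * norm (1 - herm z (axis j (of_real x))) powr (- g)) * indicator (shell (5 * r)) z \<partial>lborel)" .
  qed
qed

lemma exponent_nonpos_of_lower_bound:
  fixes k C s r0 :: real
  assumes "0 < k" "0 < r0" and le: "\<And>r. 0 < r \<Longrightarrow> r \<le> r0 \<Longrightarrow> k \<le> C * r powr s"
  shows "s \<le> 0"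
proof (rule ccontr)
  assume "\<not> s \<le> 0"
  then have "((\<lambda>r. C * r powr s) \<longlongrightarrow> C * 0 powr s) (at_right 0)"
    by (intro tendsto_intros) (auto simp: eventually_at_right_less intro: tendsto_ident_at eventually_at_right_less[THEN eventually_mono])
  then have "eventually (\<lambda>r. C * r powr s < k) (at_right 0)"
    using assms(1) by (intro order_tendstoD(2)) auto
  moreover have "eventually (\<lambda>r. r \<in> {0<..<r0}) (at_right 0)"
    using assms(2) by (rule eventually_at_right_real)
  ultimately have "eventually (\<lambda>r::real. False) (at_right 0)"
    by eventually_elim (use le in force)
  then show False by simp
qed

lemma norm_axis: "norm (axis j c :: complex ^ 'n) = norm c"
proof -
  have "(\<Sum>i\<in>UNIV. (norm ((axis j c :: complex ^ 'n) $ i))\<^sup>2) = (\<Sum>i\<in>UNIV. if i = j then (norm c)\<^sup>2 else 0)"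
    by (intro sum.cong) (auto simp: axis_def)
  then show ?thesis by (simp add: norm_vec_def L2_set_def)
qed

text \<open>Fatou's lemma along interior points of the axis that tend to \<open>axis j 1\<close>;
  for each \<open>z\<close> in the open ball the kernel is continuous there.\<close>

lemma nn_integral_kernel_axis_le:
  fixes j :: "'n::finite" and t g C :: real
  assumes J: "\<And>u::complex^'n. norm u < 1 \<Longrightarrow>
    (\<integral>\<^sup>+z. ennreal ((1 - (norm z)\<^sup>2) powr t * norm (1 - herm z u) powr (- g)) * indicator unit_ball z \<partial>lborel) \<le> ennreal C"
  shows "(\<integral>\<^sup>+z. ennreal ((1 - (norm z)\<^sup>2) powr t * norm (1 - herm z (axis j 1)) powr (- g)) * indicator unit_ball z \<partial>lborel) \<le> ennreal C"
proof -
  define x where "x = (\<lambda>m. 1 - 1 / real (Suc (Suc m)))"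
  define f where "f = (\<lambda>u z :: complex^'n. ennreal ((1 - (norm z)\<^sup>2) powr t * norm (1 - herm z u) powr (- g)) * indicator unit_ball z)"
  define u :: "nat \<Rightarrow> complex ^ 'n" where "u = (\<lambda>m. x m *\<^sub>R axis j 1)"
  have x: "0 \<le> x m" "x m < 1" for m by (auto simp: x_def)
  have nu: "norm (u m) < 1" for m
    using x[of m] by (simp add: u_def)
  have "(\<lambda>m. 1 / real (Suc m)) \<longlonglongrightarrow> 0"
    using LIMSEQ_inverse_real_of_nat by (simp add: inverse_eq_divide)
  then have "(\<lambda>m. 1 / real (Suc (Suc m))) \<longlonglongrightarrow> 0"
    by (rule LIMSEQ_Suc)
  then have "x \<longlonglongrightarrow> 1 - 0"
    unfolding x_def by (intro tendsto_diff tendsto_const)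
  then have ulim: "u \<longlonglongrightarrow> 1 *\<^sub>R axis j 1"
    unfolding u_def by (intro tendsto_scaleR tendsto_const) simp
  have lim: "(\<lambda>m. f (u m) z) \<longlonglongrightarrow> f (axis j 1) z" for z
  proof (cases "norm z < 1")
    case True
    have "(\<lambda>m. herm z (u m)) \<longlonglongrightarrow> herm z (axis j 1)"
    proof -
      have "continuous_on UNIV (\<lambda>v. herm z v)" by (intro continuous_intros)
      then show ?thesis
        using ulim continuous_on_tendsto_compose[of UNIV "\<lambda>v. herm z v" u "axis j 1" sequentially] by simp
    qed
    moreover have "norm (1 - herm z (axis j 1)) \<noteq> 0"
      using Re_1_minus_herm_pos[of z "axis j 1"] True by auto
    ultimately show ?thesis
      unfolding f_def using True
      by (auto simp: unit_ball_iff intro!: tendsto_intros tendsto_ennrealI)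
  qed (simp add: f_def unit_ball_iff)
  have "(\<integral>\<^sup>+z. f (axis j 1) z \<partial>lborel) = (\<integral>\<^sup>+z. liminf (\<lambda>m. f (u m) z) \<partial>lborel)"
    by (intro nn_integral_cong lim_imp_Liminf[symmetric] trivial_limit_sequentially lim)
  also have "\<dots> \<le> liminf (\<lambda>m. \<integral>\<^sup>+z. f (u m) z \<partial>lborel)"
    by (rule nn_integral_liminf) (simp add: f_def)
  also have "\<dots> \<le> liminf (\<lambda>m::nat. ennreal C)"
    using J[OF nu] by (intro Liminf_mono always_eventually) (simp add: f_def)
  also have "\<dots> = ennreal C" by (rule Liminf_const) simp
  finally show ?thesis by (simp add: f_def)
qed

text \<open>Each conclusion is tested on its own region: thin shells, a fixed small ball, boxes near
  an interior point, and boxes near a boundary point.\<close>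

lemma exponent_conditions_of_integral_le:
  fixes t g e C :: real
  assumes J: "\<And>u::complex^'n. norm u < 1 \<Longrightarrow>
    (\<integral>\<^sup>+z. ennreal ((1 - (norm z)\<^sup>2) powr t * norm (1 - herm z u) powr (- g)) * indicator unit_ball z \<partial>lborel)
      \<le> ennreal (C * (1 - (norm u)\<^sup>2) powr (- e))" and C: "0 \<le> C"
  shows "-1 < t" "0 \<le> e" "g \<le> real CARD('n) + 1 + t + e" "e = 0 \<Longrightarrow> g < real CARD('n) + 1 + t"
proof -
  define f where "f = (\<lambda>u z :: complex^'n. ennreal ((1 - (norm z)\<^sup>2) powr t * norm (1 - herm z u) powr (- g)))"
  have [measurable]: "f u \<in> borel_measurable borel" for u unfolding f_def by measurable
  have J': "(\<integral>\<^sup>+z. f u z * indicator unit_ball z \<partial>lborel) \<le> ennreal (C * (1 - (norm u)\<^sup>2) powr (- e))"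
    if "norm u < 1" for u
    unfolding f_def using that by (rule J)
  let ?V = "measure lborel (ball (0::complex^'n) 1)"
  have V: "0 < ?V" by (rule measure_lborel_ball_pos) simp
  have axis_norm: "norm (axis j (of_real x) :: complex ^ 'n) = \<bar>x\<bar>" for j :: 'n and x
    by (simp add: norm_axis)
  \<comment> \<open>At \<open>u = 0\<close> only the weight is left. For \<open>t \<le> -1\<close>
    its integral over a shell of width \<open>r < 1\<close> is at least
    \<open>2 powr t * ?V\<close>, however small \<open>r\<close> is.\<close>
  show "-1 < t"
  proof (rule ccontr)
    assume "\<not> -1 < t"
    then have t: "t \<le> -1" by simp
    have "(\<integral>\<^sup>+z. f 0 z * indicator unit_ball z \<partial>lborel) < \<infinity>"
      by (rule le_less_trans[OF J']) auto
    then obtain d where d: "0 < d" "\<And>r. r \<le> d \<Longrightarrow> (\<integral>\<^sup>+z. f 0 z * indicator (shell r) z \<partial>lborel) < ennreal (2 powr t * ?V)"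
      using V by (elim shell_integral_small[rotated, where e="ennreal (2 powr t * ?V)"]) auto
    define r where "r = min d (1/2)"
    have r: "0 < r" "r \<le> d" "r < 1" using d(1) by (auto simp: r_def)
    have "ennreal (2 powr t * ?V) \<le> ennreal ((2 * r) powr t) * ennreal (r * ?V)"
    proof -
      have "1 \<le> r powr (t + 1)"
        using r t powr_mono2'[of "t + 1" r 1] by simp
      then have "2 powr t * ?V * 1 \<le> 2 powr t * ?V * r powr (t + 1)"
        using V by (intro mult_left_mono) auto
      also have "\<dots> = (2 * r) powr t * (r * ?V)"
        using r by (simp add: powr_mult powr_add)
      finally show ?thesis by (simp add: ennreal_mult[symmetric] ennreal_leI r less_imp_le)
    qed
    also have "\<dots> \<le> ennreal ((2 * r) powr t) * emeasure lborel (shell r :: (complex ^ 'n) set)"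
      using r by (intro mult_left_mono emeasure_shell_ge) auto
    also have "\<dots> = (\<integral>\<^sup>+z. ennreal ((2 * r) powr t) * indicator (shell r) z \<partial>(lborel :: (complex^'n) measure))"
      by (rule nn_integral_cmult_indicator[symmetric]) simp
    also have "\<dots> \<le> (\<integral>\<^sup>+z. f 0 z * indicator (shell r) z \<partial>lborel)"
    proof (rule nn_integral_mono)
      fix z :: "complex ^ 'n"
      show "ennreal ((2 * r) powr t) * indicator (shell r) z \<le> f 0 z * indicator (shell r) z"
      proof (cases "z \<in> shell r")
        case True
        then have z: "norm z < 1" "1 - norm z < r" by (auto simp: shell_def)
        then have "(2 * r) powr t \<le> (1 - (norm z)\<^sup>2) powr t"
          using one_minus_norm_sq[OF z(1)] t by (intro powr_mono2') auto
        then show ?thesis using True by (simp add: f_def herm_def ennreal_leI)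
      qed simp
    qed
    also have "\<dots> < ennreal (2 powr t * ?V)" by (rule d(2)) (rule r)
    finally show False by simp
  qed
  define j :: 'n where "j = undefined"
  \<comment> \<open>On \<open>norm z < 1/2\<close> the integrand exceeds a constant for all
    \<open>u\<close>, so the right-hand side cannot tend to \<open>0\<close> when \<open>u\<close>
    approaches the sphere.\<close>
  show e: "0 \<le> e"
  proof -
    define k0 where "k0 = 2 powr (- \<bar>t\<bar>) * 2 powr (- \<bar>g\<bar>)"
    define W where "W = measure lborel (ball (0::complex^'n) (1/2))"
    have W: "0 < W" unfolding W_def by (rule measure_lborel_ball_pos) simp
    have k0: "0 < k0" by (simp add: k0_def)
    have low: "ennreal (k0 * W) \<le> (\<integral>\<^sup>+z. f u z * indicator unit_ball z \<partial>lborel)" if u: "norm u < 1" for u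
    proof -
      have "ennreal (k0 * W) = ennreal k0 * emeasure lborel (ball (0::complex^'n) (1/2))"
        unfolding emeasure_lborel_ball_real W_def[symmetric] using k0 W by (simp add: ennreal_mult)
      also have "\<dots> = (\<integral>\<^sup>+z. ennreal k0 * indicator (ball 0 (1/2)) z \<partial>(lborel :: (complex^'n) measure))"
        by (rule nn_integral_cmult_indicator[symmetric]) simp
      also have "\<dots> \<le> (\<integral>\<^sup>+z. f u z * indicator unit_ball z \<partial>lborel)"
      proof (rule nn_integral_mono)
        fix z :: "complex ^ 'n"
        show "ennreal k0 * indicator (ball 0 (1/2)) z \<le> f u z * indicator unit_ball z"
        proof (cases "norm z < 1/2")
          case True
          let ?y = "norm (1 - herm z u)"
          have y: "1/2 \<le> ?y" "?y \<le> 2"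
            using norm_1_minus_herm_ge(1)[of z u] norm_1_minus_herm_le[of z u] True u by auto
          have w: "1/2 \<le> 1 - (norm z)\<^sup>2" "1 - (norm z)\<^sup>2 \<le> 1"
            using one_minus_norm_sq[of z] True by auto
          have "2 powr (- \<bar>t\<bar>) * 1 powr t \<le> (1 - (norm z)\<^sup>2) powr t"
          proof (rule powr_comparable_lower)
            show "1 \<le> 2 * (1 - (norm z)\<^sup>2)" using w by simp
            show "1 - (norm z)\<^sup>2 \<le> 2 * 1" using w by linarith
          qed auto
          moreover have "2 powr (- \<bar>- g\<bar>) * 1 powr (- g) \<le> ?y powr (- g)"
            using y by (intro powr_comparable_lower) auto
          ultimately have "2 powr (- \<bar>t\<bar>) \<le> (1 - (norm z)\<^sup>2) powr t" "2 powr (- \<bar>g\<bar>) \<le> ?y powr (- g)"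
            by simp_all
          then have "k0 \<le> (1 - (norm z)\<^sup>2) powr t * ?y powr (- g)"
            unfolding k0_def by (intro mult_mono) auto
          then show ?thesis using True by (simp add: unit_ball_iff f_def ennreal_leI)
        qed simp
      qed
      finally show ?thesis .
    qed
    have "- e \<le> 0"
    proof (rule exponent_nonpos_of_lower_bound)
      show "0 < k0 * W" "0 < (1/2 :: real)" using k0 W by auto
      fix r :: real assume r: "0 < r" "r \<le> 1/2"
      \<comment> \<open>The square root makes \<open>1 - (norm u)\<^sup>2\<close> exactly
        \<open>r\<close>.\<close>
      define u :: "complex ^ 'n" where "u = axis j (of_real (sqrt (1 - r)))"
      have sq: "(norm u)\<^sup>2 = 1 - r" using r by (simp add: u_def norm_axis)
      have "norm u < 1" using r by (simp add: u_def norm_axis)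
      then have "ennreal (k0 * W) \<le> ennreal (C * (1 - (norm u)\<^sup>2) powr (- e))"
        using low J' by (blast intro: order_trans)
      then have "ennreal (k0 * W) \<le> ennreal (C * r powr (- e))"
        by (simp add: sq)
      then show "k0 * W \<le> C * r powr (- e)"
        using C by (subst (asm) ennreal_le_iff) auto
    qed
    then show ?thesis by simp
  qed
  obtain k where k: "0 < k" "\<And>r x. 0 < r \<Longrightarrow> r \<le> 1/4 \<Longrightarrow> 1 - r \<le> x \<Longrightarrow> x \<le> 1 \<Longrightarrow>
      ennreal (k * r powr (real CARD('n) + 1 + t - g)) \<le>
      (\<integral>\<^sup>+z. f (axis j (of_real x)) z * indicator (shell (5 * r)) z \<partial>lborel)"
    unfolding f_def by (rule box_integral_ge[of t g j]) blast
  let ?p = "real CARD('n) + 1 + t - g"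
  \<comment> \<open>At distance \<open>r\<close> from the sphere the box gives a multiple of
    \<open>r powr ?p\<close> below and the hypothesis a multiple of \<open>r powr (- e)\<close>
    above; then \<open>r\<close> tends to \<open>0\<close>.\<close>
  show "g \<le> real CARD('n) + 1 + t + e"
  proof -
    have "- e - ?p \<le> 0"
    proof (rule exponent_nonpos_of_lower_bound)
      show "0 < k" "0 < (1/4 :: real)" using k by auto
      fix r :: real assume r: "0 < r" "r \<le> 1/4"
      let ?u = "axis j (of_real (1 - r)) :: complex ^ 'n"
      have u: "norm ?u < 1" "norm ?u = 1 - r" using r unfolding axis_norm by auto
      have "ennreal (k * r powr ?p) \<le> (\<integral>\<^sup>+z. f ?u z * indicator (shell (5 * r)) z \<partial>lborel)"
        using r by (intro k) auto
      also have "\<dots> \<le> (\<integral>\<^sup>+z. f ?u z * indicator unit_ball z \<partial>lborel)"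
        by (intro nn_integral_mono mult_left_mono) (auto simp: indicator_def shell_def unit_ball_iff)
      also have "\<dots> \<le> ennreal (C * (1 - (norm ?u)\<^sup>2) powr (- e))"
        by (intro J' u)
      also have "\<dots> \<le> ennreal (C * (2 powr \<bar>- e\<bar> * r powr (- e)))"
        using one_minus_norm_sq[OF u(1)] C r unfolding u(2)
        by (intro ennreal_leI mult_left_mono powr_comparable) auto
      finally have "k * r powr ?p \<le> C * (2 powr \<bar>- e\<bar> * r powr (- e))"
        using C by (subst (asm) ennreal_le_iff) auto
      then have "k * r powr ?p * r powr (- ?p) \<le> C * (2 powr \<bar>- e\<bar> * r powr (- e)) * r powr (- ?p)"
        by (intro mult_right_mono) auto
      also have "k * r powr ?p * r powr (- ?p) = k"
        using r by (simp add: mult.assoc flip: powr_add)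
      also have "C * (2 powr \<bar>- e\<bar> * r powr (- e)) * r powr (- ?p) = C * 2 powr \<bar>- e\<bar> * r powr (- e - ?p)"
      proof -
        have "r powr (- e - ?p) = r powr (- e) * r powr (- ?p)"
          unfolding powr_add[symmetric] by (simp add: algebra_simps)
        then show ?thesis by (simp only: mult.assoc)
      qed
      finally show "k \<le> C * 2 powr \<bar>- e\<bar> * r powr (- e - ?p)" .
    qed
    then show ?thesis by simp
  qed
  \<comment> \<open>For \<open>e = 0\<close> the bound is uniform in \<open>u\<close> and passes to
    \<open>axis j 1\<close>. If \<open>?p \<le> 0\<close>, each thin shell carries at least
    \<open>k\<close> of that integral, which is impossible for a finite one.\<close>
  show "g < real CARD('n) + 1 + t" if "e = 0"
  proof (rule ccontr)
    assume "\<not> g < real CARD('n) + 1 + t"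
    then have p: "?p \<le> 0" by simp
    have "(\<integral>\<^sup>+z. f u z * indicator unit_ball z \<partial>lborel) \<le> ennreal C" if "norm u < 1" for u
      using J'[OF that] \<open>e = 0\<close> one_minus_norm_sq(4)[OF that] by simp
    then have "(\<integral>\<^sup>+z. f (axis j 1) z * indicator unit_ball z \<partial>lborel) \<le> ennreal C"
      unfolding f_def by (rule nn_integral_kernel_axis_le)
    then have "(\<integral>\<^sup>+z. f (axis j 1) z * indicator unit_ball z \<partial>lborel) < \<infinity>"
      by (rule le_less_trans) simp
    then obtain d where d: "0 < d" "\<And>r. r \<le> d \<Longrightarrow> (\<integral>\<^sup>+z. f (axis j 1) z * indicator (shell r) z \<partial>lborel) < ennreal k"
      using k(1) by (elim shell_integral_small[rotated, where e="ennreal k"]) auto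
    define r where "r = min (d / 5) (1 / 4)"
    have r: "0 < r" "r \<le> 1/4" "5 * r \<le> d" using d(1) by (auto simp: r_def)
    have "1 \<le> r powr ?p" using r p powr_mono2'[of ?p r 1] by simp
    then have "k \<le> k * r powr ?p" using k(1) by simp
    then have "ennreal k \<le> ennreal (k * r powr ?p)" by (rule ennreal_leI)
    also have "\<dots> \<le> (\<integral>\<^sup>+z. f (axis j 1) z * indicator (shell (5 * r)) z \<partial>lborel)"
      using k(2)[of r 1] r by simp
    also have "\<dots> < ennreal k" by (rule d(2)) (rule r)
    finally show False by simp
  qed
qed

subsection \<open>Test functions\<close>

lemma ennreal_divide_mult_self:
  fixes x :: ennreal
  assumes "0 < v" shows "x / ennreal v * ennreal v = x"
  using assms by (cases x) (auto simp: divide_ennreal ennreal_mult[symmetric] ennreal_top_divide ennreal_top_mult)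

text \<open>\<open>k\<close> stands for a lower bound on the norm of the other factor at a fixed
  point. Dividing by it and raising to the power \<open>q\<close> gives an integral bound with
  \<open>t = q * a + \<beta>\<close>, \<open>g = q * c\<close> and
  \<open>e = q * (b - \<alpha>)\<close>; its consequences are then divided by
  \<open>q\<close>.\<close>

lemma admissible_of_factor_le:
  fixes a b c \<alpha> \<beta> q k C :: real
  assumes q: "1 \<le> q" and \<beta>: "-1 < \<beta>" and k: "0 < k" and C: "0 \<le> C"
    and le: "\<And>u::complex^'n. norm u < 1 \<Longrightarrow>
      epowr (\<integral>\<^sup>+z. ennreal (factor a 0 c z u powr q) \<partial>vol_weighted \<beta>) (1 / q) * ennreal k
        \<le> ennreal (C * (1 - (norm u)\<^sup>2) powr (\<alpha> - b))"
  shows "admissible CARD('n) a b c \<alpha> \<beta> q"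
proof -
  let ?n = "real CARD('n)"
  define V where "V = measure lborel (unit_ball :: (complex^'n) set)"
  have V: "0 < V" "emeasure lborel (unit_ball :: (complex^'n) set) = ennreal V"
    unfolding V_def unit_ball_def by (auto intro: measure_lborel_ball_pos emeasure_lborel_ball_real)
  have c0: "0 < c_const CARD('n) \<beta>" using \<beta> by (rule c_const_pos)
  define B where "B = (C / k) powr q * V / c_const CARD('n) \<beta>"
  have B: "0 \<le> B" using V c0 by (simp add: B_def)
  have J: "(\<integral>\<^sup>+z. ennreal ((1 - (norm z)\<^sup>2) powr (q * a + \<beta>) * norm (1 - herm z u) powr (- (q * c))) * indicator unit_ball z \<partial>lborel)
      \<le> ennreal (B * (1 - (norm u)\<^sup>2) powr (- (q * (b - \<alpha>))))" if u: "norm u < 1" for u :: "complex ^ 'n"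
  proof -
    let ?I = "\<integral>\<^sup>+z. ennreal (factor a 0 c z u powr q) \<partial>vol_weighted \<beta>"
    let ?J = "\<integral>\<^sup>+z. ennreal ((1 - (norm z)\<^sup>2) powr (q * a + \<beta>) * norm (1 - herm z u) powr (- (q * c))) * indicator unit_ball z \<partial>lborel"
    have pos: "0 < 1 - (norm u)\<^sup>2" using one_minus_norm_sq[OF u] by simp
    define y where "y = C / k * (1 - (norm u)\<^sup>2) powr (\<alpha> - b)"
    have y: "0 \<le> y" using C k by (simp add: y_def)
    have "epowr ?I (1 / q) \<le> ennreal (C * (1 - (norm u)\<^sup>2) powr (\<alpha> - b) / k)"
      using le[OF u] k C by (intro ennreal_le_divideI) auto
    also have "\<dots> = ennreal y" by (simp add: y_def)
    finally have "epowr (epowr ?I (1 / q)) q \<le> epowr (ennreal y) q"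
      using q by (intro epowr_mono) auto
    then have I: "?I \<le> ennreal (y powr q)"
      using q y by (simp add: epowr_epowr epowr_ennreal)
    have "?I = ennreal (c_const CARD('n) \<beta>) * ?J / ennreal V"
      using pos unfolding nn_integral_factor[OF u \<beta>] V by simp
    then have "ennreal (c_const CARD('n) \<beta>) * ?J / ennreal V * ennreal V \<le> ennreal (y powr q) * ennreal V"
      using I by (intro mult_right_mono) auto
    then have "?J * ennreal (c_const CARD('n) \<beta>) \<le> ennreal (y powr q * V)"
      unfolding ennreal_divide_mult_self[OF V(1)] using V(1) by (simp add: ennreal_mult mult.commute)
    then have "?J \<le> ennreal (y powr q * V / c_const CARD('n) \<beta>)"
      using c0 V by (intro ennreal_le_divideI) auto
    also have "y powr q * V / c_const CARD('n) \<beta> = B * (1 - (norm u)\<^sup>2) powr (- (q * (b - \<alpha>)))"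
    proof -
      have "y powr q = (C / k) powr q * ((1 - (norm u)\<^sup>2) powr (\<alpha> - b)) powr q"
        unfolding y_def by (subst powr_mult) (use C k in simp_all)
      also have "((1 - (norm u)\<^sup>2) powr (\<alpha> - b)) powr q = (1 - (norm u)\<^sup>2) powr (- (q * (b - \<alpha>)))"
        by (simp add: powr_powr algebra_simps)
      finally show ?thesis by (simp add: B_def)
    qed
    finally show ?thesis .
  qed
  note ex = exponent_conditions_of_integral_le[OF J B]
  have q0: "0 < q" using q by simp
  have t: "- (q * a) < \<beta> + 1" using ex(1) by simp
  have ba: "\<alpha> \<le> b" using ex(2) q0 by (simp add: zero_le_mult_iff)
  have Q: "q * ((?n + 1 + \<beta>) / q) = ?n + 1 + \<beta>" using q0 by simp
  have "q * (a + b - \<alpha> + (?n + 1 + \<beta>) / q) = q * a + q * (b - \<alpha>) + q * ((?n + 1 + \<beta>) / q)"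
    by (simp only: distrib_left right_diff_distrib)
  then have "q * c \<le> q * (a + b - \<alpha> + (?n + 1 + \<beta>) / q)"
    using ex(3) unfolding Q by linarith
  then have c1: "c \<le> a + b - \<alpha> + (?n + 1 + \<beta>) / q"
    using q0 by (simp only: mult_le_cancel_left_pos)
  have c2: "c < a + (?n + 1 + \<beta>) / q" if "\<alpha> = b"
  proof -
    have "q * c < q * (a + (?n + 1 + \<beta>) / q)"
      using ex(4) that unfolding distrib_left Q by simp
    then show ?thesis using q0 by (simp only: mult_less_cancel_left_pos)
  qed
  show ?thesis using t ba c1 c2 by (auto simp: admissible_def)
qed

lemma mixed_norm_mono:
  assumes q: "0 < q $ 1" "0 < q $ 2"
    and le: "\<And>z w. norm z < 1 \<Longrightarrow> norm w < 1 \<Longrightarrow> norm (f (z, w)) \<le> norm (g (z, w))"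
  shows "mixed_norm q \<beta> f \<le> mixed_norm q \<beta> g"
  unfolding mixed_norm_def using q
  by (intro epowr_mono nn_integral_mono ennreal_leI powr_mono2 le) (auto simp: unit_ball_iff)

text \<open>The inner integral leaves the outer one with the power \<open>q $ 2 / q $ 1\<close>,
  which the final root turns into \<open>1 / q $ 1\<close>.\<close>

lemma mixed_norm_product:
  fixes g h :: "complex ^ 'n \<Rightarrow> real"
  assumes q: "0 < q $ 1" "0 < q $ 2" and r: "0 \<le> r"
    and gh: "\<And>z. 0 \<le> g z" "\<And>z. 0 \<le> h z" "g \<in> borel_measurable borel" "h \<in> borel_measurable borel"
  shows "mixed_norm q \<beta> (\<lambda>(z, w). complex_of_real (r * g z * h w)) = ennreal r *
    (epowr (\<integral>\<^sup>+z. ennreal (g z powr (q $ 1)) \<partial>vol_weighted (\<beta> $ 1)) (1 / q $ 1) *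
     epowr (\<integral>\<^sup>+w. ennreal (h w powr (q $ 2)) \<partial>vol_weighted (\<beta> $ 2)) (1 / q $ 2))"
proof -
  have [measurable]: "g \<in> borel_measurable vol" "h \<in> borel_measurable vol"
    using gh by (auto intro: borel_measurable_vol)
  define I1 where "I1 = (\<integral>\<^sup>+z. ennreal (g z powr (q $ 1)) \<partial>vol_weighted (\<beta> $ 1))"
  define I2 where "I2 = (\<integral>\<^sup>+w. ennreal (h w powr (q $ 2)) \<partial>vol_weighted (\<beta> $ 2))"
  have inner: "epowr (\<integral>\<^sup>+z. ennreal (norm (complex_of_real (r * g z * h w)) powr (q $ 1)) \<partial>vol_weighted (\<beta> $ 1)) (q $ 2 / q $ 1)
    = (ennreal (r powr (q $ 2)) * epowr I1 (q $ 2 / q $ 1)) * ennreal (h w powr (q $ 2))" for w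
  proof -
    have "(\<integral>\<^sup>+z. ennreal (norm (complex_of_real (r * g z * h w)) powr (q $ 1)) \<partial>vol_weighted (\<beta> $ 1))
      = (\<integral>\<^sup>+z. ennreal (r powr (q $ 1) * h w powr (q $ 1)) * ennreal (g z powr (q $ 1)) \<partial>vol_weighted (\<beta> $ 1))"
    proof (rule nn_integral_cong)
      fix z :: "complex ^ 'n"
      have "norm (complex_of_real (r * g z * h w)) = r * g z * h w"
        using r gh(1,2) by (simp only: norm_of_real abs_of_nonneg mult_nonneg_nonneg)
      then show "ennreal (norm (complex_of_real (r * g z * h w)) powr (q $ 1))
        = ennreal (r powr (q $ 1) * h w powr (q $ 1)) * ennreal (g z powr (q $ 1))"
        using r gh(1,2) by (simp add: ennreal_mult[symmetric] powr_mult mult_ac)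
    qed
    also have "\<dots> = ennreal (r powr (q $ 1) * h w powr (q $ 1)) * I1"
      unfolding I1_def by (rule nn_integral_cmult) measurable
    finally show ?thesis
      using q by (simp add: epowr_mult epowr_ennreal powr_mult powr_powr ennreal_mult mult_ac)
  qed
  have "mixed_norm q \<beta> (\<lambda>(z, w). complex_of_real (r * g z * h w))
    = epowr (\<integral>\<^sup>+w. (ennreal (r powr (q $ 2)) * epowr I1 (q $ 2 / q $ 1)) * ennreal (h w powr (q $ 2)) \<partial>vol_weighted (\<beta> $ 2)) (1 / q $ 2)"
    unfolding mixed_norm_def by (simp only: prod.case inner)
  also have "(\<integral>\<^sup>+w. (ennreal (r powr (q $ 2)) * epowr I1 (q $ 2 / q $ 1)) * ennreal (h w powr (q $ 2)) \<partial>vol_weighted (\<beta> $ 2))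
    = (ennreal (r powr (q $ 2)) * epowr I1 (q $ 2 / q $ 1)) * I2"
    unfolding I2_def by (rule nn_integral_cmult) measurable
  also have "epowr \<dots> (1 / q $ 2) = ennreal r * (epowr I1 (1 / q $ 1) * epowr I2 (1 / q $ 2))"
    using q r by (simp add: epowr_mult epowr_epowr epowr_ennreal powr_powr mult.assoc)
  finally show ?thesis by (simp add: I1_def I2_def)
qed

text \<open>Supplies the positive constant by which the bound for the product of two factors is
  divided to isolate one of them.\<close>

lemma factor_integral_pos:
  fixes u :: "complex ^ 'n"
  assumes u: "norm u < 1" and \<beta>: "-1 < \<beta>"
  shows "(\<integral>\<^sup>+z. ennreal (factor a 0 c z u powr q) \<partial>vol_weighted \<beta>) \<noteq> 0"
proof
  define f where "f = (\<lambda>z. ennreal ((1 - (norm z)\<^sup>2) powr (q * a + \<beta>) * norm (1 - herm z u) powr (- (q * c))) * indicator unit_ball z)"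
  assume "(\<integral>\<^sup>+z. ennreal (factor a 0 c z u powr q) \<partial>vol_weighted \<beta>) = 0"
  then have "(\<integral>\<^sup>+z. f z \<partial>lborel) = 0"
    using c_const_pos[OF \<beta>, of "CARD('n)"] emeasure_vol_space[where 'n='n] one_minus_norm_sq(4)[OF u]
    unfolding nn_integral_factor[OF u \<beta>] f_def
    by (auto simp: ennreal_divide_eq_0_iff)
  moreover have "f \<in> borel_measurable lborel" unfolding f_def by measurable
  ultimately have "AE z in lborel. f z = 0" by (simp add: nn_integral_0_iff_AE)
  then have "AE z in lborel. z \<notin> (unit_ball :: (complex ^ 'n) set)"
  proof (rule AE_mp, intro AE_I2 impI)
    fix z assume z: "f z = 0"
    show "z \<notin> unit_ball"
    proof
      assume "z \<in> unit_ball"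
      then have "norm z < 1" by (simp add: unit_ball_iff)
      then have "0 < (1 - (norm z)\<^sup>2) powr (q * a + \<beta>) * norm (1 - herm z u) powr (- (q * c))"
        using one_minus_norm_sq(4)[of z] Re_1_minus_herm_pos[of z u] u by (intro mult_pos_pos) auto
      then have "ennreal ((1 - (norm z)\<^sup>2) powr (q * a + \<beta>) * norm (1 - herm z u) powr (- (q * c))) \<noteq> 0"
        by (simp only: ennreal_eq_0_iff not_le)
      moreover have "f z = ennreal ((1 - (norm z)\<^sup>2) powr (q * a + \<beta>) * norm (1 - herm z u) powr (- (q * c)))"
        using \<open>z \<in> unit_ball\<close> by (simp only: f_def indicator_simps mult_1_right)
      ultimately show False using z by simp
    qed
  qed
  then have "emeasure lborel (unit_ball :: (complex ^ 'n) set) = 0"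
    by (subst (asm) AE_iff_measurable[OF _ refl]) auto
  then show False using emeasure_vol_space[where 'n='n] by simp
qed

section \<open>Oscillation of the kernel on small balls\<close>

lemma product_perturbation:
  fixes A A0 B B0 :: complex
  assumes "norm (A - A0) \<le> norm A0 / 4" "norm (B - B0) \<le> norm B0 / 4"
  shows "norm (A * B - A0 * B0) \<le> 9/16 * norm (A0 * B0)"
proof -
  have "A * B - A0 * B0 = (A - A0) * (B - B0) + ((A - A0) * B0 + A0 * (B - B0))"
    by (simp add: algebra_simps)
  also have "norm \<dots> \<le> norm ((A - A0) * (B - B0)) + (norm ((A - A0) * B0) + norm (A0 * (B - B0)))"
    by (intro norm_triangle_le add_mono norm_triangle_ineq order_refl)
  \<comment> \<open>\<open>9/16 = 1/16 + 1/4 + 1/4\<close>; what matters is that it is less than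
    \<open>1\<close>.\<close>
  also have "\<dots> \<le> norm A0 / 4 * (norm B0 / 4) + (norm A0 / 4 * norm B0 + norm A0 * (norm B0 / 4))"
    unfolding norm_mult using assms by (intro add_mono mult_mono) auto
  also have "\<dots> = 9/16 * norm (A0 * B0)" by (simp add: norm_mult)
  finally show ?thesis .
qed

text \<open>A radius proportional to \<open>1 - norm u\<close>, which is at most
  \<open>norm (1 - herm z u)\<close>, makes the relative change small for all \<open>z\<close> at
  once.\<close>

lemma herm_perturbation:
  fixes z u v :: "complex ^ 'n"
  assumes "norm z < 1" "norm u < 1" "0 < k" "dist u v < k * (1 - norm u)"
  shows "norm ((1 - herm z v) - (1 - herm z u)) \<le> k * norm (1 - herm z u)"
proof -
  have "(1 - herm z v) - (1 - herm z u) = herm z (u - v)" by (simp add: herm_diff_right)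
  also have "norm \<dots> \<le> norm z * norm (u - v)" by (rule norm_herm_le)
  also have "\<dots> \<le> 1 * (k * (1 - norm u))"
    using assms by (intro mult_mono) (auto simp: dist_norm)
  also have "\<dots> \<le> k * norm (1 - herm z u)"
    using norm_1_minus_herm_ge(2)[of z u] assms by simp
  finally show ?thesis .
qed

text \<open>With \<open>k \<le> 1/2\<close>, the quantity \<open>1 - norm v\<close> lies between one
  half and three halves of \<open>1 - norm u\<close>; passing to squares of the norms leaves the
  factor \<open>4\<close>.\<close>

lemma ball_near:
  fixes u v :: "complex ^ 'n"
  assumes u: "norm u < 1" and k: "0 < k" "k \<le> 1/2" and v: "dist u v < k * (1 - norm u)"
  shows "norm v < 1" "(1 - (norm v)\<^sup>2) powr s \<le> 4 powr \<bar>s\<bar> * (1 - (norm u)\<^sup>2) powr s"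
proof -
  have "k * (1 - norm u) \<le> 1/2 * (1 - norm u)" using u k by (intro mult_right_mono) auto
  then have d: "norm (u - v) \<le> (1 - norm u) / 2" using v by (simp add: dist_norm)
  have uv: "norm v \<le> norm u + norm (u - v)" "norm u \<le> norm v + norm (u - v)"
    using norm_triangle_ineq4[of u "u - v"] norm_triangle_ineq[of v "u - v"] by simp_all
  show nv: "norm v < 1" using uv d u by argo
  show "(1 - (norm v)\<^sup>2) powr s \<le> 4 powr \<bar>s\<bar> * (1 - (norm u)\<^sup>2) powr s"
    using one_minus_norm_sq[OF u] one_minus_norm_sq[OF nv] uv d
    by (intro powr_comparable) argo+
qed

lemma finite_measure_vol_pair: "finite_measure ((vol :: (complex ^ 'n) measure) \<Otimes>\<^sub>M (vol :: (complex ^ 'n) measure))"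
proof (rule finite_measureI)
  interpret pair_sigma_finite "vol :: (complex ^ 'n) measure" "vol :: (complex ^ 'n) measure"
    by (rule pair_sigma_finite_vol)
  interpret V: finite_measure "vol :: (complex ^ 'n) measure" by (rule finite_measure_vol)
  have sp: "unit_ball \<in> sets (vol :: (complex ^ 'n) measure)"
    using sets.top[of "vol :: (complex ^ 'n) measure"] by simp
  have "emeasure (vol \<Otimes>\<^sub>M vol) ((unit_ball :: (complex ^ 'n) set) \<times> (unit_ball :: (complex ^ 'n) set)) = emeasure (vol :: (complex ^ 'n) measure) unit_ball * emeasure (vol :: (complex ^ 'n) measure) unit_ball"
    by (intro sigma_finite_measure.emeasure_pair_measure_Times sigma_finite_vol sp)
  then show "emeasure (vol \<Otimes>\<^sub>M vol) (space ((vol :: (complex ^ 'n) measure) \<Otimes>\<^sub>M (vol :: (complex ^ 'n) measure))) \<noteq> \<infinity>"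
    using V.emeasure_finite[of unit_ball] by (simp add: space_pair_measure ennreal_mult_eq_top_iff)
qed

lemma ball_vol:
  assumes r: "0 < r" and sub: "ball u r \<subseteq> unit_ball"
  shows "ball u r \<in> sets vol" "0 < emeasure vol (ball u r)"
proof -
  show *: "ball u r \<in> sets vol"
    using sub by (auto simp: sets_vol sets_restrict_space)
  have "emeasure vol (ball u r) = (\<integral>\<^sup>+z. indicator (ball u r) z \<partial>vol)"
    using * by simp
  also have "\<dots> = (\<integral>\<^sup>+z. indicator (ball u r) z * indicator unit_ball z \<partial>lborel)
      / emeasure lborel (unit_ball :: (complex ^ 'a) set)"
    using * by (intro nn_integral_vol borel_measurable_indicator)
  also have "(\<integral>\<^sup>+z. indicator (ball u r) z * indicator unit_ball z \<partial>lborel) = (\<integral>\<^sup>+z. indicator (ball u r) z \<partial>lborel)"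
    using sub by (intro nn_integral_cong) (auto simp: indicator_def)
  also have "\<dots> = emeasure lborel (ball u r)" by (simp add: nn_integral_indicator)
  finally show "0 < emeasure vol (ball u r)"
    using emeasure_lborel_ball_pos[OF r, of u] emeasure_vol_space[where 'n='a]
    by (simp add: zero_less_iff_neq_zero ennreal_divide_eq_0_iff)
qed

text \<open>The test function is a weight times the indicator of a product of small balls around \<open>(u, \<eta>)\<close>. Relative to its
  value at \<open>(u, \<eta>)\<close> the kernel oscillates by at most \<open>9/16\<close> there, uniformly in \<open>(z, w)\<close>.\<close>

lemma factors_le_of_kernel_op_bounded:
  fixes K :: "'n::finite cpair \<Rightarrow> 'n cpair \<Rightarrow> complex" and \<Phi> :: "real \<Rightarrow> complex \<Rightarrow> complex"
    and a b c \<alpha> \<beta> q :: "real ^ 2"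
  assumes K: "\<And>z w u \<eta>. norm z < 1 \<Longrightarrow> norm w < 1 \<Longrightarrow> norm u < 1 \<Longrightarrow> norm \<eta> < 1 \<Longrightarrow>
      K (z, w) (u, \<eta>) = of_real ((1 - (norm u)\<^sup>2) powr (b $ 1) * (1 - (norm \<eta>)\<^sup>2) powr (b $ 2)) *
        (\<Phi> (c $ 1) (1 - herm z u) * \<Phi> (c $ 2) (1 - herm w \<eta>))"
    and \<Phi>_norm: "\<And>c y. 0 < Re y \<Longrightarrow> norm (\<Phi> c y) = norm y powr (- c)"
    and \<Phi>_cont: "\<And>c. \<exists>k>0. k \<le> 1/2 \<and> (\<forall>y y'. 0 < Re y \<longrightarrow> 0 < Re y' \<longrightarrow> norm (y' - y) \<le> k * norm y \<longrightarrow>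
      norm (\<Phi> c y' - \<Phi> c y) \<le> norm (\<Phi> c y) / 4)"
    and \<alpha>: "\<forall>i. -1 < \<alpha> $ i" and q: "\<forall>i. 1 \<le> q $ i"
    and bdd: "kernel_op_bounded a K (mixed_L (vector [1, 1]) \<alpha>) (mixed_norm (vector [1, 1]) \<alpha>) (mixed_L q \<beta>) (mixed_norm q \<beta>)"
  obtains C where "0 \<le> C"
    "\<And>(u :: complex ^ 'n) (\<eta> :: complex ^ 'n). norm u < 1 \<Longrightarrow> norm \<eta> < 1 \<Longrightarrow>
      epowr (\<integral>\<^sup>+z. ennreal (factor (a $ 1) 0 (c $ 1) z u powr (q $ 1)) \<partial>vol_weighted (\<beta> $ 1)) (1 / q $ 1) *
      epowr (\<integral>\<^sup>+w. ennreal (factor (a $ 2) 0 (c $ 2) w \<eta> powr (q $ 2)) \<partial>vol_weighted (\<beta> $ 2)) (1 / q $ 2)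
      \<le> ennreal (C * ((1 - (norm u)\<^sup>2) powr (\<alpha> $ 1 - b $ 1) * (1 - (norm \<eta>)\<^sup>2) powr (\<alpha> $ 2 - b $ 2)))"
proof -
  let ?P = "(vol :: (complex ^ 'n) measure) \<Otimes>\<^sub>M (vol :: (complex ^ 'n) measure)"
  interpret pair_sigma_finite "vol :: (complex ^ 'n) measure" "vol :: (complex ^ 'n) measure"
    by (rule pair_sigma_finite_vol)
  interpret P: finite_measure ?P by (rule finite_measure_vol_pair)
  let ?cc = "c_const CARD('n) (\<alpha> $ 1) * c_const CARD('n) (\<alpha> $ 2)"
  have cc: "0 < ?cc" using \<alpha> by (intro mult_pos_pos c_const_pos) auto
  have q0: "0 < q $ i" for i using q[rule_format, of i] by simp
  obtain C0 where C0: "\<And>f. f \<in> mixed_L (vector [1, 1]) \<alpha> \<Longrightarrow>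
      (\<forall>z\<in>unit_ball. \<forall>w\<in>unit_ball. integrable ?P (\<lambda>x. K (z, w) x * f x)) \<and>
      mixed_norm q \<beta> (kernel_op a K f) \<le> ennreal C0 * mixed_norm (vector [1, 1]) \<alpha> f"
    using bdd unfolding kernel_op_bounded_def by blast
  obtain k1 where k1: "0 < k1" "k1 \<le> 1/2" "\<And>y y'. 0 < Re y \<Longrightarrow> 0 < Re y' \<Longrightarrow> norm (y' - y) \<le> k1 * norm y \<Longrightarrow>
      norm (\<Phi> (c $ 1) y' - \<Phi> (c $ 1) y) \<le> norm (\<Phi> (c $ 1) y) / 4"
    using \<Phi>_cont[of "c $ 1"] by blast
  obtain k2 where k2: "0 < k2" "k2 \<le> 1/2" "\<And>y y'. 0 < Re y \<Longrightarrow> 0 < Re y' \<Longrightarrow> norm (y' - y) \<le> k2 * norm y \<Longrightarrow>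
      norm (\<Phi> (c $ 2) y' - \<Phi> (c $ 2) y) \<le> norm (\<Phi> (c $ 2) y) / 4"
    using \<Phi>_cont[of "c $ 2"] by blast
  define s1 where "s1 = \<alpha> $ 1 - b $ 1"
  define s2 where "s2 = \<alpha> $ 2 - b $ 2"
  \<comment> \<open>\<open>16/7\<close> undoes the loss \<open>1 - 9/16\<close>, the powers of
    \<open>4\<close> bound the norm of the test function, and \<open>max\<close> makes the operator
    bound nonnegative.\<close>
  define C where "C = 16/7 * (max C0 0 * (?cc * (4 powr \<bar>s1\<bar> * 4 powr \<bar>s2\<bar>)))"
  show thesis
  proof (rule that)
    show "0 \<le> C" using cc by (simp add: C_def)
    fix u0 \<eta>0 :: "complex ^ 'n" assume u0: "norm u0 < 1" and \<eta>0: "norm \<eta>0 < 1"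
    define U where "U = ball u0 (k1 * (1 - norm u0))"
    define E where "E = ball \<eta>0 (k2 * (1 - norm \<eta>0))"
    have U: "norm u < 1" "(1 - (norm u)\<^sup>2) powr s \<le> 4 powr \<bar>s\<bar> * (1 - (norm u0)\<^sup>2) powr s" if "u \<in> U" for u s
      using ball_near[OF u0 k1(1,2)] that by (auto simp: U_def)
    have E: "norm u < 1" "(1 - (norm u)\<^sup>2) powr s \<le> 4 powr \<bar>s\<bar> * (1 - (norm \<eta>0)\<^sup>2) powr s" if "u \<in> E" for u s
      using ball_near[OF \<eta>0 k2(1,2)] that by (auto simp: E_def)
    have Uv: "U \<in> sets vol" "0 < emeasure vol U"
      unfolding U_def using U(1) u0 k1(1) by (auto intro!: ball_vol simp: U_def unit_ball_iff)
    have Ev: "E \<in> sets vol" "0 < emeasure vol E"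
      unfolding E_def using E(1) \<eta>0 k2(1) by (auto intro!: ball_vol simp: E_def unit_ball_iff)
    note [measurable] = Uv(1) Ev(1)
    let ?UE = "U \<times> E"
    have UE [measurable]: "?UE \<in> sets ?P" by simp
    define V where "V = measure ?P ?UE"
    have V: "emeasure ?P ?UE = ennreal V" unfolding V_def by (rule P.emeasure_eq_measure)
    have "emeasure ?P ?UE = emeasure vol U * emeasure vol E"
      by (intro sigma_finite_measure.emeasure_pair_measure_Times sigma_finite_vol) auto
    then have "0 < emeasure ?P ?UE" using Uv Ev by (simp add: zero_less_iff_neq_zero)
    then have V0: "0 < V" unfolding V by simp
    \<comment> \<open>The exponents \<open>- b\<close> cancel the weights of the kernel, so
      \<open>K * f\<close> reduces to the product of the two \<open>\<Phi>\<close> values on the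
      product of balls.\<close>
    define f where "f = (\<lambda>x :: 'n cpair. complex_of_real ((1 - (norm (fst x))\<^sup>2) powr (- (b $ 1)) * (1 - (norm (snd x))\<^sup>2) powr (- (b $ 2)) * indicator ?UE x))"
    have [measurable]: "f \<in> borel_measurable ?P" unfolding f_def by measurable
    define D where "D = 4 powr \<bar>s1\<bar> * (1 - (norm u0)\<^sup>2) powr s1 * (4 powr \<bar>s2\<bar> * (1 - (norm \<eta>0)\<^sup>2) powr s2)"
    have D0: "0 \<le> D" by (simp add: D_def)
    have "mixed_norm (vector [1, 1]) \<alpha> f = ennreal ?cc *
      (\<integral>\<^sup>+x. ennreal (norm (f x) * (1 - (norm (fst x))\<^sup>2) powr (\<alpha> $ 1) * (1 - (norm (snd x))\<^sup>2) powr (\<alpha> $ 2)) \<partial>?P)"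
      using \<alpha> by (intro mixed_norm_1_1) auto
    also have "\<dots> \<le> ennreal ?cc * (\<integral>\<^sup>+x. ennreal D * indicator ?UE x \<partial>?P)"
    proof (intro mult_left_mono nn_integral_mono)
      fix x :: "'n cpair"
      show "ennreal (norm (f x) * (1 - (norm (fst x))\<^sup>2) powr (\<alpha> $ 1) * (1 - (norm (snd x))\<^sup>2) powr (\<alpha> $ 2))
        \<le> ennreal D * indicator ?UE x"
      proof (cases "x \<in> ?UE")
        case True
        then obtain u \<eta> where x: "x = (u, \<eta>)" "u \<in> U" "\<eta> \<in> E" by auto
        have "norm (f x) * (1 - (norm (fst x))\<^sup>2) powr (\<alpha> $ 1) * (1 - (norm (snd x))\<^sup>2) powr (\<alpha> $ 2)
          = (1 - (norm u)\<^sup>2) powr s1 * (1 - (norm \<eta>)\<^sup>2) powr s2"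
        proof -
          have "norm (f x) = (1 - (norm u)\<^sup>2) powr (- (b $ 1)) * (1 - (norm \<eta>)\<^sup>2) powr (- (b $ 2))"
            using x by (simp add: f_def norm_mult)
          moreover have "(1 - (norm u)\<^sup>2) powr s1 = (1 - (norm u)\<^sup>2) powr (- (b $ 1)) * (1 - (norm u)\<^sup>2) powr (\<alpha> $ 1)"
            "(1 - (norm \<eta>)\<^sup>2) powr s2 = (1 - (norm \<eta>)\<^sup>2) powr (- (b $ 2)) * (1 - (norm \<eta>)\<^sup>2) powr (\<alpha> $ 2)"
            by (simp_all add: s1_def s2_def flip: powr_add)
          ultimately show ?thesis using x by simp
        qed
        also have "\<dots> \<le> D"
          unfolding D_def using U(2)[OF x(2)] E(2)[OF x(3)] by (intro mult_mono) auto
        finally show ?thesis using True by (simp add: ennreal_leI)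
      qed (simp add: f_def)
    qed simp
    also have "(\<integral>\<^sup>+x. ennreal D * indicator ?UE x \<partial>?P) = ennreal D * ennreal V"
      unfolding V[symmetric] by (rule nn_integral_cmult_indicator) simp
    finally have f_norm: "mixed_norm (vector [1, 1]) \<alpha> f \<le> ennreal (?cc * (D * V))"
      using cc D0 V0 by (simp add: ennreal_mult)
    then have fL: "f \<in> mixed_L (vector [1, 1]) \<alpha>"
      unfolding mixed_L_def by (auto intro: le_less_trans)
    \<comment> \<open>\<open>7/16 = 1 - 9/16\<close> is the share of \<open>V * norm p\<close> that
      remains after the oscillation has been subtracted.\<close>
    define r where "r = 7/16 * V"
    have low: "norm (complex_of_real (r * factor (a $ 1) 0 (c $ 1) z u0 * factor (a $ 2) 0 (c $ 2) w \<eta>0)) \<le> norm (kernel_op a K f (z, w))"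
      if z: "norm z < 1" and w: "norm w < 1" for z w
    proof -
      let ?A = "\<lambda>u. \<Phi> (c $ 1) (1 - herm z u)" and ?B = "\<lambda>\<eta>. \<Phi> (c $ 2) (1 - herm w \<eta>)"
      define p where "p = ?A u0 * ?B \<eta>0"
      define g where "g = (\<lambda>x. K (z, w) x * f x)"
      have g_int: "integrable ?P g"
        unfolding g_def using C0[OF fL] z w by (simp add: unit_ball_iff)
      have g_eq: "g x = indicator ?UE x * (?A (fst x) * ?B (snd x))" if xP: "x \<in> space ?P" for x
      proof -
        obtain u \<eta> where x: "x = (u, \<eta>)" "norm u < 1" "norm \<eta> < 1"
          using xP by (cases x) (auto simp: space_pair_measure unit_ball_iff)
        have one: "(1 - (norm u)\<^sup>2) powr (b $ 1) * (1 - (norm u)\<^sup>2) powr (- (b $ 1)) = 1"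
          "(1 - (norm \<eta>)\<^sup>2) powr (b $ 2) * (1 - (norm \<eta>)\<^sup>2) powr (- (b $ 2)) = 1"
          using one_minus_norm_sq(4)[OF x(2)] one_minus_norm_sq(4)[OF x(3)] by (simp_all flip: powr_add)
        have e: "(1 - (norm u)\<^sup>2) powr (b $ 1) * (1 - (norm \<eta>)\<^sup>2) powr (b $ 2) *
            ((1 - (norm u)\<^sup>2) powr (- (b $ 1)) * (1 - (norm \<eta>)\<^sup>2) powr (- (b $ 2)) * indicator ?UE x) = (indicator ?UE x :: real)"
        proof -
          have "x1 * y1 * (x2 * y2 * i) = (x1 * x2) * ((y1 * y2) * i)" for x1 x2 y1 y2 i :: real
            by (simp only: mult_ac)
          with one show ?thesis by (simp only: mult_1_left)
        qed
        have "g x = complex_of_real ((1 - (norm u)\<^sup>2) powr (b $ 1) * (1 - (norm \<eta>)\<^sup>2) powr (b $ 2) *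
            ((1 - (norm u)\<^sup>2) powr (- (b $ 1)) * (1 - (norm \<eta>)\<^sup>2) powr (- (b $ 2)) * indicator ?UE x)) * (?A u * ?B \<eta>)"
          unfolding g_def f_def x K[OF z w x(2,3)] by simp
        then show ?thesis unfolding e using x by (simp add: indicator_def)
      qed
      have near: "norm (g x - indicator ?UE x *\<^sub>R p) \<le> 9/16 * norm p * indicator ?UE x" if "x \<in> space ?P" for x
      proof (cases "x \<in> ?UE")
        case True
        then obtain u \<eta> where x: "x = (u, \<eta>)" "u \<in> U" "\<eta> \<in> E" by auto
        have "norm (?A u - ?A u0) \<le> norm (?A u0) / 4"
          using x U(1)[of u] u0 z k1(1) Re_1_minus_herm_pos
          by (intro k1(3) herm_perturbation) (auto simp: U_def intro: less_imp_le)
        moreover have "norm (?B \<eta> - ?B \<eta>0) \<le> norm (?B \<eta>0) / 4"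
          using x E(1)[of \<eta>] \<eta>0 w k2(1) Re_1_minus_herm_pos
          by (intro k2(3) herm_perturbation) (auto simp: E_def intro: less_imp_le)
        ultimately have "norm (?A u * ?B \<eta> - p) \<le> 9/16 * norm p"
          unfolding p_def by (rule product_perturbation)
        then show ?thesis using True x that by (simp add: g_eq)
      qed (use that in \<open>simp add: g_eq\<close>)
      have ind_int: "integrable ?P (\<lambda>x. indicator ?UE x *\<^sub>R p)"
        by (intro integrable_scaleR_left) (simp add: integrable_indicator_iff P.emeasure_eq_measure)
      have ind_int2: "integrable ?P (\<lambda>x. 9/16 * norm p * indicator ?UE x)"
        by (intro integrable_mult_right) (simp add: integrable_indicator_iff P.emeasure_eq_measure)
      have "norm ((\<integral>x. g x \<partial>?P) - V *\<^sub>R p) = norm (\<integral>x. (g x - indicator ?UE x *\<^sub>R p) \<partial>?P)"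
      proof -
        have "(\<integral>x. indicator ?UE x *\<^sub>R p \<partial>?P) = V *\<^sub>R p"
          by (subst integral_scaleR_left) (simp_all add: V_def integrable_indicator_iff P.emeasure_eq_measure)
        then show ?thesis using g_int ind_int by simp
      qed
      also have "\<dots> \<le> (\<integral>x. norm (g x - indicator ?UE x *\<^sub>R p) \<partial>?P)" by (rule integral_norm_bound)
      also have "\<dots> \<le> (\<integral>x. 9/16 * norm p * indicator ?UE x \<partial>?P)"
        using g_int ind_int ind_int2 near by (intro integral_mono) auto
      also have "\<dots> = 9/16 * norm p * V"
        by (simp add: V_def)
      finally have "norm ((\<integral>x. g x \<partial>?P) - V *\<^sub>R p) \<le> 9/16 * (V * norm p)"
        by (simp add: mult_ac)
      moreover have "norm (V *\<^sub>R p) = V * norm p" using V0 by simp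
      moreover have "norm (V *\<^sub>R p) - norm (\<integral>x. g x \<partial>?P) \<le> norm ((\<integral>x. g x \<partial>?P) - V *\<^sub>R p)"
        using norm_triangle_ineq2[of "V *\<^sub>R p" "\<integral>x. g x \<partial>?P"] by (simp only: norm_minus_commute)
      ultimately have "7/16 * (V * norm p) \<le> norm (\<integral>x. g x \<partial>?P)" by linarith
      then have main: "r * norm p \<le> norm (\<integral>x. g x \<partial>?P)" by (simp add: r_def)
      let ?h = "(1 - (norm z)\<^sup>2) powr (a $ 1) * (1 - (norm w)\<^sup>2) powr (a $ 2)"
      have np: "norm p = norm (1 - herm z u0) powr (- (c $ 1)) * norm (1 - herm w \<eta>0) powr (- (c $ 2))"
        unfolding p_def norm_mult using u0 \<eta>0 z w by (simp add: \<Phi>_norm Re_1_minus_herm_pos[simplified])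
      have one: "(1 - (norm u0)\<^sup>2) powr 0 = 1" "(1 - (norm \<eta>0)\<^sup>2) powr 0 = 1"
        using one_minus_norm_sq(4)[OF u0] one_minus_norm_sq(4)[OF \<eta>0] by simp_all
      have "r * factor (a $ 1) 0 (c $ 1) z u0 * factor (a $ 2) 0 (c $ 2) w \<eta>0 = ?h * (r * norm p)"
        unfolding np factor_def one divide_powr_uminus by (simp add: mult_ac)
      also have "\<dots> \<le> ?h * norm (\<integral>x. g x \<partial>?P)"
        using main by (intro mult_left_mono) auto
      also have "\<dots> = norm (kernel_op a K f (z, w))"
        unfolding kernel_op_def prod.case norm_mult norm_of_real g_def by (simp add: abs_mult)
      finally show ?thesis
        using V0 by (simp add: r_def abs_mult norm_mult)
    qed
    let ?I = "epowr (\<integral>\<^sup>+z. ennreal (factor (a $ 1) 0 (c $ 1) z u0 powr (q $ 1)) \<partial>vol_weighted (\<beta> $ 1)) (1 / q $ 1) *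
      epowr (\<integral>\<^sup>+w. ennreal (factor (a $ 2) 0 (c $ 2) w \<eta>0 powr (q $ 2)) \<partial>vol_weighted (\<beta> $ 2)) (1 / q $ 2)"
    have "ennreal r * ?I = mixed_norm q \<beta> (\<lambda>(z, w). complex_of_real (r * factor (a $ 1) 0 (c $ 1) z u0 * factor (a $ 2) 0 (c $ 2) w \<eta>0))"
      using q0 V0 by (intro mixed_norm_product[symmetric]) (auto simp: r_def)
    also have "\<dots> \<le> mixed_norm q \<beta> (kernel_op a K f)"
      using q0 low by (intro mixed_norm_mono) auto
    also have "\<dots> \<le> ennreal C0 * mixed_norm (vector [1, 1]) \<alpha> f" using C0[OF fL] by blast
    also have "\<dots> \<le> ennreal (max C0 0) * ennreal (?cc * (D * V))"
      by (intro mult_mono f_norm ennreal_leI) auto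
    also have "\<dots> = ennreal (max C0 0 * (?cc * (D * V)))"
      by (rule ennreal_mult[symmetric]) (use cc D0 V0 in auto)
    finally have "?I * ennreal r \<le> ennreal (max C0 0 * (?cc * (D * V)))"
      by (simp only: mult.commute)
    then have "?I \<le> ennreal (max C0 0 * (?cc * (D * V)) / r)"
      using V0 cc D0 by (intro ennreal_le_divideI) (auto simp: r_def)
    \<comment> \<open>Output and input both scale with \<open>V\<close>, so the size of the balls
      leaves the final bound.\<close>
    also have "max C0 0 * (?cc * (D * V)) / r = C * ((1 - (norm u0)\<^sup>2) powr s1 * (1 - (norm \<eta>0)\<^sup>2) powr s2)"
      using V0 by (simp add: r_def C_def D_def)
    finally show "?I \<le> ennreal (C * ((1 - (norm u0)\<^sup>2) powr (\<alpha> $ 1 - b $ 1) * (1 - (norm \<eta>0)\<^sup>2) powr (\<alpha> $ 2 - b $ 2)))"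
      by (simp only: s1_def s2_def)
  qed
qed

text \<open>One center is put at the origin. There its weight equals \<open>1\<close> and its norm
  is bounded below, so a bound in the other center alone is left.\<close>

lemma kernel_op_bounded_imp_admissible:
  fixes K :: "'n::finite cpair \<Rightarrow> 'n cpair \<Rightarrow> complex" and \<Phi> :: "real \<Rightarrow> complex \<Rightarrow> complex"
    and a b c \<alpha> \<beta> q :: "real ^ 2"
  assumes K: "\<And>z w u \<eta>. norm z < 1 \<Longrightarrow> norm w < 1 \<Longrightarrow> norm u < 1 \<Longrightarrow> norm \<eta> < 1 \<Longrightarrow>
      K (z, w) (u, \<eta>) = of_real ((1 - (norm u)\<^sup>2) powr (b $ 1) * (1 - (norm \<eta>)\<^sup>2) powr (b $ 2)) *
        (\<Phi> (c $ 1) (1 - herm z u) * \<Phi> (c $ 2) (1 - herm w \<eta>))"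
    and \<Phi>_norm: "\<And>c y. 0 < Re y \<Longrightarrow> norm (\<Phi> c y) = norm y powr (- c)"
    and \<Phi>_cont: "\<And>c. \<exists>k>0. k \<le> 1/2 \<and> (\<forall>y y'. 0 < Re y \<longrightarrow> 0 < Re y' \<longrightarrow> norm (y' - y) \<le> k * norm y \<longrightarrow>
      norm (\<Phi> c y' - \<Phi> c y) \<le> norm (\<Phi> c y) / 4)"
    and \<alpha>: "\<forall>i. -1 < \<alpha> $ i" and \<beta>: "\<forall>i. -1 < \<beta> $ i" and q: "\<forall>i. 1 \<le> q $ i"
    and bdd: "kernel_op_bounded a K (mixed_L (vector [1, 1]) \<alpha>) (mixed_norm (vector [1, 1]) \<alpha>) (mixed_L q \<beta>) (mixed_norm q \<beta>)"
  shows "admissible CARD('n) (a $ i) (b $ i) (c $ i) (\<alpha> $ i) (\<beta> $ i) (q $ i)"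
proof -
  define I where "I = (\<lambda>i u :: complex ^ 'n. epowr (\<integral>\<^sup>+z. ennreal (factor (a $ i) 0 (c $ i) z u powr (q $ i)) \<partial>vol_weighted (\<beta> $ i)) (1 / q $ i))"
  obtain C where C: "0 \<le> C" "\<And>u \<eta>. norm u < 1 \<Longrightarrow> norm \<eta> < 1 \<Longrightarrow> I 1 u * I 2 \<eta>
      \<le> ennreal (C * ((1 - (norm u)\<^sup>2) powr (\<alpha> $ 1 - b $ 1) * (1 - (norm \<eta>)\<^sup>2) powr (\<alpha> $ 2 - b $ 2)))"
    by (rule factors_le_of_kernel_op_bounded[OF K \<Phi>_norm \<Phi>_cont \<alpha> q bdd])
      (auto simp: I_def intro!: that)
  \<comment> \<open>Only a lower bound is asked for, as the norm at the origin might be infinite at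
    this stage.\<close>
  have ex: "\<exists>k>0. ennreal k \<le> I i 0" for i
  proof -
    have q0: "0 < q $ i" using q[rule_format, of i] by simp
    have ne: "(\<integral>\<^sup>+z. ennreal (factor (a $ i) 0 (c $ i) z (0 :: complex ^ 'n) powr (q $ i)) \<partial>vol_weighted (\<beta> $ i)) \<noteq> 0"
      using \<beta> by (intro factor_integral_pos) auto
    show ?thesis
    proof (cases "\<integral>\<^sup>+z. ennreal (factor (a $ i) 0 (c $ i) z (0 :: complex ^ 'n) powr (q $ i)) \<partial>vol_weighted (\<beta> $ i)")
      case (real x)
      then have "0 < x" using ne by (cases "x = 0") auto
      then show ?thesis
        unfolding I_def real by (intro exI[of _ "x powr (1 / q $ i)"]) (simp add: epowr_ennreal)
    next
      case top
      then show ?thesis unfolding I_def top by (intro exI[of _ 1]) simp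
    qed
  qed
  obtain k1 k2 where k: "0 < k1" "ennreal k1 \<le> I 1 0" "0 < k2" "ennreal k2 \<le> I 2 0"
    using ex by metis
  consider "i = 1" | "i = 2" using exhaust_2 by blast
  then show ?thesis
  proof cases
    case 1
    have "I 1 u * ennreal k2 \<le> ennreal (C * (1 - (norm u)\<^sup>2) powr (\<alpha> $ 1 - b $ 1))" if "norm u < 1" for u
    proof -
      have "I 1 u * ennreal k2 \<le> I 1 u * I 2 0" by (intro mult_left_mono k) simp
      also have "\<dots> \<le> ennreal (C * (1 - (norm u)\<^sup>2) powr (\<alpha> $ 1 - b $ 1))" using C(2)[OF that, of 0] by simp
      finally show ?thesis .
    qed
    then show ?thesis
      unfolding 1 I_def using q \<beta> by (intro admissible_of_factor_le[OF _ _ k(3) C(1)]) auto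
  next
    case 2
    have "I 2 u * ennreal k1 \<le> ennreal (C * (1 - (norm u)\<^sup>2) powr (\<alpha> $ 2 - b $ 2))" if "norm u < 1" for u
    proof -
      have "I 2 u * ennreal k1 \<le> I 2 u * I 1 0" by (intro mult_left_mono k) simp
      also have "\<dots> \<le> ennreal (C * (1 - (norm u)\<^sup>2) powr (\<alpha> $ 2 - b $ 2))"
        using C(2)[OF _ that, of 0] by (simp add: mult.commute)
      finally show ?thesis .
    qed
    then show ?thesis
      unfolding 2 I_def using q \<beta> by (intro admissible_of_factor_le[OF _ _ k(1) C(1)]) auto
  qed
qed

section \<open>Relative continuity of the kernel powers and the equivalence\<close>

lemma multiplicative_perturbation:
  fixes \<Phi> h :: "complex \<Rightarrow> complex"
  assumes h: "isCont h 1" "h 1 = 1"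
    and mult: "\<And>y \<rho>. 0 < Re y \<Longrightarrow> 0 < Re \<rho> \<Longrightarrow> 0 < Re (y * \<rho>) \<Longrightarrow> \<Phi> (y * \<rho>) = \<Phi> y * h \<rho>"
  shows "\<exists>k>0. k \<le> 1/2 \<and> (\<forall>y y'. 0 < Re y \<longrightarrow> 0 < Re y' \<longrightarrow> norm (y' - y) \<le> k * norm y \<longrightarrow>
      norm (\<Phi> y' - \<Phi> y) \<le> norm (\<Phi> y) / 4)"
proof -
  obtain d where d: "0 < d" "\<And>\<rho>. dist \<rho> 1 < d \<Longrightarrow> dist (h \<rho>) (h 1) < 1/4"
    using h(1) unfolding continuous_at_eps_delta by (metis zero_less_divide_1_iff zero_less_numeral)
  define k where "k = min (d / 2) (1 / 2)"
  have k: "0 < k" "k < d" "k \<le> 1/2" using d(1) by (auto simp: k_def)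
  have "norm (\<Phi> y' - \<Phi> y) \<le> norm (\<Phi> y) / 4"
    if y: "0 < Re y" "0 < Re y'" and le: "norm (y' - y) \<le> k * norm y" for y y'
  proof -
    \<comment> \<open>By multiplicativity the relative change of \<open>\<Phi>\<close> depends on
      \<open>\<rho>\<close> alone, so continuity of \<open>h\<close> at \<open>1\<close> is uniform
      in \<open>y\<close>. The bound \<open>k \<le> 1/2\<close> keeps \<open>\<rho>\<close> in the
      right half-plane.\<close>
    define \<rho> where "\<rho> = y' / y"
    have y0: "y \<noteq> 0" using y by auto
    have y': "y' = y * \<rho>" using y0 by (simp add: \<rho>_def)
    have "norm (\<rho> - 1) = norm (y' - y) / norm y"
      using y0 by (simp add: \<rho>_def norm_divide[symmetric] diff_divide_distrib)
    also have "\<dots> \<le> k" using le y0 by (simp add: divide_le_eq)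
    finally have \<rho>: "norm (\<rho> - 1) \<le> k" .
    have "0 < Re \<rho>" using abs_Re_le_cmod[of "\<rho> - 1"] \<rho> k(3) by simp
    then have "\<Phi> y' = \<Phi> y * h \<rho>" using mult y unfolding y' by blast
    then have "\<Phi> y' - \<Phi> y = \<Phi> y * (h \<rho> - 1)" by (simp add: algebra_simps)
    moreover have "norm (h \<rho> - 1) \<le> 1/4"
      using d(2)[of \<rho>] \<rho> k(2) h(2) by (simp add: dist_norm)
    ultimately show ?thesis
      using mult_left_mono[of "norm (h \<rho> - 1)" "1/4" "norm (\<Phi> y)"] by (simp add: norm_mult)
  qed
  then show ?thesis using k by blast
qed

text \<open>Both arguments are smaller than \<open>pi / 2\<close> in absolute value, so their sum
  stays inside the principal range and no branch correction occurs.\<close>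

lemma powr_mult_halfplane:
  fixes y \<rho> s :: complex
  assumes "0 < Re y" "0 < Re \<rho>" "0 < Re (y * \<rho>)"
  shows "(y * \<rho>) powr s = y powr s * \<rho> powr s"
proof -
  have ne: "y \<noteq> 0" "\<rho> \<noteq> 0" using assms by auto
  have "\<bar>Im (Ln y)\<bar> < pi / 2" "\<bar>Im (Ln \<rho>)\<bar> < pi / 2"
    using Re_Ln_pos_lt[OF ne(1)] Re_Ln_pos_lt[OF ne(2)] assms by simp_all
  then have "Ln (y * \<rho>) = Ln y + Ln \<rho>"
    using ne by (intro Ln_unique) (auto simp: exp_add)
  then show ?thesis using ne by (simp add: powr_def exp_add distrib_left)
qed

text \<open>Sufficiency depends on the modulus of the kernel only. For necessity the two operators
  differ in \<open>\<Phi>\<close>: a power of the modulus for \<open>S\<close>, a principal power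
  for \<open>T\<close>. Each satisfies the multiplicative law with
  \<open>h = \<Phi> c\<close>.\<close>

lemma bounded_iff_admissible:
  fixes a b c \<alpha> \<beta> q :: "real ^ 2"
  assumes \<alpha>: "\<forall>i. -1 < \<alpha> $ i" and \<beta>: "\<forall>i. -1 < \<beta> $ i" and q: "\<forall>i. 1 \<le> q $ i"
  defines "adm \<equiv> \<forall>i. admissible CARD('n::finite) (a $ i) (b $ i) (c $ i) (\<alpha> $ i) (\<beta> $ i) (q $ i)"
  shows "S_bounded TYPE('n) a b c (vector [1, 1]) \<alpha> q \<beta> \<longleftrightarrow> adm"
    and "T_bounded TYPE('n) a b c (vector [1, 1]) \<alpha> q \<beta> \<longleftrightarrow> adm"
proof -
  have suff: "kernel_op_bounded a K (mixed_L (vector [1, 1]) \<alpha>) (mixed_norm (vector [1, 1]) \<alpha>) (mixed_L q \<beta>) (mixed_norm q \<beta>)"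
    if adm and K: "(\<lambda>(p, x). K p x) \<in> borel_measurable ((vol \<Otimes>\<^sub>M vol) \<Otimes>\<^sub>M (vol \<Otimes>\<^sub>M vol))"
      and norm_K: "\<And>z w u \<eta>. norm z < 1 \<Longrightarrow> norm w < 1 \<Longrightarrow> norm u < 1 \<Longrightarrow> norm \<eta> < 1 \<Longrightarrow>
        norm (K (z, w) (u, \<eta>)) = factor 0 (b $ 1) (c $ 1) z u * factor 0 (b $ 2) (c $ 2) w \<eta>"
    for K :: "'n cpair \<Rightarrow> 'n cpair \<Rightarrow> complex"
  proof -
    have "\<forall>i. \<exists>M\<ge>0. \<forall>u::complex^'n. norm u < 1 \<longrightarrow>
      (\<integral>\<^sup>+z. ennreal (factor (a $ i) (b $ i - \<alpha> $ i) (c $ i) z u powr (q $ i)) \<partial>vol_weighted (\<beta> $ i)) \<le> ennreal M"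
    proof
      fix i
      have "admissible CARD('n) (a $ i) (b $ i) (c $ i) (\<alpha> $ i) (\<beta> $ i) (q $ i)" "1 \<le> q $ i" "-1 < \<beta> $ i"
        using \<open>adm\<close> q \<beta> by (auto simp: adm_def)
      then show "\<exists>M\<ge>0. \<forall>u::complex^'n. norm u < 1 \<longrightarrow>
        (\<integral>\<^sup>+z. ennreal (factor (a $ i) (b $ i - \<alpha> $ i) (c $ i) z u powr (q $ i)) \<partial>vol_weighted (\<beta> $ i)) \<le> ennreal M"
        by (rule admissible_imp_factor_bounded) blast
    qed
    then obtain M where M: "\<And>i. 0 \<le> M i" "\<And>i (u::complex^'n). norm u < 1 \<Longrightarrow>
      (\<integral>\<^sup>+z. ennreal (factor (a $ i) (b $ i - \<alpha> $ i) (c $ i) z u powr (q $ i)) \<partial>vol_weighted (\<beta> $ i)) \<le> ennreal (M i)"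
      by metis
    have "\<alpha> $ i \<le> b $ i" for i
      using \<open>adm\<close>[unfolded adm_def, rule_format, of i] by (auto simp: admissible_def)
    then have "\<forall>i. \<alpha> $ i \<le> b $ i" ..
    then show ?thesis
      using M by (intro kernel_op_bounded_of_factors[OF K norm_K \<alpha> q, where M="\<chi> i. M i"]) auto
  qed
  show "S_bounded TYPE('n) a b c (vector [1, 1]) \<alpha> q \<beta> \<longleftrightarrow> adm"
    unfolding S_bounded_def
  proof
    assume adm
    then show "kernel_op_bounded a (S_kernel b c :: 'n cpair \<Rightarrow> _) (mixed_L (vector [1, 1]) \<alpha>) (mixed_norm (vector [1, 1]) \<alpha>) (mixed_L q \<beta>) (mixed_norm q \<beta>)"
      by (rule suff[OF _ borel_measurable_S_kernel norm_S_kernel])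
  next
    assume bdd: "kernel_op_bounded a (S_kernel b c :: 'n cpair \<Rightarrow> _) (mixed_L (vector [1, 1]) \<alpha>) (mixed_norm (vector [1, 1]) \<alpha>) (mixed_L q \<beta>) (mixed_norm q \<beta>)"
    define \<Phi> where "\<Phi> = (\<lambda>c (y::complex). complex_of_real (norm y powr (- c)))"
    show adm
      unfolding adm_def
    proof (intro allI kernel_op_bounded_imp_admissible[OF _ _ _ \<alpha> \<beta> q bdd, where \<Phi>=\<Phi>])
      show "S_kernel b c (z, w) (u, \<eta>) = of_real ((1 - (norm u)\<^sup>2) powr (b $ 1) * (1 - (norm \<eta>)\<^sup>2) powr (b $ 2)) *
        (\<Phi> (c $ 1) (1 - herm z u) * \<Phi> (c $ 2) (1 - herm w \<eta>))" for z w u \<eta> :: "complex ^ 'n"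
        by (simp add: S_kernel_def \<Phi>_def powr_minus divide_inverse)
      show "norm (\<Phi> c y) = norm y powr (- c)" for c y by (simp add: \<Phi>_def)
      show "\<exists>k>0. k \<le> 1/2 \<and> (\<forall>y y'. 0 < Re y \<longrightarrow> 0 < Re y' \<longrightarrow> norm (y' - y) \<le> k * norm y \<longrightarrow>
        norm (\<Phi> c y' - \<Phi> c y) \<le> norm (\<Phi> c y) / 4)" for c
      proof (rule multiplicative_perturbation[where h="\<Phi> c"])
        show "isCont (\<Phi> c) 1" unfolding \<Phi>_def by (intro continuous_intros) auto
      qed (auto simp: \<Phi>_def norm_mult powr_mult)
    qed
  qed
  show "T_bounded TYPE('n) a b c (vector [1, 1]) \<alpha> q \<beta> \<longleftrightarrow> adm"
    unfolding T_bounded_def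
  proof
    assume adm
    then show "kernel_op_bounded a (T_kernel b c :: 'n cpair \<Rightarrow> _) (mixed_L (vector [1, 1]) \<alpha>) (mixed_norm (vector [1, 1]) \<alpha>) (mixed_L q \<beta>) (mixed_norm q \<beta>)"
      by (rule suff[OF _ borel_measurable_T_kernel norm_T_kernel])
  next
    assume bdd: "kernel_op_bounded a (T_kernel b c :: 'n cpair \<Rightarrow> _) (mixed_L (vector [1, 1]) \<alpha>) (mixed_norm (vector [1, 1]) \<alpha>) (mixed_L q \<beta>) (mixed_norm q \<beta>)"
    define \<Phi> where "\<Phi> = (\<lambda>c (y::complex). y powr (- complex_of_real c))"
    show adm
      unfolding adm_def
    proof (intro allI kernel_op_bounded_imp_admissible[OF _ _ _ \<alpha> \<beta> q bdd, where \<Phi>=\<Phi>])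
      show "T_kernel b c (z, w) (u, \<eta>) = of_real ((1 - (norm u)\<^sup>2) powr (b $ 1) * (1 - (norm \<eta>)\<^sup>2) powr (b $ 2)) *
        (\<Phi> (c $ 1) (1 - herm z u) * \<Phi> (c $ 2) (1 - herm w \<eta>))" for z w u \<eta> :: "complex ^ 'n"
        by (simp add: T_kernel_def \<Phi>_def powr_minus divide_inverse)
      show "norm (\<Phi> c y) = norm y powr (- c)" for c y
        by (simp add: \<Phi>_def norm_powr_real_powr')
      show "\<exists>k>0. k \<le> 1/2 \<and> (\<forall>y y'. 0 < Re y \<longrightarrow> 0 < Re y' \<longrightarrow> norm (y' - y) \<le> k * norm y \<longrightarrow>
        norm (\<Phi> c y' - \<Phi> c y) \<le> norm (\<Phi> c y) / 4)" for c
      proof (rule multiplicative_perturbation[where h="\<Phi> c"])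
        show "isCont (\<Phi> c) 1" unfolding \<Phi>_def by (intro continuous_intros) auto
      qed (auto simp: \<Phi>_def powr_mult_halfplane)
    qed
  qed
qed

theorem theorem1p6:
  fixes a b c \<alpha> \<beta> q :: "real ^ 2"
  assumes "\<forall>i. \<alpha> $ i > -1"
    and "\<forall>i. \<beta> $ i > -1"
    and "\<forall>i. q $ i \<ge> 1"
  shows
    "(S_bounded TYPE('n::finite) a b c (vector [1, 1]) \<alpha> q \<beta> \<longleftrightarrow>
      T_bounded TYPE('n) a b c (vector [1, 1]) \<alpha> q \<beta>) \<and>
     (T_bounded TYPE('n) a b c (vector [1, 1]) \<alpha> q \<beta> \<longleftrightarrow>
       (\<forall>i. - (q $ i * a $ i) < \<beta> $ i + 1 \<and> \<alpha> $ i < b $ i \<and>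
            c $ i \<le> a $ i + b $ i - \<alpha> $ i + (real CARD('n) + 1 + \<beta> $ i) / q $ i) \<or>
       (\<forall>i. - (q $ i * a $ i) < \<beta> $ i + 1 \<and> \<alpha> $ i = b $ i \<and>
            c $ i < a $ i + (real CARD('n) + 1 + \<beta> $ i) / q $ i) \<or>
       ((\<forall>i. - (q $ i * a $ i) < \<beta> $ i + 1) \<and>
         \<alpha> $ 1 = b $ 1 \<and>
         c $ 1 < a $ 1 + (real CARD('n) + 1 + \<beta> $ 1) / q $ 1 \<and>
         \<alpha> $ 2 < b $ 2 \<and>
         c $ 2 \<le> a $ 2 + b $ 2 - \<alpha> $ 2 + (real CARD('n) + 1 + \<beta> $ 2) / q $ 2) \<or>
       ((\<forall>i. - (q $ i * a $ i) < \<beta> $ i + 1) \<and>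
         \<alpha> $ 1 < b $ 1 \<and>
         c $ 1 \<le> a $ 1 + b $ 1 - \<alpha> $ 1 + (real CARD('n) + 1 + \<beta> $ 1) / q $ 1 \<and>
         \<alpha> $ 2 = b $ 2 \<and>
         c $ 2 < a $ 2 + (real CARD('n) + 1 + \<beta> $ 2) / q $ 2))"
proof -
  let ?adm = "\<forall>i. admissible CARD('n) (a $ i) (b $ i) (c $ i) (\<alpha> $ i) (\<beta> $ i) (q $ i)"
  have "S_bounded TYPE('n) a b c (vector [1, 1]) \<alpha> q \<beta> \<longleftrightarrow> ?adm"
    "T_bounded TYPE('n) a b c (vector [1, 1]) \<alpha> q \<beta> \<longleftrightarrow> ?adm"
    using assms by (intro bounded_iff_admissible; simp)+
  then show ?thesis
    unfolding forall_2 admissible_def by argo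
qed

end
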